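(* Let $s_1,s_2\in\overline{\mathbf R_{\flat,\infty}}$, $s=(s_2,s_1)$, $W=\mathbf C^{d_2}\times\mathbf C^{d_1}$ and let $B_j$ be a complex $d_j\times d_j$ matrix, $j=1,2$. Consider the pullbacks $$\text{(a) }K(z_2,z_1)\mapsto K(z_2,B_1z_1),\qquad\text{(b) }K(z_2,z_1)\mapsto K(B_2z_2,z_1),\qquad\text{(c) }K(z_2,z_1)\mapsto K(B_2z_2,B_1z_1).$$ Let (R) be the list of spaces $\widehat{\mathcal A}_s(W),\widehat{\mathcal A}_s^\star(W),\widehat{\mathcal B}_s(W),\widehat{\mathcal B}_s^\star(W),\widehat{\mathcal C}_s(W),\widehat{\mathcal C}_s^\star(W)$ and (B) the list $\widehat{\mathcal A}_{0,s}(W),\widehat{\mathcal A}_{0,s}^\star(W),\widehat{\mathcal B}_{0,s}(W),\widehat{\mathcal B}_{0,s}^\star(W),\widehat{\mathcal C}_{0,s}(W),\widehat{\mathcal C}_{0,s}^\star(W)$. Then the following is true: (1) the map (c) on $\widehat A(W)$ extends uniquely to a continuous map on $\widehat{\mathcal A}_0'(W)$; (2) if in addition $s_1<\frac12$ (respectively $0<s_1\le\frac12$), then (a) on $\widehat{\mathcal A}_0'(W)$ restricts to continuous mappings on each of the spaces in (R) (respectively in (B)); (3) if in addition $s_2<\frac12$ (respectively $0<s_2\le\frac12$), then (b) on $\widehat{\mathcal A}_0'(W)$ restricts to continuous mappings on each of the spaces in (R) (respectively in (B)); (4) if in addition $s_1,s_2<\frac12$ (respectively $0<s_1,s_2\le\frac12$),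 then (c) on $\widehat{\mathcal A}_0'(W)$ restricts to continuous mappings on each of the spaces in (R) (respectively in (B)).
   Context: **Indices and weights.** $\mathbf N=\{0,1,2,\dots\}$. $\overline{\mathbf R_{\flat,\infty}}=[0,\infty]\cup\{\flat_\sigma:\sigma>0\}$, where the $\flat_\sigma$ are formal symbols, ordered so that $x_1<\flat_{\sigma_1}<\flat_{\sigma_2}<x_2$ whenever $x_1<\frac12\le x_2$ and $\sigma_1<\sigma_2$. For $r>0$ and a multi-index $\alpha$: $\vartheta_{r,s}(\alpha)=e^{r|\alpha|^{1/(2s)}}$ if $s\in(0,\infty)$; $\vartheta_{r,s}(\alpha)=r^{|\alpha|}(\alpha!)^{1/(2\sigma)}$ if $s=\flat_\sigma$; $\vartheta_{r,\infty}(\alpha)=(1+|\alpha|^2)^{r/2}$; $\vartheta_{r,0}(\alpha)=1$ if $|\alpha|\le r$ and $=\infty$ if $|\alpha|>r$. Conventions: $a/\infty=0$ for all $a\in(0,\infty]$, $\infty\cdot0=0$. For $\omega:\Lambda\to[0,\infty]$, $\ell_{[\omega]}(\Lambda)$ is the set of $c:\Lambda\to\mathbf C$ with $\|c\,\omega\|_{\ell^2(\Lambda)}<\infty$, with this (semi-)norm (except for the (R)-type spaces below with $s_1=\infty$ or $s_2=\infty$, replacing $\ell^2$ by any $\ell^p$, $p\in(0,\infty]$, gives the same limit spaces). **Spaces.** For $\alpha=(\alpha_2,\alpha_1)\in\Lambda=\mathbf N^{d_2}\times\mathbf N^{d_1}$ put $\vartheta_r(\alpha)=\vartheta_{r,s_2}(\alpha_2)\vartheta_{r,s_1}(\alpha_1)$,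 $\omega_{r_2,r_1}(\alpha)=\vartheta_{r_2,s_2}(\alpha_2)/\vartheta_{r_1,s_1}(\alpha_1)$, $\omega^\star_{r_2,r_1}(\alpha)=\vartheta_{r_1,s_1}(\alpha_1)/\vartheta_{r_2,s_2}(\alpha_2)$. With limits over positive parameters: $\ell_{\mathcal A,s}=\operatorname{ind\,lim}_r\ell_{[\vartheta_r]}$, $\ell_{\mathcal A,s}^\star=\operatorname{proj\,lim}_r\ell_{[1/\vartheta_r]}$, $\ell_{\mathcal A,0,s}=\operatorname{proj\,lim}_r\ell_{[\vartheta_r]}$, $\ell_{\mathcal A,0,s}^\star=\operatorname{ind\,lim}_r\ell_{[1/\vartheta_r]}$; $\ell_{\mathcal B,s}=\operatorname{proj\,lim}_{r_1}\operatorname{ind\,lim}_{r_2}\ell_{[\omega_{r_2,r_1}]}$, $\ell_{\mathcal B,0,s}=\operatorname{proj\,lim}_{r_2}\operatorname{ind\,lim}_{r_1}\ell_{[\omega_{r_2,r_1}]}$, $\ell_{\mathcal B,s}^\star=\operatorname{proj\,lim}_{r_2}\operatorname{ind\,lim}_{r_1}\ell_{[\omega^\star_{r_2,r_1}]}$, $\ell_{\mathcal B,0,s}^\star=\operatorname{proj\,lim}_{r_1}\operatorname{ind\,lim}_{r_2}\ell_{[\omega^\star_{r_2,r_1}]}$; $\ell_{\mathcal C,s}=\operatorname{ind\,lim}_{r_2}\operatorname{proj\,lim}_{r_1}\ell_{[\omega_{r_2,r_1}]}$, $\ell_{\mathcal C,0,s}=\operatorname{ind\,lim}_{r_1}\operatorname{proj\,lim}_{r_2}\ell_{[\omega_{r_2,r_1}]}$,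 $\ell_{\mathcal C,s}^\star=\operatorname{ind\,lim}_{r_1}\operatorname{proj\,lim}_{r_2}\ell_{[\omega^\star_{r_2,r_1}]}$, $\ell_{\mathcal C,0,s}^\star=\operatorname{ind\,lim}_{r_2}\operatorname{proj\,lim}_{r_1}\ell_{[\omega^\star_{r_2,r_1}]}$. If $s_1=0$ or $s_2=0$, all spaces with a subscript "$0,s$" are by definition $\{0\}$. As sets, projective/inductive limits are intersections/unions. With $e_\alpha(z)=z^\alpha/\sqrt{\alpha!}$, the spaces $\widehat{\mathcal A}_s(W),\widehat{\mathcal A}_s^\star(W),\widehat{\mathcal B}_s(W)$, etc. consist of the formal series $K(z_2,z_1)=\sum c(K;\alpha_2,\alpha_1)e_{\alpha_2}(z_2)e_{\alpha_1}(\overline{z_1})$ with coefficients in the sequence space with the same decorations, with transported topology. $\widehat{\mathcal A}_0'(W)$ is the space of all such formal series, with the topology of coefficientwise convergence. $\widehat A(W)$ is the set of functions $K$ on $W$ such that $(z_2,z_1)\mapsto K(z_2,\overline{z_1})$ is entire. In (2) and (3), (a) and (b) on $\widehat{\mathcal A}_0'(W)$ are the special cases $B_2=I$ and $B_1=I$ of the extension in (1).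
   Formalization: When exactly one of s_1, s_2 is 0, the limits defining Â_s and Â_s^⋆ are taken over independent r_2, r_1 > 0 instead of one common r; with a single r the claim is false (e.g. s_2=0, 0<s_1<1/2, B_1=2) and the union is not a vector space. *)

theory Defs
  imports "HOL-Analysis.Analysis"
begin

section \<open>The index set\<close>

text \<open>
  The datatype is slightly too large: \<open>Flat \<sigma>\<close> is meant only for \<open>\<sigma> > 0\<close>, and \<open>flat_indices\<close>
  is the actual index set.
\<close>

datatype gs_index = Num ennreal | Flat real

definition flat_indices :: "gs_index set" where
  "flat_indices = range Num \<union> Flat ` {0<..}"

instantiation gs_index :: linorder
begin

fun less_gs_index :: "gs_index \<Rightarrow> gs_index \<Rightarrow> bool" where
  "less_gs_index (Num x) (Num y) \<longleftrightarrow> x < y"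
| "less_gs_index (Flat \<sigma>) (Flat \<tau>) \<longleftrightarrow> \<sigma> < \<tau>"
| "less_gs_index (Num x) (Flat \<sigma>) \<longleftrightarrow> x < 1/2"
| "less_gs_index (Flat \<sigma>) (Num x) \<longleftrightarrow> 1/2 \<le> x"

definition less_eq_gs_index :: "gs_index \<Rightarrow> gs_index \<Rightarrow> bool" where
  "less_eq_gs_index x y \<longleftrightarrow> x < y \<or> x = y"

instance
proof
  fix x y z :: gs_index
  show "x < y \<longleftrightarrow> x \<le> y \<and> \<not> y \<le> x"
    by (cases x; cases y) (auto simp: less_eq_gs_index_def)
  show "x \<le> x"
    by (simp add: less_eq_gs_index_def)
  show "x \<le> z" if "x \<le> y" "y \<le> z"
    using that by (cases x; cases y; cases z) (auto simp: less_eq_gs_index_def)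
  show "x = y" if "x \<le> y" "y \<le> x"
    using that by (cases x; cases y) (auto simp: less_eq_gs_index_def)
  show "x \<le> y \<or> y \<le> x"
    by (cases x; cases y) (auto simp: less_eq_gs_index_def)
qed

end


section \<open>Multi-indices and weights\<close>

definition mi_size :: "nat ^ 'n::finite \<Rightarrow> nat" where
  "mi_size \<alpha> = (\<Sum>i\<in>UNIV. \<alpha> $ i)"

definition mi_fact :: "nat ^ 'n::finite \<Rightarrow> real" where
  "mi_fact \<alpha> = (\<Prod>i\<in>UNIV. fact (\<alpha> $ i))"

fun wt :: "real \<Rightarrow> gs_index \<Rightarrow> nat ^ 'n::finite \<Rightarrow> ennreal" where
  "wt r (Num s) \<alpha> =
     (if s = 0 then (if real (mi_size \<alpha>) \<le> r then 1 else \<infinity>)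
      else if s = \<infinity> then ennreal ((1 + (real (mi_size \<alpha>))\<^sup>2) powr (r / 2))
      else ennreal (exp (r * real (mi_size \<alpha>) powr (1 / (2 * enn2real s)))))"
| "wt r (Flat \<sigma>) \<alpha> = ennreal (r ^ mi_size \<alpha> * mi_fact \<alpha> powr (1 / (2 * \<sigma>)))"


section \<open>Weighted sequence spaces and their limits\<close>

text \<open>
  Arithmetic on \<^typ>\<open>ennreal\<close> satisfies \<open>a / \<infinity> = 0\<close> (also for \<open>a = \<infinity>\<close>) and \<open>\<infinity> * 0 = 0\<close>, so a
  sequence of finite energy vanishes wherever the weight is infinite, and the values of a sequence
  where the weight is zero do not enter its seminorm.
\<close>

definition ell_energy :: "('a \<Rightarrow> ennreal) \<Rightarrow> ('a \<Rightarrow> complex) \<Rightarrow> ennreal" where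
  "ell_energy \<omega> c = (\<Sum>\<^sub>\<infinity>\<alpha>. (ennreal (cmod (c \<alpha>)) * \<omega> \<alpha>)\<^sup>2)"

definition ell_carrier :: "('a \<Rightarrow> ennreal) \<Rightarrow> ('a \<Rightarrow> complex) set" where
  "ell_carrier \<omega> = {c. ell_energy \<omega> c < \<infinity>}"

definition ell_norm :: "('a \<Rightarrow> ennreal) \<Rightarrow> ('a \<Rightarrow> complex) \<Rightarrow> real" where
  "ell_norm \<omega> c = sqrt (enn2real (ell_energy \<omega> c))"

definition ell_ball ::
    "('a \<Rightarrow> ennreal) \<Rightarrow> ('a \<Rightarrow> complex) \<Rightarrow> real \<Rightarrow> ('a \<Rightarrow> complex) set" where
  "ell_ball \<omega> x \<epsilon> = {y \<in> ell_carrier \<omega>. ell_norm \<omega> (\<lambda>\<alpha>. y \<alpha> - x \<alpha>) < \<epsilon>}"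

definition ell :: "('a \<Rightarrow> ennreal) \<Rightarrow> ('a \<Rightarrow> complex) topology" where
  "ell \<omega> = topology_generated_by {ell_ball \<omega> x \<epsilon> | x \<epsilon>. x \<in> ell_carrier \<omega> \<and> 0 < \<epsilon>}"

text \<open>
  Limits along families of topologies on linear subspaces of \<open>'a \<Rightarrow> complex\<close>, all connecting maps
  being inclusions. The projective limit carries the initial topology on the intersection.
  The inductive limit is the locally convex one: a neighbourhood base of 0 is given by the
  absolutely convex sets which contain a neighbourhood of 0 of every step.
\<close>

definition proj_lim ::
    "'i set \<Rightarrow> ('i \<Rightarrow> ('a \<Rightarrow> complex) topology) \<Rightarrow> ('a \<Rightarrow> complex) topology" where
  "proj_lim I X = topology_generated_by
     {U \<inter> (\<Inter>j\<in>I. topspace (X j)) | U i. i \<in> I \<and> openin (X i) U}"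

definition absconvex :: "('a \<Rightarrow> complex) set \<Rightarrow> bool" where
  "absconvex V \<longleftrightarrow> (\<forall>x\<in>V. \<forall>y\<in>V. \<forall>a b. cmod a + cmod b \<le> 1 \<longrightarrow> (\<lambda>\<alpha>. a * x \<alpha> + b * y \<alpha>) \<in> V)"

definition ind_lim_nhd0 ::
    "'i set \<Rightarrow> ('i \<Rightarrow> ('a \<Rightarrow> complex) topology) \<Rightarrow> ('a \<Rightarrow> complex) set \<Rightarrow> bool" where
  "ind_lim_nhd0 I X V \<longleftrightarrow> V \<subseteq> (\<Union>i\<in>I. topspace (X i)) \<and> absconvex V \<and>
     (\<forall>i\<in>I. \<exists>N. openin (X i) N \<and> (\<lambda>_. 0) \<in> N \<and> N \<subseteq> V)"

definition ind_lim ::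
    "'i set \<Rightarrow> ('i \<Rightarrow> ('a \<Rightarrow> complex) topology) \<Rightarrow> ('a \<Rightarrow> complex) topology" where
  "ind_lim I X = topology (\<lambda>U. U \<subseteq> (\<Union>i\<in>I. topspace (X i)) \<and>
     (\<forall>x\<in>U. \<exists>V. ind_lim_nhd0 I X V \<and> (\<forall>v\<in>V. (\<lambda>\<alpha>. x \<alpha> + v \<alpha>) \<in> U)))"

lemma ell_energy_zero [simp]: "ell_energy \<omega> (\<lambda>_. 0) = 0"
  by (simp add: ell_energy_def)

lemma topspace_ell: "topspace (ell \<omega>) = ell_carrier \<omega>"
proof -
  have "x \<in> ell_ball \<omega> x 1" if "x \<in> ell_carrier \<omega>" for x
    using that by (simp add: ell_ball_def ell_norm_def)
  then have "ell_carrier \<omega> \<subseteq> topspace (ell \<omega>)"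
    unfolding ell_def topology_generated_by_topspace using zero_less_one by blast
  moreover have "topspace (ell \<omega>) \<subseteq> ell_carrier \<omega>"
    unfolding ell_def topology_generated_by_topspace ell_ball_def by blast
  ultimately show ?thesis
    by blast
qed

lemma topspace_proj_lim:
  assumes "I \<noteq> {}"
  shows "topspace (proj_lim I X) = (\<Inter>i\<in>I. topspace (X i))"
proof
  show "topspace (proj_lim I X) \<subseteq> (\<Inter>i\<in>I. topspace (X i))"
    unfolding proj_lim_def topology_generated_by_topspace by blast
  obtain i where i: "i \<in> I"
    using assms by blast
  have "(\<Inter>j\<in>I. topspace (X j)) = topspace (X i) \<inter> (\<Inter>j\<in>I. topspace (X j))"
    using i by blast
  then have "(\<Inter>j\<in>I. topspace (X j)) \<in> {U \<inter> (\<Inter>j\<in>I. topspace (X j)) | U i. i \<in> I \<and> openin (X i) U}"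
    using i openin_topspace[of "X i"] by blast
  then show "(\<Inter>i\<in>I. topspace (X i)) \<subseteq> topspace (proj_lim I X)"
    unfolding proj_lim_def topology_generated_by_topspace by (rule Union_upper)
qed

lemma ind_lim_nhd0_Int:
  assumes "ind_lim_nhd0 I X V" "ind_lim_nhd0 I X W"
  shows "ind_lim_nhd0 I X (V \<inter> W)"
proof -
  have "\<exists>N. openin (X i) N \<and> (\<lambda>_. 0) \<in> N \<and> N \<subseteq> V \<inter> W" if "i \<in> I" for i
  proof -
    obtain M N where "openin (X i) M" "(\<lambda>_. 0) \<in> M" "M \<subseteq> V"
      and "openin (X i) N" "(\<lambda>_. 0) \<in> N" "N \<subseteq> W"
      using assms \<open>i \<in> I\<close> unfolding ind_lim_nhd0_def by meson
    then show ?thesis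
      by (intro exI[of _ "M \<inter> N"]) auto
  qed
  then show ?thesis
    using assms unfolding ind_lim_nhd0_def absconvex_def by blast
qed

lemma openin_ind_lim:
  "openin (ind_lim I X) U \<longleftrightarrow> U \<subseteq> (\<Union>i\<in>I. topspace (X i)) \<and>
     (\<forall>x\<in>U. \<exists>V. ind_lim_nhd0 I X V \<and> (\<forall>v\<in>V. (\<lambda>\<alpha>. x \<alpha> + v \<alpha>) \<in> U))"
proof -
  define Q where "Q x U \<longleftrightarrow> (\<exists>V. ind_lim_nhd0 I X V \<and> (\<forall>v\<in>V. (\<lambda>\<alpha>. x \<alpha> + v \<alpha>) \<in> U))" for x U
  define C where "C = (\<Union>i\<in>I. topspace (X i))"
  have Q_Int: "Q x (S \<inter> T)" if S: "Q x S" and T: "Q x T" for x S T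
  proof -
    obtain V where V: "ind_lim_nhd0 I X V" "\<And>v. v \<in> V \<Longrightarrow> (\<lambda>\<alpha>. x \<alpha> + v \<alpha>) \<in> S"
      using S unfolding Q_def by auto
    obtain W where W: "ind_lim_nhd0 I X W" "\<And>v. v \<in> W \<Longrightarrow> (\<lambda>\<alpha>. x \<alpha> + v \<alpha>) \<in> T"
      using T unfolding Q_def by auto
    show ?thesis
      unfolding Q_def using V W by (intro exI[of _ "V \<inter> W"]) (simp add: ind_lim_nhd0_Int)
  qed
  have Q_mono: "Q x T" if "Q x S" and "S \<subseteq> T" for x S T
    using that unfolding Q_def by (auto simp: subset_iff)
  have "istopology (\<lambda>U. U \<subseteq> C \<and> (\<forall>x\<in>U. Q x U))"
    unfolding istopology_def
  proof (rule conjI; intro allI impI)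
    show "S \<inter> T \<subseteq> C \<and> (\<forall>x\<in>S \<inter> T. Q x (S \<inter> T))"
      if "S \<subseteq> C \<and> (\<forall>x\<in>S. Q x S)" "T \<subseteq> C \<and> (\<forall>x\<in>T. Q x T)" for S T
      using that by (simp add: Q_Int le_infI1)
    show "\<Union>\<K> \<subseteq> C \<and> (\<forall>x\<in>\<Union>\<K>. Q x (\<Union>\<K>))" if "\<forall>K\<in>\<K>. K \<subseteq> C \<and> (\<forall>x\<in>K. Q x K)" for \<K>
    proof
      show "\<Union>\<K> \<subseteq> C"
        using that by (simp add: Sup_least)
      show "\<forall>x\<in>\<Union>\<K>. Q x (\<Union>\<K>)"
      proof
        fix x assume "x \<in> \<Union>\<K>"
        then obtain K where "K \<in> \<K>" "x \<in> K"
          by (rule UnionE)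
        then show "Q x (\<Union>\<K>)"
          using that Q_mono[of x K "\<Union>\<K>"] by (simp add: Union_upper)
      qed
    qed
  qed
  then show ?thesis
    unfolding ind_lim_def Q_def C_def by (simp only: topology_inverse')
qed


section \<open>The spaces of formal kernel series\<close>

text \<open>
  A formal series \<open>\<Sum> c(\<alpha>\<^sub>2, \<alpha>\<^sub>1) e\<^bsub>\<alpha>\<^sub>2\<^esub>(z\<^sub>2) e\<^bsub>\<alpha>\<^sub>1\<^esub>(cnj z\<^sub>1)\<close> is represented by its coefficient family \<open>c\<close>.
  The spaces of series therefore coincide with the corresponding sequence spaces, and
  coefficientwise convergence is the product topology, that is, the canonical topology of the
  function type.
\<close>

type_synonym ('d2, 'd1) kernel_series = "(nat ^ 'd2) \<times> (nat ^ 'd1) \<Rightarrow> complex"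

definition wt_A :: "gs_index \<Rightarrow> gs_index \<Rightarrow> real \<Rightarrow> real \<Rightarrow>
    (nat ^ 'd2::finite) \<times> (nat ^ 'd1::finite) \<Rightarrow> ennreal" where
  "wt_A s2 s1 r2 r1 = (\<lambda>(\<alpha>2, \<alpha>1). wt r2 s2 \<alpha>2 * wt r1 s1 \<alpha>1)"

definition wt_A_dual :: "gs_index \<Rightarrow> gs_index \<Rightarrow> real \<Rightarrow> real \<Rightarrow>
    (nat ^ 'd2::finite) \<times> (nat ^ 'd1::finite) \<Rightarrow> ennreal" where
  "wt_A_dual s2 s1 r2 r1 = (\<lambda>\<alpha>. 1 / wt_A s2 s1 r2 r1 \<alpha>)"

definition wt_B :: "gs_index \<Rightarrow> gs_index \<Rightarrow> real \<Rightarrow> real \<Rightarrow>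
    (nat ^ 'd2::finite) \<times> (nat ^ 'd1::finite) \<Rightarrow> ennreal" where
  "wt_B s2 s1 r2 r1 = (\<lambda>(\<alpha>2, \<alpha>1). wt r2 s2 \<alpha>2 / wt r1 s1 \<alpha>1)"

definition wt_B_dual :: "gs_index \<Rightarrow> gs_index \<Rightarrow> real \<Rightarrow> real \<Rightarrow>
    (nat ^ 'd2::finite) \<times> (nat ^ 'd1::finite) \<Rightarrow> ennreal" where
  "wt_B_dual s2 s1 r2 r1 = (\<lambda>(\<alpha>2, \<alpha>1). wt r1 s1 \<alpha>1 / wt r2 s2 \<alpha>2)"

text \<open>
  The spaces \<open>space_A\<close> and \<open>space_A_dual\<close> are limits over one common parameter \<open>r\<close>, except when
  exactly one of the two indices is 0. For index 0 the spaces \<open>ell (wt r s)\<close> grow with \<open>r\<close>, whereas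
  they shrink for all other indices. In the mixed case the one-parameter family is hence not
  directed, its union is not a vector space, and neither limit set is invariant under dilations of the
  variable with nonzero index. There the limit is taken over independent \<open>r\<^sub>2\<close> and \<open>r\<^sub>1\<close>; in
  all other cases this would not change the limit, the diagonal being cofinal.
\<close>

definition mixed_zero :: "gs_index \<Rightarrow> gs_index \<Rightarrow> bool" where
  "mixed_zero s2 s1 \<longleftrightarrow> (s2 = Num 0) \<noteq> (s1 = Num 0)"

definition space_A ::
    "gs_index \<Rightarrow> gs_index \<Rightarrow> ('d2::finite, 'd1::finite) kernel_series topology" where
  "space_A s2 s1 =
     (if mixed_zero s2 s1
      then ind_lim ({0<..} \<times> {0<..}) (\<lambda>(r2, r1). ell (wt_A s2 s1 r2 r1))
      else ind_lim {0<..} (\<lambda>r. ell (wt_A s2 s1 r r)))"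

definition space_A_dual ::
    "gs_index \<Rightarrow> gs_index \<Rightarrow> ('d2::finite, 'd1::finite) kernel_series topology" where
  "space_A_dual s2 s1 =
     (if mixed_zero s2 s1
      then proj_lim ({0<..} \<times> {0<..}) (\<lambda>(r2, r1). ell (wt_A_dual s2 s1 r2 r1))
      else proj_lim {0<..} (\<lambda>r. ell (wt_A_dual s2 s1 r r)))"

definition space_B ::
    "gs_index \<Rightarrow> gs_index \<Rightarrow> ('d2::finite, 'd1::finite) kernel_series topology" where
  "space_B s2 s1 = proj_lim {0<..} (\<lambda>r1. ind_lim {0<..} (\<lambda>r2. ell (wt_B s2 s1 r2 r1)))"

definition space_B_dual ::
    "gs_index \<Rightarrow> gs_index \<Rightarrow> ('d2::finite, 'd1::finite) kernel_series topology" where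
  "space_B_dual s2 s1 = proj_lim {0<..} (\<lambda>r2. ind_lim {0<..} (\<lambda>r1. ell (wt_B_dual s2 s1 r2 r1)))"

definition space_C ::
    "gs_index \<Rightarrow> gs_index \<Rightarrow> ('d2::finite, 'd1::finite) kernel_series topology" where
  "space_C s2 s1 = ind_lim {0<..} (\<lambda>r2. proj_lim {0<..} (\<lambda>r1. ell (wt_B s2 s1 r2 r1)))"

definition space_C_dual ::
    "gs_index \<Rightarrow> gs_index \<Rightarrow> ('d2::finite, 'd1::finite) kernel_series topology" where
  "space_C_dual s2 s1 = ind_lim {0<..} (\<lambda>r1. proj_lim {0<..} (\<lambda>r2. ell (wt_B_dual s2 s1 r2 r1)))"

definition zero_unless :: "bool \<Rightarrow> ('a \<Rightarrow> complex) topology \<Rightarrow> ('a \<Rightarrow> complex) topology" where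
  "zero_unless P X = (if P then X else discrete_topology {\<lambda>_. 0})"

definition both_nonzero :: "gs_index \<Rightarrow> gs_index \<Rightarrow> bool" where
  "both_nonzero s2 s1 \<longleftrightarrow> s2 \<noteq> Num 0 \<and> s1 \<noteq> Num 0"

definition space_A0 ::
    "gs_index \<Rightarrow> gs_index \<Rightarrow> ('d2::finite, 'd1::finite) kernel_series topology" where
  "space_A0 s2 s1 = zero_unless (both_nonzero s2 s1)
     (proj_lim {0<..} (\<lambda>r. ell (wt_A s2 s1 r r)))"

definition space_A0_dual ::
    "gs_index \<Rightarrow> gs_index \<Rightarrow> ('d2::finite, 'd1::finite) kernel_series topology" where
  "space_A0_dual s2 s1 = zero_unless (both_nonzero s2 s1)
     (ind_lim {0<..} (\<lambda>r. ell (wt_A_dual s2 s1 r r)))"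

definition space_B0 ::
    "gs_index \<Rightarrow> gs_index \<Rightarrow> ('d2::finite, 'd1::finite) kernel_series topology" where
  "space_B0 s2 s1 = zero_unless (both_nonzero s2 s1)
     (proj_lim {0<..} (\<lambda>r2. ind_lim {0<..} (\<lambda>r1. ell (wt_B s2 s1 r2 r1))))"

definition space_B0_dual ::
    "gs_index \<Rightarrow> gs_index \<Rightarrow> ('d2::finite, 'd1::finite) kernel_series topology" where
  "space_B0_dual s2 s1 = zero_unless (both_nonzero s2 s1)
     (proj_lim {0<..} (\<lambda>r1. ind_lim {0<..} (\<lambda>r2. ell (wt_B_dual s2 s1 r2 r1))))"

definition space_C0 ::
    "gs_index \<Rightarrow> gs_index \<Rightarrow> ('d2::finite, 'd1::finite) kernel_series topology" where
  "space_C0 s2 s1 = zero_unless (both_nonzero s2 s1)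
     (ind_lim {0<..} (\<lambda>r1. proj_lim {0<..} (\<lambda>r2. ell (wt_B s2 s1 r2 r1))))"

definition space_C0_dual ::
    "gs_index \<Rightarrow> gs_index \<Rightarrow> ('d2::finite, 'd1::finite) kernel_series topology" where
  "space_C0_dual s2 s1 = zero_unless (both_nonzero s2 s1)
     (ind_lim {0<..} (\<lambda>r2. proj_lim {0<..} (\<lambda>r1. ell (wt_B_dual s2 s1 r2 r1))))"

definition spaces_R ::
    "gs_index \<Rightarrow> gs_index \<Rightarrow> ('d2::finite, 'd1::finite) kernel_series topology set" where
  "spaces_R s2 s1 = {space_A s2 s1, space_A_dual s2 s1, space_B s2 s1, space_B_dual s2 s1,
     space_C s2 s1, space_C_dual s2 s1}"

definition spaces_B ::
    "gs_index \<Rightarrow> gs_index \<Rightarrow> ('d2::finite, 'd1::finite) kernel_series topology set" where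
  "spaces_B s2 s1 = {space_A0 s2 s1, space_A0_dual s2 s1, space_B0 s2 s1, space_B0_dual s2 s1,
     space_C0 s2 s1, space_C0_dual s2 s1}"


section \<open>Entire kernels and linear pullbacks\<close>

text \<open>
  Entire functions of several variables: complex differentiable at every point, i.e. with a
  complex linear Frechet derivative.
\<close>

definition entire :: "((complex ^ 'd2::finite) \<times> (complex ^ 'd1::finite) \<Rightarrow> complex) \<Rightarrow> bool" where
  "entire f \<longleftrightarrow> (\<forall>z. \<exists>f'. (f has_derivative f') (at z) \<and>
     (\<forall>a v2 v1. f' (a *s v2, a *s v1) = a * f' (v2, v1)))"

definition cnj_vec :: "complex ^ 'n::finite \<Rightarrow> complex ^ 'n" where
  "cnj_vec z = (\<chi> i. cnj (z $ i))"

definition entire_kernels ::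
    "((complex ^ 'd2::finite) \<times> (complex ^ 'd1::finite) \<Rightarrow> complex) set" where
  "entire_kernels = {K. entire (\<lambda>(z2, z1). K (z2, cnj_vec z1))}"

definition herm :: "nat ^ 'n::finite \<Rightarrow> complex ^ 'n \<Rightarrow> complex" where
  "herm \<alpha> z = (\<Prod>i\<in>UNIV. (z $ i) ^ (\<alpha> $ i)) / complex_of_real (sqrt (mi_fact \<alpha>))"

definition expands :: "('d2::finite, 'd1::finite) kernel_series \<Rightarrow>
    ((complex ^ 'd2) \<times> (complex ^ 'd1) \<Rightarrow> complex) \<Rightarrow> bool" where
  "expands c K \<longleftrightarrow> (\<forall>z2 z1.
     ((\<lambda>(\<alpha>2, \<alpha>1). c (\<alpha>2, \<alpha>1) * herm \<alpha>2 z2 * herm \<alpha>1 (cnj_vec z1)) has_sum K (z2, z1)) UNIV)"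

text \<open>The embedding of the entire kernels into the formal series, by power series expansion.\<close>

definition series_of :: "((complex ^ 'd2::finite) \<times> (complex ^ 'd1::finite) \<Rightarrow> complex) \<Rightarrow>
    ('d2, 'd1) kernel_series" where
  "series_of K = (THE c. expands c K)"

definition pullback :: "complex ^ 'd2 ^ 'd2 \<Rightarrow> complex ^ 'd1 ^ 'd1 \<Rightarrow>
    ((complex ^ 'd2::finite) \<times> (complex ^ 'd1::finite) \<Rightarrow> complex) \<Rightarrow>
    (complex ^ 'd2) \<times> (complex ^ 'd1) \<Rightarrow> complex" where
  "pullback B2 B1 K = (\<lambda>(z2, z1). K (B2 *v z2, B1 *v z1))"

definition continuous_extension :: "complex ^ 'd2 ^ 'd2 \<Rightarrow> complex ^ 'd1 ^ 'd1 \<Rightarrow>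
    (('d2::finite, 'd1::finite) kernel_series \<Rightarrow> ('d2, 'd1) kernel_series) \<Rightarrow> bool" where
  "continuous_extension B2 B1 T \<longleftrightarrow> continuous_on UNIV T \<and>
     (\<forall>K\<in>entire_kernels. T (series_of K) = series_of (pullback B2 B1 K))"

definition formal_pullback :: "complex ^ 'd2 ^ 'd2 \<Rightarrow> complex ^ 'd1 ^ 'd1 \<Rightarrow>
    ('d2::finite, 'd1::finite) kernel_series \<Rightarrow> ('d2, 'd1) kernel_series" where
  "formal_pullback B2 B1 = (THE T. continuous_extension B2 B1 T)"

end

theory Submission
  imports Defs "HOL-Complex_Analysis.Cauchy_Integral_Formula"
begin

unbundle no fps_syntax

text \<open>
  A linear substitution preserves the degree of a polynomial. In the basis \<open>e\<^sub>\<alpha>\<close> it is therefore a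
  matrix with finite blocks, and both its entries in degree \<open>n\<close> and the size of the block of degree
  \<open>n\<close> are at most \<open>C^n\<close>. So it acts on all formal series, and this action is the only continuous one
  because the polynomials are dense. By the Cauchy-Schwarz inequality it maps \<open>\<ell>\<^sup>2\<close> with weight \<open>\<omega>\<close>
  boundedly to \<open>\<ell>\<^sup>2\<close> with weight \<open>\<omega>'\<close> as soon as \<open>C^n \<omega>'(\<alpha>) \<le> K \<omega>(\<beta>)\<close> whenever
  \<open>|\<alpha>| = |\<beta>| = n\<close>. A factor \<open>C^n\<close> is absorbed by lowering \<open>r\<close> in the weight if \<open>s < 1/2\<close>, and by raising
  \<open>r\<close> if \<open>0 < s \<le> 1/2\<close>; for the flat indices this uses \<open>\<alpha>! \<le> D^n \<beta>!\<close>. Such bounds pass to all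
  the limit spaces.
\<close>

section \<open>Linear maps between limits of topologies\<close>

text \<open>In the spaces (R) the parameter of a weight in the numerator belongs to an inductive
  limit and that of a weight in the denominator to a projective one; in (B) it is the other way
  round. Hence lowering \<open>r\<close> serves all of (R) and raising \<open>r\<close> all of (B):
  domination is symmetric within a block, so inverting the weights only exchanges source and target.
  The obstacle is the index 0, whose weights decrease in \<open>r\<close>. There the factor is
  absorbed with \<open>r\<close> unchanged, because only finitely many degrees have finite weight,
  and so a common parameter is still available when both indices are 0. The underlying set of an
  inductive limit is the union of its steps once that union is a linear space, so each family has to
  be shown directed. The formal pullback is given by a definite description; identifying it with a
  matrix requires the power series of every entire kernel. This comes from one-variable Taylor
  series, one variable after the other, with Cauchy estimates giving absolute convergence. The
  series is in the conjugate of \<open>z1\<close>, so the second matrix is built from the conjugate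
  of \<open>B1\<close>.\<close>

definition lin_subspace :: "('a \<Rightarrow> complex) set \<Rightarrow> bool" where
  "lin_subspace S \<longleftrightarrow> (\<lambda>_. 0) \<in> S \<and> (\<forall>x\<in>S. \<forall>y\<in>S. \<forall>a b. (\<lambda>\<alpha>. a * x \<alpha> + b * y \<alpha>) \<in> S)"

definition lin_op :: "(('a \<Rightarrow> complex) \<Rightarrow> 'b \<Rightarrow> complex) \<Rightarrow> bool" where
  "lin_op T \<longleftrightarrow> (\<forall>x y a b. T (\<lambda>\<alpha>. a * x \<alpha> + b * y \<alpha>) = (\<lambda>\<alpha>. a * T x \<alpha> + b * T y \<alpha>))"

lemma lin_subspaceD:
  "lin_subspace S \<Longrightarrow> x \<in> S \<Longrightarrow> y \<in> S \<Longrightarrow> (\<lambda>\<alpha>. a * x \<alpha> + b * y \<alpha>) \<in> S"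
  by (simp add: lin_subspace_def)

lemma lin_subspace_add: "lin_subspace S \<Longrightarrow> x \<in> S \<Longrightarrow> y \<in> S \<Longrightarrow> (\<lambda>\<alpha>. x \<alpha> + y \<alpha>) \<in> S"
  using lin_subspaceD[of S x y 1 1] by simp

lemma lin_opD: "lin_op T \<Longrightarrow> T (\<lambda>\<alpha>. a * x \<alpha> + b * y \<alpha>) = (\<lambda>\<alpha>. a * T x \<alpha> + b * T y \<alpha>)"
  by (simp add: lin_op_def)

lemma lin_op_add: "lin_op T \<Longrightarrow> T (\<lambda>\<alpha>. x \<alpha> + y \<alpha>) = (\<lambda>\<alpha>. T x \<alpha> + T y \<alpha>)"
  using lin_opD[of T 1 x 1 y] by simp

lemma lin_op_diff: "lin_op T \<Longrightarrow> T (\<lambda>\<alpha>. x \<alpha> - y \<alpha>) = (\<lambda>\<alpha>. T x \<alpha> - T y \<alpha>)"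
  using lin_opD[of T 1 x "-1" y] by simp

lemma lin_op_zero: "lin_op T \<Longrightarrow> T (\<lambda>_. 0) = (\<lambda>_. 0)"
  using lin_opD[of T 0 "\<lambda>_. 0" 0 "\<lambda>_. 0"] by simp

lemma lin_subspace_absconvex: "lin_subspace S \<Longrightarrow> absconvex S"
  by (simp add: lin_subspace_def absconvex_def)

lemma lin_subspace_INT: "(\<And>i. i \<in> I \<Longrightarrow> lin_subspace (S i)) \<Longrightarrow> lin_subspace (\<Inter>i\<in>I. S i)"
  by (simp add: lin_subspace_def)

lemma lin_subspace_directed_UN:
  assumes "I \<noteq> {}" and lin: "\<And>i. i \<in> I \<Longrightarrow> lin_subspace (S i)"
    and dir: "\<And>i j. i \<in> I \<Longrightarrow> j \<in> I \<Longrightarrow> \<exists>k\<in>I. S i \<subseteq> S k \<and> S j \<subseteq> S k"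
  shows "lin_subspace (\<Union>i\<in>I. S i)"
  unfolding lin_subspace_def
proof (intro conjI ballI allI)
  show "(\<lambda>_. 0) \<in> (\<Union>i\<in>I. S i)"
    using assms(1) lin by (auto simp: lin_subspace_def)
  fix x y a b
  assume "x \<in> (\<Union>i\<in>I. S i)" "y \<in> (\<Union>i\<in>I. S i)"
  then obtain i j where "i \<in> I" "x \<in> S i" "j \<in> I" "y \<in> S j"
    by blast
  with dir obtain k where "k \<in> I" "x \<in> S k" "y \<in> S k"
    by blast
  then have "(\<lambda>\<alpha>. a * x \<alpha> + b * y \<alpha>) \<in> S k"
    by (intro lin_subspaceD lin)
  with \<open>k \<in> I\<close> show "(\<lambda>\<alpha>. a * x \<alpha> + b * y \<alpha>) \<in> (\<Union>i\<in>I. S i)"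
    by blast
qed

text \<open>A linear union is absolutely convex and stable under its own translations, so it can
  serve as its own neighbourhood of 0 and is therefore open.\<close>

lemma topspace_ind_lim:
  assumes "lin_subspace (\<Union>i\<in>I. topspace (X i))" and "\<And>i. i \<in> I \<Longrightarrow> (\<lambda>_. 0) \<in> topspace (X i)"
  shows "topspace (ind_lim I X) = (\<Union>i\<in>I. topspace (X i))"
proof
  let ?C = "\<Union>i\<in>I. topspace (X i)"
  have "openin (ind_lim I X) ?C"
    unfolding openin_ind_lim
  proof (intro conjI ballI exI)
    show "ind_lim_nhd0 I X ?C"
      unfolding ind_lim_nhd0_def using assms lin_subspace_absconvex by blast
    show "\<And>x v. x \<in> ?C \<Longrightarrow> v \<in> ?C \<Longrightarrow> (\<lambda>\<alpha>. x \<alpha> + v \<alpha>) \<in> ?C"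
      using lin_subspace_add assms(1) by blast
  qed auto
  then show "?C \<subseteq> topspace (ind_lim I X)"
    by (rule openin_subset)
  show "topspace (ind_lim I X) \<subseteq> ?C"
    using openin_topspace[of "ind_lim I X"] unfolding openin_ind_lim by blast
qed

text \<open>The universal property of the locally convex limit: the preimage of an absolutely convex
  set under a linear map is absolutely convex, and continuity on every step puts a neighbourhood of
  0 of that step into it.\<close>

lemma continuous_map_ind_lim:
  assumes T: "lin_op T"
    and X: "lin_subspace (\<Union>i\<in>I. topspace (X i))" "\<And>i. i \<in> I \<Longrightarrow> (\<lambda>_. 0) \<in> topspace (X i)"
    and Y: "lin_subspace (\<Union>j\<in>J. topspace (Y j))" "\<And>j. j \<in> J \<Longrightarrow> (\<lambda>_. 0) \<in> topspace (Y j)"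
    and step: "\<And>i. i \<in> I \<Longrightarrow> \<exists>j\<in>J. continuous_map (X i) (Y j) T"
  shows "continuous_map (ind_lim I X) (ind_lim J Y) T"
  unfolding continuous_map_def
proof (intro conjI allI impI)
  let ?C = "\<Union>i\<in>I. topspace (X i)"
  have tX: "topspace (ind_lim I X) = ?C"
    using X by (rule topspace_ind_lim)
  have tY: "topspace (ind_lim J Y) = (\<Union>j\<in>J. topspace (Y j))"
    using Y by (rule topspace_ind_lim)
  show "T \<in> topspace (ind_lim I X) \<rightarrow> topspace (ind_lim J Y)"
  proof
    fix x assume "x \<in> topspace (ind_lim I X)"
    then obtain i where "i \<in> I" "x \<in> topspace (X i)"
      unfolding tX by blast
    moreover from \<open>i \<in> I\<close> step obtain j where "j \<in> J" "continuous_map (X i) (Y j) T"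
      by blast
    ultimately have "T x \<in> topspace (Y j)" "j \<in> J"
      by (auto simp: continuous_map_def)
    then show "T x \<in> topspace (ind_lim J Y)"
      unfolding tY by blast
  qed
  fix U assume U: "openin (ind_lim J Y) U"
  show "openin (ind_lim I X) {x \<in> topspace (ind_lim I X). T x \<in> U}"
    unfolding openin_ind_lim tX
  proof (intro conjI ballI)
    fix x assume "x \<in> {x \<in> ?C. T x \<in> U}"
    then have x: "x \<in> ?C" "T x \<in> U"
      by auto
    with U obtain V where V: "ind_lim_nhd0 J Y V" "\<And>v. v \<in> V \<Longrightarrow> (\<lambda>\<alpha>. T x \<alpha> + v \<alpha>) \<in> U"
      unfolding openin_ind_lim by blast
    \<comment> \<open>By linearity, translating \<open>x\<close> by \<open>v\<close> translates
      \<open>T x\<close> by \<open>T v\<close>, so the preimage of \<open>V\<close> is a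
      neighbourhood that works at \<open>x\<close>.\<close>
    let ?V = "{v \<in> ?C. T v \<in> V}"
    have "ind_lim_nhd0 I X ?V"
      unfolding ind_lim_nhd0_def
    proof (intro conjI ballI)
      show "absconvex ?V"
        unfolding absconvex_def
      proof (intro ballI allI impI)
        fix x y a b
        assume "x \<in> ?V" "y \<in> ?V" "cmod a + cmod b \<le> 1"
        moreover have "absconvex V"
          using V(1) by (simp add: ind_lim_nhd0_def)
        ultimately have "(\<lambda>\<alpha>. a * T x \<alpha> + b * T y \<alpha>) \<in> V" "x \<in> ?C" "y \<in> ?C"
          by (simp_all add: absconvex_def)
        then show "(\<lambda>\<alpha>. a * x \<alpha> + b * y \<alpha>) \<in> ?V"
          using lin_subspaceD[OF X(1), of x y a b] lin_opD[OF T, of a x b y] by simp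
      qed
      fix i assume i: "i \<in> I"
      with step obtain j where j: "j \<in> J" "continuous_map (X i) (Y j) T"
        by blast
      with V(1) obtain N where N: "openin (Y j) N" "(\<lambda>_. 0) \<in> N" "N \<subseteq> V"
        unfolding ind_lim_nhd0_def by blast
      show "\<exists>M. openin (X i) M \<and> (\<lambda>_. 0) \<in> M \<and> M \<subseteq> ?V"
      proof (intro exI conjI)
        show "openin (X i) {v \<in> topspace (X i). T v \<in> N}"
          using j N by (auto simp: continuous_map_def)
        show "(\<lambda>_. 0) \<in> {v \<in> topspace (X i). T v \<in> N}"
          using X(2) i N(2) by (simp add: lin_op_zero[OF T])
        show "{v \<in> topspace (X i). T v \<in> N} \<subseteq> ?V"
          using i N(3) by blast
      qed
    qed blast
    moreover have "(\<lambda>\<alpha>. x \<alpha> + v \<alpha>) \<in> {x \<in> ?C. T x \<in> U}" if "v \<in> ?V" for v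
      using that V(2)[of "T v"] lin_subspace_add[OF X(1) x(1)] by (simp add: lin_op_add[OF T])
    ultimately show "\<exists>V. ind_lim_nhd0 I X V \<and> (\<forall>v\<in>V. (\<lambda>\<alpha>. x \<alpha> + v \<alpha>) \<in> {x \<in> ?C. T x \<in> U})"
      by blast
  qed blast
qed

text \<open>Generating open sets of the target involve one index \<open>j\<close> only, so it
  suffices that each \<open>j\<close> is controlled by a single index \<open>i\<close> of the
  source.\<close>

lemma continuous_map_proj_lim:
  assumes "I \<noteq> {}" "J \<noteq> {}"
    and step: "\<And>j. j \<in> J \<Longrightarrow> \<exists>i\<in>I. continuous_map (X i) (Y j) T"
  shows "continuous_map (proj_lim I X) (proj_lim J Y) T"
proof -
  have maps: "T x \<in> (\<Inter>j\<in>J. topspace (Y j))" if "x \<in> (\<Inter>i\<in>I. topspace (X i))" for x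
    using that step by (force simp: continuous_map_def Pi_iff)
  show ?thesis
    unfolding proj_lim_def[of J]
  proof (rule continuous_on_generated_topo)
    fix U assume "U \<in> {U \<inter> (\<Inter>j\<in>J. topspace (Y j)) | U j. j \<in> J \<and> openin (Y j) U}"
    then obtain V j where V: "U = V \<inter> (\<Inter>j\<in>J. topspace (Y j))" "j \<in> J" "openin (Y j) V"
      by blast
    with step obtain i where i: "i \<in> I" "continuous_map (X i) (Y j) T"
      by blast
    have "T -` U \<inter> topspace (proj_lim I X) = {x \<in> topspace (X i). T x \<in> V} \<inter> (\<Inter>i\<in>I. topspace (X i))"
      using maps i(1) by (auto simp: topspace_proj_lim[OF assms(1)] V(1))
    moreover have "openin (X i) {x \<in> topspace (X i). T x \<in> V}"
      using i V by (simp add: continuous_map_def)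
    ultimately show "openin (proj_lim I X) (T -` U \<inter> topspace (proj_lim I X))"
      unfolding proj_lim_def using i(1) by (auto intro!: topology_generated_by_Basis)
  next
    have "\<Union>{U \<inter> (\<Inter>j\<in>J. topspace (Y j)) | U j. j \<in> J \<and> openin (Y j) U} = (\<Inter>j\<in>J. topspace (Y j))"
      using topspace_proj_lim[OF assms(2), of Y] by (simp only: proj_lim_def topology_generated_by_topspace)
    then show "T ` topspace (proj_lim I X) \<subseteq> \<Union>{U \<inter> (\<Inter>j\<in>J. topspace (Y j)) | U j. j \<in> J \<and> openin (Y j) U}"
      using maps by (simp only: topspace_proj_lim[OF assms(1)] image_subset_iff) simp
  qed
qed

section \<open>Weighted sequence spaces\<close>

text \<open>Reduces every estimate of an energy to finite sums.\<close>

lemma ell_energy_eq_SUP: "ell_energy \<omega> c = (SUP A\<in>{A. finite A}. \<Sum>\<alpha>\<in>A. (ennreal (cmod (c \<alpha>)) * \<omega> \<alpha>)\<^sup>2)"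
  unfolding ell_energy_def by (subst nonneg_infsum_complete) auto

lemma sum_le_ell_energy:
  "finite A \<Longrightarrow> (\<Sum>\<alpha>\<in>A. (ennreal (cmod (c \<alpha>)) * \<omega> \<alpha>)\<^sup>2) \<le> ell_energy \<omega> c"
  unfolding ell_energy_eq_SUP by (rule SUP_upper) simp

lemma ell_energy_leI:
  "(\<And>A. finite A \<Longrightarrow> (\<Sum>\<alpha>\<in>A. (ennreal (cmod (c \<alpha>)) * \<omega> \<alpha>)\<^sup>2) \<le> K) \<Longrightarrow> ell_energy \<omega> c \<le> K"
  unfolding ell_energy_eq_SUP by (rule SUP_least) simp

lemma ell_energy_mono: "(\<And>\<alpha>. \<omega> \<alpha> \<le> \<omega>' \<alpha>) \<Longrightarrow> ell_energy \<omega> c \<le> ell_energy \<omega>' c"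
  unfolding ell_energy_def
  by (intro infsum_mono power_mono mult_left_mono nonneg_summable_on_complete) auto

lemma ell_carrier_antimono: "(\<And>\<alpha>. \<omega> \<alpha> \<le> \<omega>' \<alpha>) \<Longrightarrow> ell_carrier \<omega>' \<subseteq> ell_carrier \<omega>"
  unfolding ell_carrier_def using ell_energy_mono le_less_trans by blast

lemma zero_in_ell_carrier [simp]: "(\<lambda>_. 0) \<in> ell_carrier \<omega>"
  by (simp add: ell_carrier_def)

lemma ell_energy_scale: "ell_energy \<omega> (\<lambda>\<alpha>. a * c \<alpha>) = (ennreal (cmod a))\<^sup>2 * ell_energy \<omega> c"
  unfolding ell_energy_eq_SUP
  by (simp add: norm_mult ennreal_mult power_mult_distrib mult.assoc sum_distrib_left[symmetric]
      SUP_mult_left_ennreal)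

text \<open>Finite energy forces \<open>c \<alpha> = 0\<close> where the weight is infinite, and
  there \<open>enn2real\<close> gives the matching value 0. On the carrier one may therefore compute
  with real weights.\<close>

lemma ell_carrier_coeff:
  assumes "c \<in> ell_carrier \<omega>"
  shows "ennreal (cmod (c \<alpha>)) * \<omega> \<alpha> = ennreal (cmod (c \<alpha>) * enn2real (\<omega> \<alpha>))"
proof -
  have "(ennreal (cmod (c \<alpha>)) * \<omega> \<alpha>)\<^sup>2 < \<infinity>"
    using sum_le_ell_energy[of "{\<alpha>}" c \<omega>] assms by (auto simp: ell_carrier_def)
  then have "ennreal (cmod (c \<alpha>)) * \<omega> \<alpha> \<noteq> \<infinity>"
    by (auto simp: power2_eq_square)
  then show ?thesis
    by (cases "\<omega> \<alpha>") (auto simp: ennreal_mult ennreal_mult_top split: if_splits)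
qed

lemma L2_set_le_ell_norm:
  assumes "c \<in> ell_carrier \<omega>" and "finite A"
  shows "L2_set (\<lambda>\<alpha>. cmod (c \<alpha>) * enn2real (\<omega> \<alpha>)) A \<le> ell_norm \<omega> c"
proof -
  have "ennreal (\<Sum>\<alpha>\<in>A. (cmod (c \<alpha>) * enn2real (\<omega> \<alpha>))\<^sup>2) = (\<Sum>\<alpha>\<in>A. (ennreal (cmod (c \<alpha>)) * \<omega> \<alpha>)\<^sup>2)"
    by (simp add: ell_carrier_coeff[OF assms(1)] sum_ennreal ennreal_power)
  also have "\<dots> \<le> ell_energy \<omega> c"
    by (rule sum_le_ell_energy) fact
  finally have "(\<Sum>\<alpha>\<in>A. (cmod (c \<alpha>) * enn2real (\<omega> \<alpha>))\<^sup>2) \<le> enn2real (ell_energy \<omega> c)"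
    using assms(1) by (cases "ell_energy \<omega> c") (auto simp: ell_carrier_def)
  then show ?thesis
    by (simp add: L2_set_def ell_norm_def)
qed

lemma ell_energy_conv_norm: "c \<in> ell_carrier \<omega> \<Longrightarrow> ell_energy \<omega> c = ennreal ((ell_norm \<omega> c)\<^sup>2)"
  by (simp add: ell_norm_def ell_carrier_def)

text \<open>Minkowski's inequality for \<open>L2_set\<close>, applied to finite sets with real
  weights.\<close>

lemma ell_energy_add_le:
  assumes c: "c \<in> ell_carrier \<omega>" and d: "d \<in> ell_carrier \<omega>"
  shows "ell_energy \<omega> (\<lambda>\<alpha>. c \<alpha> + d \<alpha>) \<le> ennreal ((ell_norm \<omega> c + ell_norm \<omega> d)\<^sup>2)"
proof (rule ell_energy_leI)
  fix A :: "'a set" assume A: "finite A"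
  let ?w = "\<lambda>\<alpha>. enn2real (\<omega> \<alpha>)"
  have "ennreal (cmod (c \<alpha> + d \<alpha>)) * \<omega> \<alpha> \<le> ennreal (cmod (c \<alpha>) * ?w \<alpha> + cmod (d \<alpha>) * ?w \<alpha>)" for \<alpha>
  proof -
    have "ennreal (cmod (c \<alpha> + d \<alpha>)) * \<omega> \<alpha> \<le> ennreal (cmod (c \<alpha>) + cmod (d \<alpha>)) * \<omega> \<alpha>"
      by (intro mult_right_mono ennreal_leI norm_triangle_ineq) auto
    also have "\<dots> = ennreal (cmod (c \<alpha>)) * \<omega> \<alpha> + ennreal (cmod (d \<alpha>)) * \<omega> \<alpha>"
      by (simp add: distrib_right)
    finally show ?thesis
      by (simp add: ell_carrier_coeff[OF c] ell_carrier_coeff[OF d])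
  qed
  then have "(\<Sum>\<alpha>\<in>A. (ennreal (cmod (c \<alpha> + d \<alpha>)) * \<omega> \<alpha>)\<^sup>2)
      \<le> (\<Sum>\<alpha>\<in>A. (ennreal (cmod (c \<alpha>) * ?w \<alpha> + cmod (d \<alpha>) * ?w \<alpha>))\<^sup>2)"
    by (intro sum_mono power_mono) auto
  also have "\<dots> = ennreal ((L2_set (\<lambda>\<alpha>. cmod (c \<alpha>) * ?w \<alpha> + cmod (d \<alpha>) * ?w \<alpha>) A)\<^sup>2)"
    by (simp add: L2_set_def sum_nonneg sum_ennreal ennreal_power del: ennreal_plus)
  also have "\<dots> \<le> ennreal ((ell_norm \<omega> c + ell_norm \<omega> d)\<^sup>2)"
    using L2_set_triangle_ineq[of "\<lambda>\<alpha>. cmod (c \<alpha>) * ?w \<alpha>" "\<lambda>\<alpha>. cmod (d \<alpha>) * ?w \<alpha>" A]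
      L2_set_le_ell_norm[OF c A] L2_set_le_ell_norm[OF d A]
    by (intro ennreal_leI power_mono) auto
  finally show "(\<Sum>\<alpha>\<in>A. (ennreal (cmod (c \<alpha> + d \<alpha>)) * \<omega> \<alpha>)\<^sup>2) \<le> \<dots>" .
qed

lemma ell_norm_nonneg [simp]: "0 \<le> ell_norm \<omega> c"
  by (simp add: ell_norm_def)

lemma ell_norm_triangle:
  assumes "c \<in> ell_carrier \<omega>" and "d \<in> ell_carrier \<omega>"
  shows "ell_norm \<omega> (\<lambda>\<alpha>. c \<alpha> + d \<alpha>) \<le> ell_norm \<omega> c + ell_norm \<omega> d"
proof -
  have "enn2real (ell_energy \<omega> (\<lambda>\<alpha>. c \<alpha> + d \<alpha>)) \<le> (ell_norm \<omega> c + ell_norm \<omega> d)\<^sup>2"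
    using ell_energy_add_le[OF assms] by (simp add: enn2real_leI)
  then show ?thesis
    unfolding ell_norm_def[of \<omega> "\<lambda>\<alpha>. c \<alpha> + d \<alpha>"] by (intro real_le_lsqrt) auto
qed

lemma lin_subspace_ell_carrier: "lin_subspace (ell_carrier \<omega>)"
  unfolding lin_subspace_def
proof (intro conjI ballI allI zero_in_ell_carrier)
  fix x y a b assume xy: "x \<in> ell_carrier \<omega>" "y \<in> ell_carrier \<omega>"
  have scale: "(\<lambda>\<alpha>. a * x \<alpha>) \<in> ell_carrier \<omega>" if "x \<in> ell_carrier \<omega>" for a x
    using that by (simp add: ell_carrier_def ell_energy_scale ennreal_mult_less_top power_less_top_ennreal)
  show "(\<lambda>\<alpha>. a * x \<alpha> + b * y \<alpha>) \<in> ell_carrier \<omega>"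
    using ell_energy_add_le[OF scale[OF xy(1), of a] scale[OF xy(2), of b]]
    by (auto simp: ell_carrier_def intro: le_less_trans)
qed

text \<open>Bounded linear maps are continuous. The topology is only generated by balls about
  arbitrary centres, so each point of a preimage needs a ball of its own.\<close>

lemma continuous_map_ell:
  assumes T: "lin_op T" and bound: "\<And>c. ell_energy \<omega>' (T c) \<le> ennreal K * ell_energy \<omega> c"
  shows "continuous_map (ell \<omega>) (ell \<omega>') T"
proof -
  \<comment> \<open>\<open>max\<close> matches \<open>ennreal K = 0\<close> for negative
    \<open>K\<close>; the summand 1 keeps the Lipschitz constant positive so that it can be divided
    by.\<close>
  let ?L = "sqrt (max K 0) + 1"
  have maps: "T c \<in> ell_carrier \<omega>'" if "c \<in> ell_carrier \<omega>" for c
    using that le_less_trans[OF bound[of c]] by (auto simp: ell_carrier_def ennreal_mult_less_top)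
  have norm: "ell_norm \<omega>' (T c) \<le> ?L * ell_norm \<omega> c" if "c \<in> ell_carrier \<omega>" for c
  proof -
    have "ennreal ((ell_norm \<omega>' (T c))\<^sup>2) \<le> ennreal K * ennreal ((ell_norm \<omega> c)\<^sup>2)"
      using bound[of c] that maps[OF that] by (simp only: ell_energy_conv_norm)
    also have "\<dots> \<le> ennreal (max K 0) * ennreal ((ell_norm \<omega> c)\<^sup>2)"
      by (intro mult_right_mono ennreal_leI) auto
    finally have "(ell_norm \<omega>' (T c))\<^sup>2 \<le> max K 0 * (ell_norm \<omega> c)\<^sup>2"
      by (simp add: ennreal_mult[symmetric])
    then have "ell_norm \<omega>' (T c) \<le> sqrt (max K 0 * (ell_norm \<omega> c)\<^sup>2)"
      by (intro real_le_rsqrt)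
    also have "\<dots> = sqrt (max K 0) * ell_norm \<omega> c"
      by (simp add: real_sqrt_mult)
    also have "\<dots> \<le> ?L * ell_norm \<omega> c"
      by (intro mult_right_mono) auto
    finally show ?thesis .
  qed
  have L: "0 < ?L"
    by (simp add: add_nonneg_pos)
  have sub: "(\<lambda>\<alpha>. x \<alpha> - y \<alpha>) \<in> ell_carrier \<omega>" if "x \<in> ell_carrier \<omega>" "y \<in> ell_carrier \<omega>"
    for x y :: "'a \<Rightarrow> complex" and \<omega>
    using lin_subspaceD[OF lin_subspace_ell_carrier that, of 1 "-1"] by simp
  have sub': "(\<lambda>\<alpha>. x \<alpha> - y \<alpha>) \<in> ell_carrier \<omega>" if "x \<in> ell_carrier \<omega>" "y \<in> ell_carrier \<omega>"
    for x y :: "'b \<Rightarrow> complex" and \<omega>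
    using lin_subspaceD[OF lin_subspace_ell_carrier that, of 1 "-1"] by simp
  show ?thesis
    unfolding ell_def[of \<omega>']
  proof (rule continuous_on_generated_topo)
    fix U assume "U \<in> {ell_ball \<omega>' x \<epsilon> | x \<epsilon>. x \<in> ell_carrier \<omega>' \<and> 0 < \<epsilon>}"
    then obtain x \<epsilon> where U: "U = ell_ball \<omega>' x \<epsilon>" "x \<in> ell_carrier \<omega>'" "0 < \<epsilon>"
      by blast
    show "openin (ell \<omega>) (T -` U \<inter> topspace (ell \<omega>))"
    proof (subst openin_subopen, intro ballI)
      fix y assume "y \<in> T -` U \<inter> topspace (ell \<omega>)"
      then have y: "y \<in> ell_carrier \<omega>" "T y \<in> ell_carrier \<omega>'" "ell_norm \<omega>' (\<lambda>\<alpha>. T y \<alpha> - x \<alpha>) < \<epsilon>"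
        by (auto simp: U(1) ell_ball_def topspace_ell)
      \<comment> \<open>What is left of the radius at \<open>T y\<close>, scaled back by the
        Lipschitz constant.\<close>
      define \<delta> where "\<delta> = (\<epsilon> - ell_norm \<omega>' (\<lambda>\<alpha>. T y \<alpha> - x \<alpha>)) / ?L"
      have \<delta>: "0 < \<delta>"
        using y(3) L by (simp add: \<delta>_def)
      have "z \<in> T -` U \<inter> topspace (ell \<omega>)" if "z \<in> ell_ball \<omega> y \<delta>" for z
      proof -
        have z: "z \<in> ell_carrier \<omega>" "ell_norm \<omega> (\<lambda>\<alpha>. z \<alpha> - y \<alpha>) < \<delta>"
          using that by (auto simp: ell_ball_def)
        have "ell_norm \<omega>' (\<lambda>\<alpha>. T z \<alpha> - x \<alpha>)
            = ell_norm \<omega>' (\<lambda>\<alpha>. T (\<lambda>\<alpha>. z \<alpha> - y \<alpha>) \<alpha> + (T y \<alpha> - x \<alpha>))"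
          by (simp add: lin_op_diff[OF T])
        also have "\<dots> \<le> ell_norm \<omega>' (T (\<lambda>\<alpha>. z \<alpha> - y \<alpha>)) + ell_norm \<omega>' (\<lambda>\<alpha>. T y \<alpha> - x \<alpha>)"
          by (intro ell_norm_triangle maps sub sub' z y U)
        also have "ell_norm \<omega>' (T (\<lambda>\<alpha>. z \<alpha> - y \<alpha>)) \<le> ?L * ell_norm \<omega> (\<lambda>\<alpha>. z \<alpha> - y \<alpha>)"
          by (intro norm sub z y)
        also have "\<dots> < ?L * \<delta>"
          using L z(2) by (intro mult_strict_left_mono) auto
        also have "?L * \<delta> = \<epsilon> - ell_norm \<omega>' (\<lambda>\<alpha>. T y \<alpha> - x \<alpha>)"
          using L by (simp add: \<delta>_def)
        finally show ?thesis
          using z(1) maps by (simp add: U(1) ell_ball_def topspace_ell)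
      qed
      moreover have "openin (ell \<omega>) (ell_ball \<omega> y \<delta>)"
        unfolding ell_def using y(1) \<delta> by (intro topology_generated_by_Basis) blast
      moreover have "y \<in> ell_ball \<omega> y \<delta>"
        using y(1) \<delta> by (simp add: ell_ball_def ell_norm_def)
      ultimately show "\<exists>V. openin (ell \<omega>) V \<and> y \<in> V \<and> V \<subseteq> T -` U \<inter> topspace (ell \<omega>)"
        by blast
    qed
  next
    have "T ` topspace (ell \<omega>) \<subseteq> topspace (ell \<omega>')"
      using maps by (auto simp: topspace_ell)
    then show "T ` topspace (ell \<omega>) \<subseteq> \<Union>{ell_ball \<omega>' x \<epsilon> | x \<epsilon>. x \<in> ell_carrier \<omega>' \<and> 0 < \<epsilon>}"
      by (simp add: ell_def topology_generated_by_topspace)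
  qed
qed

section \<open>Block matrices\<close>

text \<open>Convention: \<open>m \<delta> \<gamma>\<close> is the coefficient of the basis element
  \<open>\<gamma>\<close> in the image of \<open>\<delta>\<close>. The sum may run over the block of
  the output index because blocks are symmetric.\<close>

definition mat_op :: "('a \<Rightarrow> 'a set) \<Rightarrow> ('a \<Rightarrow> 'a \<Rightarrow> complex) \<Rightarrow> ('a \<Rightarrow> complex) \<Rightarrow> 'a \<Rightarrow> complex" where
  "mat_op F m c = (\<lambda>\<gamma>. \<Sum>\<delta>\<in>F \<gamma>. c \<delta> * m \<delta> \<gamma>)"

text \<open>The sets \<open>F \<alpha>\<close> are the classes of an equivalence relation with
  finite classes.\<close>

definition blocks :: "('a \<Rightarrow> 'a set) \<Rightarrow> bool" where
  "blocks F \<longleftrightarrow> (\<forall>\<alpha>. finite (F \<alpha>) \<and> \<alpha> \<in> F \<alpha> \<and> (\<forall>\<beta>\<in>F \<alpha>. F \<beta> = F \<alpha>))"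

lemma lin_op_mat_op: "lin_op (mat_op F m)"
  by (simp add: lin_op_def mat_op_def fun_eq_iff sum.distrib distrib_right sum_distrib_left mult.assoc)

text \<open>Cauchy-Schwarz against the constant 1. If some term is infinite, so is the right-hand
  side, the set being nonempty.\<close>

lemma sum_squared_le_card_ennreal:
  fixes y :: "'a \<Rightarrow> ennreal"
  assumes "finite A"
  shows "(\<Sum>\<delta>\<in>A. y \<delta>)\<^sup>2 \<le> of_nat (card A) * (\<Sum>\<delta>\<in>A. (y \<delta>)\<^sup>2)"
proof (cases "\<exists>\<delta>\<in>A. y \<delta> = \<infinity>")
  case True
  then obtain \<delta> where \<delta>: "\<delta> \<in> A" "y \<delta> = \<infinity>"
    by blast
  have "(y \<delta>)\<^sup>2 \<le> (\<Sum>\<delta>\<in>A. (y \<delta>)\<^sup>2)"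
    using assms \<delta>(1) by (intro member_le_sum) auto
  then have "(\<Sum>\<delta>\<in>A. (y \<delta>)\<^sup>2) = \<infinity>"
    using \<delta>(2) by (simp add: power2_eq_square top_unique)
  moreover have "card A \<noteq> 0"
    using assms \<delta>(1) by auto
  ultimately show ?thesis
    by (simp add: ennreal_mult_top)
next
  case False
  then have y: "y \<delta> = ennreal (enn2real (y \<delta>))" if "\<delta> \<in> A" for \<delta>
    using that by (metis ennreal_enn2real_if infinity_ennreal_def)
  define z where "z \<delta> = enn2real (y \<delta>)" for \<delta>
  have z: "0 \<le> z \<delta>" for \<delta>
    by (simp add: z_def)
  have "(\<Sum>\<delta>\<in>A. y \<delta>) = ennreal (\<Sum>\<delta>\<in>A. z \<delta>)" "(\<Sum>\<delta>\<in>A. (y \<delta>)\<^sup>2) = ennreal (\<Sum>\<delta>\<in>A. (z \<delta>)\<^sup>2)"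
    using y by (simp_all add: sum_ennreal[symmetric] z ennreal_power[symmetric] z_def cong: sum.cong)
  moreover have "ennreal ((\<Sum>\<delta>\<in>A. z \<delta>)\<^sup>2) \<le> ennreal (real (card A) * (\<Sum>\<delta>\<in>A. (z \<delta>)\<^sup>2))"
    using sum_squared_le_sum_of_squares[of z A] by (intro ennreal_leI) (simp add: mult.commute)
  ultimately show ?thesis
    by (simp add: ennreal_power sum_nonneg z ennreal_mult ennreal_of_nat_eq_real_of_nat)
qed

text \<open>In a block of size \<open>N\<close> every weighted entry is at most
  \<open>K / N\<close>. Cauchy-Schwarz along a row costs one factor \<open>N\<close>, summing over
  the rows of the block another, and \<open>(K / N)\<^sup>2\<close> pays for both.\<close>

lemma ell_energy_mat_op_le:
  assumes F: "blocks F" and K: "0 \<le> K"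
    and bound: "\<And>\<gamma> \<delta>. \<delta> \<in> F \<gamma> \<Longrightarrow> ennreal (cmod (m \<delta> \<gamma>) * card (F \<gamma>)) * \<omega>' \<gamma> \<le> ennreal K * \<omega> \<delta>"
  shows "ell_energy \<omega>' (mat_op F m c) \<le> ennreal (K\<^sup>2) * ell_energy \<omega> c"
proof (rule ell_energy_leI)
  fix A :: "'a set" assume A: "finite A"
  define N where "N \<gamma> = real (card (F \<gamma>))" for \<gamma>
  define y where "y \<delta> = ennreal (cmod (c \<delta>)) * \<omega> \<delta>" for \<delta>
  define x where "x \<gamma> = (ennreal (cmod (mat_op F m c \<gamma>)) * \<omega>' \<gamma>)\<^sup>2" for \<gamma>
  have N: "0 < N \<gamma>" for \<gamma>
    using F by (auto simp: N_def blocks_def card_gt_0_iff)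
  have entry: "ennreal (cmod (c \<delta> * m \<delta> \<gamma>)) * \<omega>' \<gamma> \<le> ennreal (K / N \<gamma>) * y \<delta>" if "\<delta> \<in> F \<gamma>" for \<delta> \<gamma>
  proof -
    have "ennreal (cmod (c \<delta> * m \<delta> \<gamma>)) * \<omega>' \<gamma>
        = ennreal (cmod (c \<delta>) / N \<gamma>) * (ennreal (cmod (m \<delta> \<gamma>) * N \<gamma>) * \<omega>' \<gamma>)"
      using N[of \<gamma>] by (simp add: norm_mult mult.assoc[symmetric] ennreal_mult[symmetric])
    also have "\<dots> \<le> ennreal (cmod (c \<delta>) / N \<gamma>) * (ennreal K * \<omega> \<delta>)"
      using bound[OF that] by (intro mult_left_mono) (auto simp: N_def)
    also have "\<dots> = ennreal (cmod (c \<delta>) / N \<gamma> * K) * \<omega> \<delta>"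
      using N[of \<gamma>] K by (simp add: mult.assoc[symmetric] ennreal_mult[symmetric])
    also have "cmod (c \<delta>) / N \<gamma> * K = K / N \<gamma> * cmod (c \<delta>)"
      by simp
    also have "ennreal (K / N \<gamma> * cmod (c \<delta>)) * \<omega> \<delta> = ennreal (K / N \<gamma>) * y \<delta>"
      using N[of \<gamma>] K by (simp add: y_def mult.assoc[symmetric] ennreal_mult[symmetric])
    finally show ?thesis .
  qed
  have x: "x \<gamma> \<le> (\<Sum>\<delta>\<in>F \<gamma>. ennreal (K\<^sup>2 / N \<gamma>) * (y \<delta>)\<^sup>2)" for \<gamma>
  proof -
    have "ennreal (cmod (mat_op F m c \<gamma>)) * \<omega>' \<gamma> \<le> ennreal (\<Sum>\<delta>\<in>F \<gamma>. cmod (c \<delta> * m \<delta> \<gamma>)) * \<omega>' \<gamma>"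
      unfolding mat_op_def by (intro mult_right_mono ennreal_leI norm_sum) auto
    also have "\<dots> = (\<Sum>\<delta>\<in>F \<gamma>. ennreal (cmod (c \<delta> * m \<delta> \<gamma>)) * \<omega>' \<gamma>)"
      by (subst sum_ennreal[symmetric]) (simp_all only: sum_distrib_right norm_ge_zero)
    also have "\<dots> \<le> (\<Sum>\<delta>\<in>F \<gamma>. ennreal (K / N \<gamma>) * y \<delta>)"
      by (intro sum_mono entry)
    also have "\<dots> = ennreal (K / N \<gamma>) * (\<Sum>\<delta>\<in>F \<gamma>. y \<delta>)"
      by (simp add: sum_distrib_left)
    finally have "x \<gamma> \<le> (ennreal (K / N \<gamma>) * (\<Sum>\<delta>\<in>F \<gamma>. y \<delta>))\<^sup>2"
      unfolding x_def by (intro power_mono) auto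
    also have "\<dots> = ennreal ((K / N \<gamma>)\<^sup>2) * (\<Sum>\<delta>\<in>F \<gamma>. y \<delta>)\<^sup>2"
      using K N[of \<gamma>] by (simp add: power_mult_distrib ennreal_power)
    also have "\<dots> \<le> ennreal ((K / N \<gamma>)\<^sup>2) * (of_nat (card (F \<gamma>)) * (\<Sum>\<delta>\<in>F \<gamma>. (y \<delta>)\<^sup>2))"
      using F by (intro mult_left_mono sum_squared_le_card_ennreal) (auto simp: blocks_def)
    also have "\<dots> = ennreal ((K / N \<gamma>)\<^sup>2 * N \<gamma>) * (\<Sum>\<delta>\<in>F \<gamma>. (y \<delta>)\<^sup>2)"
      by (simp add: N_def ennreal_mult mult.assoc ennreal_of_nat_eq_real_of_nat)
    also have "(K / N \<gamma>)\<^sup>2 * N \<gamma> = K\<^sup>2 / N \<gamma>"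
      using N[of \<gamma>] by (simp add: field_simps power2_eq_square)
    finally show ?thesis
      by (simp add: sum_distrib_left)
  qed
  \<comment> \<open>\<open>A\<close> is enlarged to a union of whole blocks, over which the double
    sum can be interchanged.\<close>
  define G where "G = (\<Union>\<gamma>\<in>A. F \<gamma>)"
  have G: "finite G" "A \<subseteq> G"
    using F A by (auto simp: G_def blocks_def)
  have swap: "\<gamma> \<in> G \<and> \<delta> \<in> F \<gamma> \<longleftrightarrow> \<delta> \<in> G \<and> \<gamma> \<in> F \<delta>" for \<gamma> \<delta>
  proof -
    have sym: "\<delta> \<in> F \<gamma> \<longleftrightarrow> \<gamma> \<in> F \<delta>" and trans: "\<gamma> \<in> F \<alpha> \<Longrightarrow> \<delta> \<in> F \<gamma> \<Longrightarrow> \<delta> \<in> F \<alpha>"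
      for \<alpha> \<gamma> \<delta>
      using F by (auto simp: blocks_def)
    show ?thesis
      unfolding G_def using sym trans by blast
  qed
  have "(\<Sum>\<gamma>\<in>A. x \<gamma>) \<le> (\<Sum>\<gamma>\<in>G. x \<gamma>)"
    using G by (intro sum_mono2) auto
  also have "\<dots> \<le> (\<Sum>\<gamma>\<in>G. \<Sum>\<delta>\<in>F \<gamma>. ennreal (K\<^sup>2 / N \<gamma>) * (y \<delta>)\<^sup>2)"
    by (intro sum_mono x)
  also have "\<dots> = (\<Sum>(\<gamma>, \<delta>)\<in>Sigma G F. ennreal (K\<^sup>2 / N \<gamma>) * (y \<delta>)\<^sup>2)"
    using F G by (subst sum.Sigma) (auto simp: blocks_def)
  also have "\<dots> = (\<Sum>(\<delta>, \<gamma>)\<in>Sigma G F. ennreal (K\<^sup>2 / N \<gamma>) * (y \<delta>)\<^sup>2)"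
    by (rule sum.reindex_bij_witness[of _ "\<lambda>(a, b). (b, a)" "\<lambda>(a, b). (b, a)"]) (use swap in auto)
  also have "\<dots> = (\<Sum>\<delta>\<in>G. \<Sum>\<gamma>\<in>F \<delta>. ennreal (K\<^sup>2 / N \<gamma>) * (y \<delta>)\<^sup>2)"
    using F G by (subst sum.Sigma) (auto simp: blocks_def)
  \<comment> \<open>The size \<open>N\<close> is constant on a block, so the inner summand no longer
    depends on \<open>\<gamma>\<close>.\<close>
  also have "\<dots> = (\<Sum>\<delta>\<in>G. \<Sum>\<gamma>\<in>F \<delta>. ennreal (K\<^sup>2 / N \<delta>) * (y \<delta>)\<^sup>2)"
    using F by (intro sum.cong refl) (auto simp: N_def blocks_def)
  also have "\<dots> = (\<Sum>\<delta>\<in>G. ennreal (K\<^sup>2) * (y \<delta>)\<^sup>2)"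
  proof (intro sum.cong refl)
    fix \<delta>
    have "(\<Sum>\<gamma>\<in>F \<delta>. ennreal (K\<^sup>2 / N \<delta>) * (y \<delta>)\<^sup>2) = ennreal (N \<delta>) * ennreal (K\<^sup>2 / N \<delta>) * (y \<delta>)\<^sup>2"
      by (simp add: N_def ennreal_of_nat_eq_real_of_nat mult.assoc)
    also have "ennreal (N \<delta>) * ennreal (K\<^sup>2 / N \<delta>) = ennreal (K\<^sup>2)"
      using N[of \<delta>] by (simp add: ennreal_mult[symmetric])
    finally show "(\<Sum>\<gamma>\<in>F \<delta>. ennreal (K\<^sup>2 / N \<delta>) * (y \<delta>)\<^sup>2) = ennreal (K\<^sup>2) * (y \<delta>)\<^sup>2" .
  qed
  also have "\<dots> = ennreal (K\<^sup>2) * (\<Sum>\<delta>\<in>G. (y \<delta>)\<^sup>2)"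
    by (simp add: sum_distrib_left)
  also have "\<dots> \<le> ennreal (K\<^sup>2) * ell_energy \<omega> c"
    unfolding y_def using G(1) by (intro mult_left_mono sum_le_ell_energy) auto
  finally show "(\<Sum>\<gamma>\<in>A. (ennreal (cmod (mat_op F m c \<gamma>)) * \<omega>' \<gamma>)\<^sup>2) \<le> \<dots>"
    unfolding x_def .
qed

text \<open>The source weight is \<open>\<omega>\<close> and the target weight
  \<open>\<omega>'\<close>; \<open>h\<close> stands for a bound on matrix entry times block size.
  This is the form in which weights are compared from here on.\<close>

definition dominated :: "('a \<Rightarrow> 'a set) \<Rightarrow> ('a \<Rightarrow> real) \<Rightarrow> ('a \<Rightarrow> ennreal) \<Rightarrow> ('a \<Rightarrow> ennreal) \<Rightarrow> bool" where
  "dominated F h \<omega> \<omega>' \<longleftrightarrow> (\<exists>K>0. \<forall>\<alpha>. \<forall>\<beta>\<in>F \<alpha>. ennreal (h \<alpha>) * \<omega>' \<alpha> \<le> ennreal K * \<omega> \<beta>)"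

definition tens_wt :: "('a \<Rightarrow> ennreal) \<Rightarrow> ('b \<Rightarrow> ennreal) \<Rightarrow> 'a \<times> 'b \<Rightarrow> ennreal" where
  "tens_wt u v = (\<lambda>(a, b). u a * v b)"

definition tens_blocks :: "('a \<Rightarrow> 'a set) \<Rightarrow> ('b \<Rightarrow> 'b set) \<Rightarrow> 'a \<times> 'b \<Rightarrow> ('a \<times> 'b) set" where
  "tens_blocks F G = (\<lambda>(a, b). F a \<times> G b)"

definition tens_mat :: "('a \<Rightarrow> 'a \<Rightarrow> complex) \<Rightarrow> ('b \<Rightarrow> 'b \<Rightarrow> complex) \<Rightarrow> 'a \<times> 'b \<Rightarrow> 'a \<times> 'b \<Rightarrow> complex" where
  "tens_mat m n = (\<lambda>(a, b) (a', b'). m a a' * n b b')"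

text \<open>For finite values this is cross multiplication. If \<open>x\<close> is infinite, the
  hypothesis makes \<open>y\<close> infinite too and the left-hand side vanishes.\<close>

lemma ennreal_mult_inverse_le:
  fixes x y :: ennreal
  assumes h: "0 < h" "0 < K" and "0 < x" "0 < y" and le: "ennreal h * x \<le> ennreal K * y"
  shows "ennreal h * inverse y \<le> ennreal K * inverse x"
proof (cases x)
  case top
  then have "y = top"
    using le h by (auto simp: ennreal_mult_top ennreal_mult_eq_top_iff top_unique)
  then show ?thesis by simp
next
  case (real a)
  note a = real
  show ?thesis
  proof (cases y)
    case top then show ?thesis by simp
  next
    case (real b)
    have ab: "0 < a" "0 < b" using a real assms(3,4) by auto
    have "h * a \<le> K * b"
      using le h ab a real by (simp add: ennreal_mult[symmetric])
    then have "h * inverse b \<le> K * inverse a"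
      using ab by (simp add: field_simps)
    then show ?thesis
      using h ab by (simp add: a real inverse_ennreal ennreal_mult[symmetric] ennreal_leI)
  qed
qed

text \<open>Exchanging \<open>\<alpha>\<close> and \<open>\<beta>\<close> inside a block and
  inverting turns the estimate into one for the reciprocal weights, with source and target
  interchanged. Thus denominators need no estimates of their own.\<close>

lemma dominated_inverse:
  assumes F: "blocks F" and h: "\<And>\<alpha>. 0 < h \<alpha>" "\<And>\<alpha> \<beta>. \<beta> \<in> F \<alpha> \<Longrightarrow> h \<beta> = h \<alpha>"
    and pos: "\<And>\<alpha>. 0 < \<omega> \<alpha>" "\<And>\<alpha>. 0 < \<omega>' \<alpha>" and "dominated F h \<omega> \<omega>'"
  shows "dominated F h (\<lambda>\<alpha>. inverse (\<omega>' \<alpha>)) (\<lambda>\<alpha>. inverse (\<omega> \<alpha>))"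
proof -
  obtain K where K: "0 < K" "\<And>\<alpha> \<beta>. \<beta> \<in> F \<alpha> \<Longrightarrow> ennreal (h \<alpha>) * \<omega>' \<alpha> \<le> ennreal K * \<omega> \<beta>"
    using assms(6) by (auto simp: dominated_def)
  have "ennreal (h \<alpha>) * inverse (\<omega> \<alpha>) \<le> ennreal K * inverse (\<omega>' \<beta>)" if "\<beta> \<in> F \<alpha>" for \<alpha> \<beta>
  proof -
    have "\<alpha> \<in> F \<beta>"
      using F that unfolding blocks_def by metis
    then have "ennreal (h \<beta>) * \<omega>' \<beta> \<le> ennreal K * \<omega> \<alpha>"
      by (rule K(2))
    then show ?thesis
      using ennreal_mult_inverse_le[OF h(1)[of \<alpha>] K(1) pos(2)[of \<beta>] pos(1)[of \<alpha>]] h(2)[OF that]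
      by simp
  qed
  then show ?thesis
    using K(1) unfolding dominated_def by blast
qed

lemma dominated_tens:
  assumes "dominated F h u u'" "dominated G k v v'" and h: "\<And>a. 0 \<le> h a" "\<And>b. 0 \<le> k b"
  shows "dominated (tens_blocks F G) (\<lambda>(a, b). h a * k b) (tens_wt u v) (tens_wt u' v')"
proof -
  obtain K L where K: "0 < K" "\<And>\<alpha> \<beta>. \<beta> \<in> F \<alpha> \<Longrightarrow> ennreal (h \<alpha>) * u' \<alpha> \<le> ennreal K * u \<beta>"
    and L: "0 < L" "\<And>\<alpha> \<beta>. \<beta> \<in> G \<alpha> \<Longrightarrow> ennreal (k \<alpha>) * v' \<alpha> \<le> ennreal L * v \<beta>"
    using assms(1,2) by (auto simp: dominated_def)
  have "ennreal (h a * k b) * (u' a * v' b) \<le> ennreal (K * L) * (u a' * v b')"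
    if "a' \<in> F a" "b' \<in> G b" for a a' b b'
  proof -
    have "ennreal (h a * k b) * (u' a * v' b) = (ennreal (h a) * u' a) * (ennreal (k b) * v' b)"
      by (simp add: ennreal_mult h mult_ac)
    also have "\<dots> \<le> (ennreal K * u a') * (ennreal L * v b')"
      by (intro mult_mono K L that) auto
    also have "\<dots> = ennreal (K * L) * (u a' * v b')"
      using K(1) L(1) by (simp add: ennreal_mult mult_ac)
    finally show ?thesis .
  qed
  moreover have "0 < K * L"
    using K(1) L(1) by simp
  ultimately show ?thesis
    unfolding dominated_def tens_blocks_def tens_wt_def by auto
qed

lemma dominated_mono:
  assumes "dominated F h \<omega> \<omega>'" "\<omega> \<le> \<omega>1" "\<omega>1' \<le> \<omega>'"
  shows "dominated F h \<omega>1 \<omega>1'"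
proof -
  obtain K where K: "0 < K" "\<And>\<alpha> \<beta>. \<beta> \<in> F \<alpha> \<Longrightarrow> ennreal (h \<alpha>) * \<omega>' \<alpha> \<le> ennreal K * \<omega> \<beta>"
    using assms(1) by (auto simp: dominated_def)
  have "ennreal (h \<alpha>) * \<omega>1' \<alpha> \<le> ennreal K * \<omega>1 \<beta>" if "\<beta> \<in> F \<alpha>" for \<alpha> \<beta>
  proof -
    have "ennreal (h \<alpha>) * \<omega>1' \<alpha> \<le> ennreal (h \<alpha>) * \<omega>' \<alpha>"
      using assms(3) by (intro mult_left_mono) (auto simp: le_fun_def)
    also have "\<dots> \<le> ennreal K * \<omega> \<beta>"
      by (rule K(2)[OF that])
    also have "\<dots> \<le> ennreal K * \<omega>1 \<beta>"
      using assms(2) by (intro mult_left_mono) (auto simp: le_fun_def)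
    finally show ?thesis .
  qed
  then show ?thesis
    using K(1) unfolding dominated_def by blast
qed

lemma blocks_tens: "blocks F \<Longrightarrow> blocks G \<Longrightarrow> blocks (tens_blocks F G)"
  unfolding blocks_def tens_blocks_def by auto

text \<open>The bridge from weights to topology: everything about the matrix enters through
  \<open>h\<close> alone.\<close>

lemma continuous_map_ell_mat_op:
  assumes F: "blocks F" and m: "\<And>\<gamma> \<delta>. \<delta> \<in> F \<gamma> \<Longrightarrow> cmod (m \<delta> \<gamma>) * card (F \<gamma>) \<le> h \<gamma>"
    and dom: "dominated F h \<omega> \<omega>'"
  shows "continuous_map (ell \<omega>) (ell \<omega>') (mat_op F m)"
proof -
  obtain K where K: "0 < K" "\<And>\<alpha> \<beta>. \<beta> \<in> F \<alpha> \<Longrightarrow> ennreal (h \<alpha>) * \<omega>' \<alpha> \<le> ennreal K * \<omega> \<beta>"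
    using dom by (auto simp: dominated_def)
  have "ennreal (cmod (m \<delta> \<gamma>) * card (F \<gamma>)) * \<omega>' \<gamma> \<le> ennreal K * \<omega> \<delta>" if "\<delta> \<in> F \<gamma>" for \<delta> \<gamma>
  proof -
    have "ennreal (cmod (m \<delta> \<gamma>) * card (F \<gamma>)) * \<omega>' \<gamma> \<le> ennreal (h \<gamma>) * \<omega>' \<gamma>"
      by (intro mult_right_mono ennreal_leI m that) auto
    then show ?thesis
      using K(2)[OF that] by (rule order_trans)
  qed
  then have "ell_energy \<omega>' (mat_op F m c) \<le> ennreal (K\<^sup>2) * ell_energy \<omega> c" for c
    using K(1) by (intro ell_energy_mat_op_le F) auto
  then show ?thesis
    by (rule continuous_map_ell[OF lin_op_mat_op])
qed

section \<open>Weights and dilations\<close>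

text \<open>A multinomial coefficient is a positive integer.\<close>

lemma prod_fact_le_fact_sum:
  fixes a :: "'i \<Rightarrow> nat"
  assumes "finite S"
  shows "(\<Prod>i\<in>S. fact (a i)) \<le> (fact (\<Sum>i\<in>S. a i) :: real)"
  using assms
proof (induction S)
  case (insert i S)
  have "(\<Prod>j\<in>insert i S. fact (a j)) \<le> fact (a i) * (fact (\<Sum>j\<in>S. a j) :: real)"
    using insert by (simp add: mult_left_mono)
  also have "\<dots> \<le> fact (a i + (\<Sum>j\<in>S. a j))"
  proof -
    have "fact (a i) * fact (\<Sum>j\<in>S. a j) \<le> (fact (a i + (\<Sum>j\<in>S. a j)) :: nat)"
      by (rule dvd_imp_le[OF fact_fact_dvd_fact]) simp
    then have "of_nat (fact (a i) * fact (\<Sum>j\<in>S. a j)) \<le> (of_nat (fact (a i + (\<Sum>j\<in>S. a j))) :: real)"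
      by (rule of_nat_mono)
    then show ?thesis by simp
  qed
  finally show ?case
    using insert by simp
qed simp

lemma fact_add_le: "(fact (a + b) :: real) \<le> 2 ^ (a + b) * (fact a * fact b)"
proof -
  have "real ((a + b) choose a) \<le> real (2 ^ (a + b))"
    by (intro of_nat_mono binomial_le_pow2)
  then have "real ((a + b) choose a) * (fact a * fact b) \<le> 2 ^ (a + b) * (fact a * fact b)"
    by (intro mult_right_mono) auto
  moreover have "real ((a + b) choose a) * (fact a * fact b) = fact (a + b)"
    by (simp add: binomial_fact)
  ultimately show ?thesis by simp
qed

text \<open>The multinomial coefficient is a product of binomial coefficients, one per index, each
  at most 2 to the total degree.\<close>

lemma fact_sum_le_prod_fact:
  fixes a :: "'i \<Rightarrow> nat"
  assumes "finite S"
  shows "(fact (\<Sum>i\<in>S. a i) :: real) \<le> (2 ^ card S) ^ (\<Sum>i\<in>S. a i) * (\<Prod>i\<in>S. fact (a i))"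
  using assms
proof (induction S)
  case (insert i S)
  let ?s = "\<Sum>j\<in>S. a j" and ?P = "\<Prod>j\<in>S. fact (a j) :: real"
  have P: "0 \<le> ?P" by (simp add: prod_nonneg)
  have "fact (a i + ?s) \<le> 2 ^ (a i + ?s) * (fact (a i) * (fact ?s :: real))"
    by (rule fact_add_le)
  also have "\<dots> \<le> 2 ^ (a i + ?s) * (fact (a i) * ((2 ^ card S) ^ ?s * ?P))"
    by (intro mult_left_mono insert.IH) auto
  also have "\<dots> \<le> 2 ^ (a i + ?s) * (fact (a i) * ((2 ^ card S) ^ (a i + ?s) * ?P))"
    using P by (intro mult_left_mono mult_right_mono power_increasing) auto
  also have "\<dots> = (2 ^ card (insert i S)) ^ (a i + ?s) * (fact (a i) * ?P)"
    using insert.hyps by (simp add: power_mult_distrib)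
  finally show ?case
    using insert.hyps by simp
qed simp

lemma mi_fact_pos [simp]: "0 < mi_fact \<alpha>"
  by (simp add: mi_fact_def prod_pos)

text \<open>Both factorials are compared with the factorial of the common degree. This is the origin
  of the constant \<open>2 ^ CARD('n)\<close> below.\<close>

lemma mi_fact_le_mi_fact:
  fixes \<alpha> \<beta> :: "nat ^ 'n::finite"
  assumes "mi_size \<beta> = mi_size \<alpha>"
  shows "mi_fact \<alpha> \<le> (2 ^ CARD('n)) ^ mi_size \<alpha> * mi_fact \<beta>"
proof -
  have "mi_fact \<alpha> \<le> fact (mi_size \<alpha>)"
    unfolding mi_fact_def mi_size_def by (rule prod_fact_le_fact_sum) simp
  also have "\<dots> = fact (mi_size \<beta>)"
    by (simp add: assms)
  also have "\<dots> \<le> (2 ^ CARD('n)) ^ mi_size \<beta> * mi_fact \<beta>"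
    unfolding mi_fact_def mi_size_def by (rule fact_sum_le_prod_fact) simp
  finally show ?thesis
    by (simp add: assms)
qed

lemma wt_pos: "0 < r \<Longrightarrow> 0 < wt r s \<alpha>"
proof -
  have "1 + (real (mi_size \<alpha>))\<^sup>2 \<noteq> 0"
    by (smt (verit) zero_le_power2)
  moreover have "mi_fact \<alpha> \<noteq> 0"
    using mi_fact_pos[of \<alpha>] by linarith
  ultimately show "0 < r \<Longrightarrow> 0 < wt r s \<alpha>"
    by (cases s) auto
qed

lemma wt_mono:
  assumes "0 < r" "r \<le> r'" "s \<noteq> Num 0"
  shows "wt r s \<alpha> \<le> wt r' s \<alpha>"
proof (cases s)
  case (Num x)
  then show ?thesis
    using assms by (auto intro!: ennreal_leI powr_mono mult_right_mono)
next
  case (Flat \<sigma>)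
  then show ?thesis
    using assms by (auto intro!: ennreal_leI mult_right_mono power_mono)
qed

lemma wt_zero_antimono: "r \<le> r' \<Longrightarrow> wt r' (Num 0) \<alpha> \<le> wt r (Num 0) \<alpha>"
  by auto

section \<open>Absorbing a geometric factor into the weights\<close>

definition mi_blocks :: "nat ^ 'n::finite \<Rightarrow> (nat ^ 'n) set" where
  "mi_blocks \<alpha> = {\<beta>. mi_size \<beta> = mi_size \<alpha>}"

text \<open>Where the target weight is finite the degree is at most \<open>r\<close>, so the factor
  is bounded; elsewhere the source weight, depending on the same degree, is infinite as
  well.\<close>

lemma dominated_dilate_zero:
  assumes "1 \<le> C"
  shows "dominated mi_blocks (\<lambda>\<alpha>. C ^ mi_size \<alpha>) (wt r (Num 0)) (wt r (Num 0))"
  unfolding dominated_def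
proof (intro exI conjI allI ballI)
  let ?K = "C ^ nat \<lfloor>r\<rfloor>"
  show "0 < ?K" using assms by simp
  fix \<alpha> \<beta> :: "nat ^ 'n" assume "\<beta> \<in> mi_blocks \<alpha>"
  then have eq: "mi_size \<beta> = mi_size \<alpha>"
    by (simp add: mi_blocks_def)
  show "ennreal (C ^ mi_size \<alpha>) * wt r (Num 0) \<alpha> \<le> ennreal ?K * wt r (Num 0) \<beta>"
  proof (cases "real (mi_size \<alpha>) \<le> r")
    case True
    then have "C ^ mi_size \<alpha> \<le> ?K"
      using assms by (intro power_increasing) (auto simp: le_nat_floor)
    then show ?thesis
      using True by (simp add: eq ennreal_leI)
  next
    case False
    then show ?thesis
      using \<open>0 < ?K\<close> by (simp add: eq ennreal_mult_top)
  qed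
qed

text \<open>Superlinear growth wins from the point where \<open>b * n powr (p - 1) = L\<close>;
  below it the linear term is bounded by a constant.\<close>

lemma linear_le_powr:
  fixes p b L :: real
  assumes "1 < p" "0 < b" "0 \<le> L"
  obtains M where "\<And>n::nat. L * real n \<le> M + b * real n powr p"
proof
  let ?N = "(L / b) powr (1 / (p - 1))"
  fix n :: nat
  show "L * real n \<le> L * ?N + b * real n powr p"
  proof (cases "real n \<le> ?N")
    case True
    then show ?thesis
      using assms by (intro add_increasing2 mult_left_mono) auto
  next
    case False
    then have n: "0 < real n" "?N \<le> real n"
      using powr_ge_zero[of "L / b" "1 / (p - 1)"] by linarith+
    have "L / b = ?N powr (p - 1)"
      using assms by (simp add: powr_powr)
    also have "\<dots> \<le> real n powr (p - 1)"
      using n assms by (intro powr_mono2) auto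
    finally have "L \<le> b * real n powr (p - 1)"
      using assms by (simp add: field_simps)
    then have "L * real n \<le> (b * real n powr (p - 1)) * real n"
      using n by (intro mult_right_mono) auto
    also have "\<dots> = b * real n powr p"
      using n by (simp add: powr_diff)
    finally show ?thesis
      using assms by (simp add: add_increasing)
  qed
qed

text \<open>The hypothesis \<open>le\<close> is the logarithm of the required estimate. It is stated
  with a free \<open>M\<close> and a free pair \<open>r\<close>, \<open>r'\<close> so as to cover
  both the lowering and the raising of the parameter.\<close>

lemma dominated_dilate_exp:
  fixes x :: ennreal
  assumes C: "1 \<le> C" and x: "x \<noteq> 0" "x \<noteq> \<infinity>"
    and le: "\<And>n::nat. ln C * real n \<le> M + (r - r') * real n powr (1 / (2 * enn2real x))"
  shows "dominated mi_blocks (\<lambda>\<alpha>. C ^ mi_size \<alpha>) (wt r (Num x)) (wt r' (Num x))"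
  unfolding dominated_def
proof (intro exI conjI allI ballI)
  show "0 < exp M" by simp
  fix \<alpha> \<beta> :: "nat ^ 'n" assume "\<beta> \<in> mi_blocks \<alpha>"
  then have eq: "mi_size \<beta> = mi_size \<alpha>"
    by (simp add: mi_blocks_def)
  let ?n = "mi_size \<alpha>" and ?p = "1 / (2 * enn2real x)"
  have "C ^ ?n * exp (r' * real ?n powr ?p) = exp (ln C * real ?n + r' * real ?n powr ?p)"
    using C by (simp add: exp_add exp_of_nat2_mult)
  also have "\<dots> \<le> exp (M + r * real ?n powr ?p)"
    using le[of ?n] by (simp add: algebra_simps)
  also have "\<dots> = exp M * exp (r * real ?n powr ?p)"
    by (simp add: exp_add)
  finally have "ennreal (C ^ ?n * exp (r' * real ?n powr ?p)) \<le> ennreal (exp M * exp (r * real ?n powr ?p))"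
    by (rule ennreal_leI)
  then show "ennreal (C ^ mi_size \<alpha>) * wt r' (Num x) \<alpha> \<le> ennreal (exp M) * wt r (Num x) \<beta>"
    using C x by (simp add: eq ennreal_mult)
qed

text \<open>The factor \<open>C\<close> and the loss from comparing factorials are both geometric in
  the degree, hence both fit into the factor \<open>r ^ n\<close> of the weight, leaving the
  constant 1.\<close>

lemma dominated_dilate_flat:
  assumes C: "1 \<le> C" and \<sigma>: "0 < \<sigma>" and r: "0 < r'"
    and r': "r' * C * (2 ^ CARD('n::finite)) powr (1 / (2 * \<sigma>)) \<le> r"
  shows "dominated mi_blocks (\<lambda>\<alpha> :: nat ^ 'n. C ^ mi_size \<alpha>) (wt r (Flat \<sigma>)) (wt r' (Flat \<sigma>))"
  unfolding dominated_def
proof (intro exI conjI allI ballI)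
  show "(0::real) < 1" by simp
  fix \<alpha> \<beta> :: "nat ^ 'n" assume "\<beta> \<in> mi_blocks \<alpha>"
  then have eq: "mi_size \<beta> = mi_size \<alpha>"
    by (simp add: mi_blocks_def)
  let ?n = "mi_size \<alpha>" and ?e = "1 / (2 * \<sigma>)" and ?D = "2 ^ CARD('n) :: real"
  have "mi_fact \<alpha> powr ?e \<le> (?D ^ ?n * mi_fact \<beta>) powr ?e"
    using \<sigma> mi_fact_le_mi_fact[OF eq] by (intro powr_mono2) (auto intro: less_imp_le)
  also have "\<dots> = (?D powr ?e) ^ ?n * mi_fact \<beta> powr ?e"
    by (simp add: powr_mult less_imp_le powr_powr powr_realpow[symmetric] mult.commute)
  finally have "C ^ ?n * (r' ^ ?n * mi_fact \<alpha> powr ?e)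
      \<le> C ^ ?n * (r' ^ ?n * ((?D powr ?e) ^ ?n * mi_fact \<beta> powr ?e))"
    using C r by (intro mult_left_mono) auto
  also have "\<dots> = (r' * C * ?D powr ?e) ^ ?n * mi_fact \<beta> powr ?e"
    by (simp add: power_mult_distrib mult_ac)
  also have "\<dots> \<le> r ^ ?n * mi_fact \<beta> powr ?e"
    using r' r C by (intro mult_right_mono power_mono) auto
  finally have "ennreal (C ^ ?n * (r' ^ ?n * mi_fact \<alpha> powr ?e)) \<le> ennreal (r ^ ?n * mi_fact \<beta> powr ?e)"
    by (rule ennreal_leI)
  then show "ennreal (C ^ ?n) * wt r' (Flat \<sigma>) \<alpha> \<le> ennreal 1 * wt r (Flat \<sigma>) \<beta>"
    using C r by (simp add: eq ennreal_mult)
qed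

lemma enn2real_half_bounds:
  fixes x :: ennreal
  assumes "0 < x" "x \<le> 1/2"
  shows "x \<noteq> \<infinity>" "0 < enn2real x" "enn2real x \<le> 1/2" "x < 1/2 \<Longrightarrow> enn2real x < 1/2"
proof -
  have half: "(1/2::ennreal) = ennreal (1/2)"
    using divide_ennreal[of 1 2] by simp
  with assms(2) obtain a where a: "x = ennreal a" "0 \<le> a"
    by (cases x) (auto simp: top_unique)
  then show "x \<noteq> \<infinity>" "0 < enn2real x"
    using assms by auto
  from a have "enn2real x = a" by simp
  then show "enn2real x \<le> 1/2" "x < 1/2 \<Longrightarrow> enn2real x < 1/2"
    using a assms unfolding half by (simp_all only: ennreal_le_iff ennreal_less_iff)
qed

text \<open>For \<open>0 < s < 1/2\<close> the exponent \<open>1 / (2 * s)\<close> exceeds 1, so any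
  positive part of the exponential weight beats \<open>C ^ n\<close>. The clause for index 0 is
  there because its weights are decreasing in \<open>r\<close>, so that a smaller parameter would
  not be harmless.\<close>

lemma dominated_dilate_down:
  assumes C: "1 \<le> C" and s: "s \<in> flat_indices" "s < Num (1/2)" and r: "0 < r"
  obtains r' where "0 < r'" "r' \<le> r" "s = Num 0 \<Longrightarrow> r' = r"
    "dominated mi_blocks (\<lambda>\<alpha> :: nat ^ 'n::finite. C ^ mi_size \<alpha>) (wt r s) (wt r' s)"
proof (cases s)
  case (Num x)
  show ?thesis
  proof (cases "x = 0")
    case True
    then show ?thesis
      using that[of r] r dominated_dilate_zero[OF C] Num by auto
  next
    case False
    with s Num have x: "0 < x" "x \<le> 1/2" "x < 1/2"
      by (auto simp: zero_less_iff_neq_zero)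
    note b = enn2real_half_bounds[OF x(1,2)]
    \<comment> \<open>Half of \<open>r\<close> is spent on the factor, the other half remains as the
      new parameter.\<close>
    have "1 < 1 / (2 * enn2real x)" "0 < r / 2" "0 \<le> ln C"
      using b(2) b(4)[OF x(3)] r C by (auto simp: field_simps)
    from linear_le_powr[OF this] obtain M
      where "\<And>n::nat. ln C * real n \<le> M + r / 2 * real n powr (1 / (2 * enn2real x))"
      by blast
    then have "dominated mi_blocks (\<lambda>\<alpha> :: nat ^ 'n. C ^ mi_size \<alpha>) (wt r s) (wt (r / 2) s)"
      unfolding Num using b(1) False by (intro dominated_dilate_exp C) auto
    then show ?thesis
      using r False Num by (intro that[of "r / 2"]) auto
  qed
next
  case (Flat \<sigma>)
  with s have \<sigma>: "0 < \<sigma>"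
    by (auto simp: flat_indices_def)
  \<comment> \<open>The total geometric loss per degree: the dilation times the comparison of
    factorials.\<close>
  define D where "D = C * (2 ^ CARD('n)) powr (1 / (2 * \<sigma>))"
  have "(1::real) \<le> (2 ^ CARD('n)) powr (1 / (2 * \<sigma>))"
    using \<sigma> by (intro ge_one_powr_ge_zero) auto
  with C have D: "1 \<le> D"
    unfolding D_def using mult_mono[of 1 C 1] by simp
  show ?thesis
  proof (rule that[of "r / D"])
    show "0 < r / D" "r / D \<le> r"
      using r D by (auto simp: field_simps)
    show "dominated mi_blocks (\<lambda>\<alpha> :: nat ^ 'n. C ^ mi_size \<alpha>) (wt r s) (wt (r / D) s)"
      unfolding Flat using r D by (intro dominated_dilate_flat C \<sigma>) (auto simp: D_def mult.assoc)
  qed (simp add: Flat)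
qed

text \<open>Now the exponent \<open>1 / (2 * s)\<close> may equal 1, where weight and factor are
  both exponentials of the degree: the parameter has to gain \<open>ln C\<close>, which is possible
  because it may be raised.\<close>

lemma dominated_dilate_up:
  assumes C: "1 \<le> C" and s: "s \<in> flat_indices" "Num 0 < s" "s \<le> Num (1/2)" and r: "0 < r"
  obtains r' where "r \<le> r'"
    "dominated mi_blocks (\<lambda>\<alpha> :: nat ^ 'n::finite. C ^ mi_size \<alpha>) (wt r' s) (wt r s)"
proof (cases s)
  case (Num x)
  with s have x: "0 < x" "x \<le> 1/2"
    by (auto simp: less_eq_gs_index_def)
  note b = enn2real_half_bounds[OF x]
  have p: "1 \<le> 1 / (2 * enn2real x)"
    using b(2,3) by (simp add: field_simps)
  have "ln C * real n \<le> 0 + (r + ln C - r) * real n powr (1 / (2 * enn2real x))" for n :: nat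
  proof (cases "n = 0")
    case False
    then have "real n powr 1 \<le> real n powr (1 / (2 * enn2real x))"
      using p by (intro powr_mono) auto
    then show ?thesis
      using C by (simp add: mult_left_mono)
  qed simp
  then have "dominated mi_blocks (\<lambda>\<alpha> :: nat ^ 'n. C ^ mi_size \<alpha>) (wt (r + ln C) s) (wt r s)"
    unfolding Num using x(1) b(1) by (intro dominated_dilate_exp[where M = 0] C) auto
  then show ?thesis
    using C by (intro that[of "r + ln C"]) auto
next
  case (Flat \<sigma>)
  with s have \<sigma>: "0 < \<sigma>"
    by (auto simp: flat_indices_def)
  define D where "D = C * (2 ^ CARD('n)) powr (1 / (2 * \<sigma>))"
  have "(1::real) \<le> (2 ^ CARD('n)) powr (1 / (2 * \<sigma>))"
    using \<sigma> by (intro ge_one_powr_ge_zero) auto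
  with C have D: "1 \<le> D"
    unfolding D_def using mult_mono[of 1 C 1] by simp
  show ?thesis
  proof (rule that[of "r * D"])
    show "r \<le> r * D"
      using r D by simp
    show "dominated mi_blocks (\<lambda>\<alpha> :: nat ^ 'n. C ^ mi_size \<alpha>) (wt (r * D) s) (wt r s)"
      unfolding Flat using r by (intro dominated_dilate_flat C \<sigma>) (auto simp: D_def mult.assoc)
  qed
qed

section \<open>Block matrices on the limit spaces\<close>

text \<open>Smaller weights have larger sequence spaces, so this expresses that the spaces are
  directed upwards, whichever way the weights vary with the parameter.\<close>

definition directed_family :: "(real \<Rightarrow> 'a \<Rightarrow> ennreal) \<Rightarrow> bool" where
  "directed_family U \<longleftrightarrow> (\<forall>r\<in>{0<..}. \<forall>r'\<in>{0<..}. \<exists>k\<in>{0<..}. U k \<le> U r \<and> U k \<le> U r')"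

lemma directed_familyE:
  assumes "directed_family U" "0 < r" "0 < r'"
  obtains k where "0 < k" "U k \<le> U r" "U k \<le> U r'"
  using assms unfolding directed_family_def by (meson greaterThan_iff)

lemma directed_family_mono:
  assumes "\<And>r r'. 0 < r \<Longrightarrow> r \<le> r' \<Longrightarrow> U r \<le> U r'"
  shows "directed_family U"
  unfolding directed_family_def
proof (intro ballI)
  fix r r' :: real assume "r \<in> {0<..}" "r' \<in> {0<..}"
  then show "\<exists>k\<in>{0<..}. U k \<le> U r \<and> U k \<le> U r'"
    using assms by (intro bexI[of _ "min r r'"]) auto
qed

lemma directed_family_antimono:
  assumes "\<And>r r'. 0 < r \<Longrightarrow> r \<le> r' \<Longrightarrow> U r' \<le> U r"
  shows "directed_family U"
  unfolding directed_family_def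
proof (intro ballI)
  fix r r' :: real assume "r \<in> {0<..}" "r' \<in> {0<..}"
  then show "\<exists>k\<in>{0<..}. U k \<le> U r \<and> U k \<le> U r'"
    using assms by (intro bexI[of _ "max r r'"]) auto
qed

section \<open>Monotonicity and product form of the weights\<close>

abbreviation (input) inv_wt :: "real \<Rightarrow> gs_index \<Rightarrow> nat ^ 'n::finite \<Rightarrow> ennreal" where
  "inv_wt r s \<equiv> \<lambda>\<alpha>. inverse (wt r s \<alpha>)"

lemma wt_le: "0 < r \<Longrightarrow> r \<le> r' \<Longrightarrow> s \<noteq> Num 0 \<Longrightarrow> wt r s \<le> wt r' s"
  by (intro le_funI wt_mono)

lemma wt_zero_le: "r \<le> r' \<Longrightarrow> wt r' (Num 0) \<le> wt r (Num 0)"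
  by (intro le_funI wt_zero_antimono)

lemma ennreal_inverse_antimono: "x \<le> y \<Longrightarrow> inverse y \<le> inverse (x :: ennreal)"
  by (cases "x = 0"; cases x; cases y)
    (auto simp: inverse_ennreal top_unique intro!: ennreal_leI le_imp_inverse_le)

lemma inv_wt_le: "u \<le> v \<Longrightarrow> (\<lambda>\<alpha>. inverse (v \<alpha>)) \<le> (\<lambda>\<alpha>. inverse (u \<alpha> :: ennreal))"
  by (auto simp: le_fun_def intro: ennreal_inverse_antimono)

lemma directed_wt: "directed_family (\<lambda>r. wt r s)"
  by (cases "s = Num 0")
    (auto intro: directed_family_mono wt_le directed_family_antimono wt_zero_le)

lemma directed_inv_wt: "directed_family (\<lambda>r. inv_wt r s)"
proof (cases "s = Num 0")
  case True
  then show ?thesis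
    by (intro directed_family_mono) (auto intro: inv_wt_le wt_zero_le simp del: wt.simps)
next
  case False
  then show ?thesis
    by (intro directed_family_antimono) (auto intro: inv_wt_le wt_le)
qed

lemma tens_wt_le: "u \<le> u' \<Longrightarrow> v \<le> v' \<Longrightarrow> tens_wt u v \<le> tens_wt u' v'"
  by (auto simp: tens_wt_def le_fun_def intro: mult_mono)

lemma directed_tens_left: "directed_family U \<Longrightarrow> directed_family (\<lambda>r. tens_wt (U r) v)"
  unfolding directed_family_def by (meson order_refl tens_wt_le)

lemma directed_tens_right: "directed_family V \<Longrightarrow> directed_family (\<lambda>r. tens_wt u (V r))"
  unfolding directed_family_def by (meson order_refl tens_wt_le)

lemma wt_B_eq: "wt_B s2 s1 r2 r1 = tens_wt (wt r2 s2) (inv_wt r1 s1)"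
  by (auto simp: wt_B_def tens_wt_def divide_ennreal_def)

lemma wt_B_dual_eq: "wt_B_dual s2 s1 r2 r1 = tens_wt (inv_wt r2 s2) (wt r1 s1)"
  by (auto simp: wt_B_dual_def tens_wt_def divide_ennreal_def mult.commute)

lemma wt_A_eq: "wt_A s2 s1 r2 r1 = tens_wt (wt r2 s2) (wt r1 s1)"
  by (auto simp: wt_A_def tens_wt_def)

lemma ennreal_inverse_mult_pos: "0 < x \<Longrightarrow> 0 < y \<Longrightarrow> inverse (x * y) = inverse x * inverse (y :: ennreal)"
  by (intro ennreal_inverse_mult') auto

text \<open>Positive parameters make the weights positive; \<open>inverse\<close> is not
  multiplicative at a product of 0 and infinity.\<close>

lemma wt_A_dual_eq:
  assumes "0 < r2" "0 < r1"
  shows "wt_A_dual s2 s1 r2 r1 = tens_wt (inv_wt r2 s2) (inv_wt r1 s1)"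
  by (auto simp: wt_A_dual_def wt_A_def tens_wt_def divide_ennreal_def ennreal_inverse_mult_pos wt_pos assms)

section \<open>Continuity on simple and iterated limits\<close>

lemma lin_subspace_UN_ell:
  assumes "I \<noteq> {}" and "\<And>i j. i \<in> I \<Longrightarrow> j \<in> I \<Longrightarrow> \<exists>k\<in>I. \<omega> k \<le> \<omega> i \<and> \<omega> k \<le> \<omega> j"
  shows "lin_subspace (\<Union>i\<in>I. topspace (ell (\<omega> i)))"
  unfolding topspace_ell
proof (rule lin_subspace_directed_UN[OF assms(1) lin_subspace_ell_carrier])
  fix i j assume "i \<in> I" "j \<in> I"
  with assms(2) obtain k where "k \<in> I" "\<omega> k \<le> \<omega> i" "\<omega> k \<le> \<omega> j"
    by blast
  then show "\<exists>k\<in>I. ell_carrier (\<omega> i) \<subseteq> ell_carrier (\<omega> k) \<and> ell_carrier (\<omega> j) \<subseteq> ell_carrier (\<omega> k)"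
    using ell_carrier_antimono unfolding le_fun_def by metis
qed

lemma continuous_map_ind_ell:
  assumes T: "lin_op T" and "I \<noteq> {}"
    and dir: "\<And>i j. i \<in> I \<Longrightarrow> j \<in> I \<Longrightarrow> \<exists>k\<in>I. \<omega> k \<le> \<omega> i \<and> \<omega> k \<le> \<omega> j"
      "\<And>i j. i \<in> I \<Longrightarrow> j \<in> I \<Longrightarrow> \<exists>k\<in>I. \<omega>' k \<le> \<omega>' i \<and> \<omega>' k \<le> \<omega>' j"
    and "\<And>i. i \<in> I \<Longrightarrow> \<exists>j\<in>I. continuous_map (ell (\<omega> i)) (ell (\<omega>' j)) T"
  shows "continuous_map (ind_lim I (\<lambda>i. ell (\<omega> i))) (ind_lim I (\<lambda>i. ell (\<omega>' i))) T"
  using assms by (intro continuous_map_ind_lim T lin_subspace_UN_ell) (auto simp: topspace_ell)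

text \<open>The two parameters are changed independently: the inductive one is moved forward from
  source to target by \<open>\<phi>\<close>, the projective one is chosen backward from target to
  source by \<open>\<psi>\<close>. Hence the same step estimate serves both orders of the
  limits.\<close>

lemma continuous_map_proj_ind:
  fixes \<omega> :: "real \<Rightarrow> real \<Rightarrow> 'a \<Rightarrow> ennreal"
  assumes T: "lin_op T" and dir: "\<And>p. directed_family (\<lambda>q. \<omega> q p)"
    and pos: "\<And>q. 0 < q \<Longrightarrow> 0 < \<phi> q" "\<And>p. 0 < p \<Longrightarrow> 0 < \<psi> p"
    and step: "\<And>q p. 0 < q \<Longrightarrow> 0 < p \<Longrightarrow> continuous_map (ell (\<omega> q (\<psi> p))) (ell (\<omega> (\<phi> q) p)) T"
  shows "continuous_map (proj_lim {0<..} (\<lambda>p. ind_lim {0<..} (\<lambda>q. ell (\<omega> q p))))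
    (proj_lim {0<..} (\<lambda>p. ind_lim {0<..} (\<lambda>q. ell (\<omega> q p)))) T"
proof (rule continuous_map_proj_lim)
  fix p :: real assume "p \<in> {0<..}"
  then have p: "0 < p" by simp
  have "continuous_map (ind_lim {0<..} (\<lambda>q. ell (\<omega> q (\<psi> p)))) (ind_lim {0<..} (\<lambda>q. ell (\<omega> q p))) T"
  proof (intro continuous_map_ind_ell T)
    fix q :: real assume "q \<in> {0<..}"
    then show "\<exists>q'\<in>{0<..}. continuous_map (ell (\<omega> q (\<psi> p))) (ell (\<omega> q' p)) T"
      using step[OF _ p, of q] pos(1)[of q] by (intro bexI[of _ "\<phi> q"]) auto
  qed (use dir in \<open>simp_all add: directed_family_def del: bex_simps\<close>)
  then show "\<exists>p'\<in>{0<..}. continuous_map (ind_lim {0<..} (\<lambda>q. ell (\<omega> q p'))) (ind_lim {0<..} (\<lambda>q. ell (\<omega> q p))) T"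
    using pos(2)[OF p] by auto
qed auto

text \<open>Here the members of the union are intersections over \<open>p\<close>, so directedness
  needs a \<open>k\<close> that is independent of \<open>p\<close>; product weights provide
  it.\<close>

lemma continuous_map_ind_proj:
  fixes \<omega> :: "real \<Rightarrow> real \<Rightarrow> 'a \<Rightarrow> ennreal"
  assumes T: "lin_op T" and dir: "\<And>q q'. 0 < q \<Longrightarrow> 0 < q' \<Longrightarrow> \<exists>k>0. \<forall>p. \<omega> k p \<le> \<omega> q p \<and> \<omega> k p \<le> \<omega> q' p"
    and pos: "\<And>q. 0 < q \<Longrightarrow> 0 < \<phi> q" "\<And>p. 0 < p \<Longrightarrow> 0 < \<psi> p"
    and step: "\<And>q p. 0 < q \<Longrightarrow> 0 < p \<Longrightarrow> continuous_map (ell (\<omega> q (\<psi> p))) (ell (\<omega> (\<phi> q) p)) T"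
  shows "continuous_map (ind_lim {0<..} (\<lambda>q. proj_lim {0<..} (\<lambda>p. ell (\<omega> q p))))
    (ind_lim {0<..} (\<lambda>q. proj_lim {0<..} (\<lambda>p. ell (\<omega> q p)))) T"
proof -
  let ?X = "\<lambda>q. proj_lim {0<..} (\<lambda>p. ell (\<omega> q p))"
  have top: "topspace (?X q) = (\<Inter>p\<in>{0<..}. ell_carrier (\<omega> q p))" for q
    by (subst topspace_proj_lim) (auto simp: topspace_ell)
  have lin: "lin_subspace (\<Union>q\<in>{0<..}. topspace (?X q))"
  proof (rule lin_subspace_directed_UN)
    show "lin_subspace (topspace (?X q))" for q
      unfolding top by (intro lin_subspace_INT lin_subspace_ell_carrier)
    fix q q' :: real assume "q \<in> {0<..}" "q' \<in> {0<..}"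
    then obtain k where k: "0 < k" "\<And>p. \<omega> k p \<le> \<omega> q p" "\<And>p. \<omega> k p \<le> \<omega> q' p"
      using dir[of q q'] by auto
    have "ell_carrier (\<omega> q p) \<subseteq> ell_carrier (\<omega> k p)" "ell_carrier (\<omega> q' p) \<subseteq> ell_carrier (\<omega> k p)" for p
      using k(2,3)[of p] by (simp_all add: le_fun_def ell_carrier_antimono)
    then have "topspace (?X q) \<subseteq> topspace (?X k) \<and> topspace (?X q') \<subseteq> topspace (?X k)"
      unfolding top by (intro conjI INT_anti_mono order_refl)
    then show "\<exists>k\<in>{0<..}. topspace (?X q) \<subseteq> topspace (?X k) \<and> topspace (?X q') \<subseteq> topspace (?X k)"
      using k(1) by auto
  qed auto
  have zero: "(\<lambda>_. 0) \<in> topspace (?X q)" for q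
    unfolding top by simp
  show ?thesis
  proof (rule continuous_map_ind_lim[OF T lin zero lin zero])
    fix q :: real assume "q \<in> {0<..}"
    then have q: "0 < q" by simp
    have "continuous_map (?X q) (?X (\<phi> q)) T"
      using step[OF q] pos(2) by (intro continuous_map_proj_lim) auto
    then show "\<exists>q'\<in>{0<..}. continuous_map (?X q) (?X q') T"
      using pos(1)[OF q] by auto
  qed
qed

lemma directed_tens_left_uniform:
  assumes "directed_family U" "0 < q" "0 < q'"
  shows "\<exists>k>0. \<forall>p. tens_wt (U k) (V p) \<le> tens_wt (U q) (V p) \<and> tens_wt (U k) (V p) \<le> tens_wt (U q') (V p)"
  using assms unfolding directed_family_def by (meson greaterThan_iff order_refl tens_wt_le)

lemma directed_tens_right_uniform:
  assumes "directed_family V" "0 < q" "0 < q'"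
  shows "\<exists>k>0. \<forall>p. tens_wt (U p) (V k) \<le> tens_wt (U p) (V q) \<and> tens_wt (U p) (V k) \<le> tens_wt (U p) (V q')"
  using assms unfolding directed_family_def by (meson greaterThan_iff order_refl tens_wt_le)

text \<open>Blocks may be finer than the degree: with singleton blocks the identity costs no factor, so that
  nothing is required of the index of a variable which is not substituted.\<close>

definition bounded_blocks :: "('a \<Rightarrow> 'a set) \<Rightarrow> ('a \<Rightarrow> 'a \<Rightarrow> complex) \<Rightarrow> ('a \<Rightarrow> real) \<Rightarrow> bool" where
  "bounded_blocks F m h \<longleftrightarrow> blocks F \<and> (\<forall>\<alpha>. 0 < h \<alpha>) \<and> (\<forall>\<alpha>. \<forall>\<beta>\<in>F \<alpha>. h \<beta> = h \<alpha>) \<and>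
     (\<forall>\<alpha>. \<forall>\<beta>\<in>F \<alpha>. cmod (m \<beta> \<alpha>) * card (F \<alpha>) \<le> h \<alpha>)"

lemma continuous_map_ell_tens:
  assumes m: "bounded_blocks F m h" "bounded_blocks G n k"
    and dom: "dominated F h u u'" "dominated G k v v'"
  shows "continuous_map (ell (tens_wt u v)) (ell (tens_wt u' v')) (mat_op (tens_blocks F G) (tens_mat m n))"
proof (rule continuous_map_ell_mat_op)
  show "blocks (tens_blocks F G)"
    using m by (intro blocks_tens) (auto simp: bounded_blocks_def)
  show "dominated (tens_blocks F G) (\<lambda>(a, b). h a * k b) (tens_wt u v) (tens_wt u' v')"
    using m by (intro dominated_tens dom) (auto simp: bounded_blocks_def intro: less_imp_le)
  fix \<gamma> \<delta> assume "\<delta> \<in> tens_blocks F G \<gamma>"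
  then obtain a b a' b' where ab: "\<gamma> = (a, b)" "\<delta> = (a', b')" "a' \<in> F a" "b' \<in> G b"
    by (auto simp: tens_blocks_def split: prod.splits)
  have "(cmod (m a' a) * card (F a)) * (cmod (n b' b) * card (G b)) \<le> h a * k b"
    using m ab by (intro mult_mono) (auto simp: bounded_blocks_def intro: less_imp_le)
  then show "cmod (tens_mat m n \<delta> \<gamma>) * card (tens_blocks F G \<gamma>) \<le> (case \<gamma> of (a, b) \<Rightarrow> h a * k b)"
    by (simp add: ab tens_mat_def tens_blocks_def card_cartesian_product norm_mult mult_ac)
qed

lemma dominated_inv_wt:
  assumes "bounded_blocks F m h" "0 < r" "0 < r'" "dominated F h (wt r s) (wt r' s)"
  shows "dominated F h (inv_wt r' s) (inv_wt r s)"
  using assms by (intro dominated_inverse wt_pos) (auto simp: bounded_blocks_def)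

text \<open>In each of these spaces numerators carry inductive parameters and denominators
  projective ones. Lowering therefore goes forward in the numerator and, through the inverted
  weights, backward in the denominator.\<close>

lemma continuous_map_spaces_R:
  fixes F2 :: "nat ^ 'd2::finite \<Rightarrow> (nat ^ 'd2) set" and F1 :: "nat ^ 'd1::finite \<Rightarrow> (nat ^ 'd1) set"
  assumes m2: "bounded_blocks F2 m2 h2" and m1: "bounded_blocks F1 m1 h1"
    and d2: "\<And>r. 0 < r \<Longrightarrow> \<exists>r'. 0 < r' \<and> r' \<le> r \<and> (s2 = Num 0 \<longrightarrow> r' = r) \<and> dominated F2 h2 (wt r s2) (wt r' s2)"
    and d1: "\<And>r. 0 < r \<Longrightarrow> \<exists>r'. 0 < r' \<and> r' \<le> r \<and> (s1 = Num 0 \<longrightarrow> r' = r) \<and> dominated F1 h1 (wt r s1) (wt r' s1)"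
    and X: "X \<in> spaces_R s2 s1"
  shows "continuous_map X X (mat_op (tens_blocks F2 F1) (tens_mat m2 m1))"
proof -
  let ?T = "mat_op (tens_blocks F2 F1) (tens_mat m2 m1)"
  obtain \<phi>2 where \<phi>2: "\<And>r. 0 < r \<Longrightarrow> 0 < \<phi>2 r" "\<And>r. 0 < r \<Longrightarrow> \<phi>2 r \<le> r"
    "\<And>r. 0 < r \<Longrightarrow> s2 = Num 0 \<Longrightarrow> \<phi>2 r = r" "\<And>r. 0 < r \<Longrightarrow> dominated F2 h2 (wt r s2) (wt (\<phi>2 r) s2)"
    using d2 by metis
  obtain \<phi>1 where \<phi>1: "\<And>r. 0 < r \<Longrightarrow> 0 < \<phi>1 r" "\<And>r. 0 < r \<Longrightarrow> \<phi>1 r \<le> r"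
    "\<And>r. 0 < r \<Longrightarrow> s1 = Num 0 \<Longrightarrow> \<phi>1 r = r" "\<And>r. 0 < r \<Longrightarrow> dominated F1 h1 (wt r s1) (wt (\<phi>1 r) s1)"
    using d1 by metis
  have i2: "dominated F2 h2 (inv_wt (\<phi>2 r) s2) (inv_wt r s2)" if "0 < r" for r
    using that by (intro dominated_inv_wt[OF m2] \<phi>2)
  have i1: "dominated F1 h1 (inv_wt (\<phi>1 r) s1) (inv_wt r s1)" if "0 < r" for r
    using that by (intro dominated_inv_wt[OF m1] \<phi>1)
  note tens = continuous_map_ell_tens[OF m2 m1]
  note T = lin_op_mat_op[of "tens_blocks F2 F1" "tens_mat m2 m1"]
  \<comment> \<open>The one-parameter limits need a common value. If both indices are nonzero, the
    minimum only decreases the weights; if both are 0, \<open>\<phi>2\<close> and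
    \<open>\<phi>1\<close> fix \<open>r\<close> and so does the minimum.\<close>
  let ?\<phi> = "\<lambda>r. min (\<phi>2 r) (\<phi>1 r)"
  have common: "wt (?\<phi> r) s2 \<le> wt (\<phi>2 r) s2 \<and> wt (?\<phi> r) s1 \<le> wt (\<phi>1 r) s1"
    if "\<not> mixed_zero s2 s1" "0 < r" for r
  proof (cases "s2 = Num 0")
    case True
    with that show ?thesis
      by (simp add: mixed_zero_def \<phi>2 \<phi>1 del: wt.simps)
  next
    case False
    with that show ?thesis
      by (auto simp: mixed_zero_def intro!: wt_le \<phi>2 \<phi>1)
  qed
  have A_step: "continuous_map (ell (wt_A s2 s1 r2 r1)) (ell (wt_A s2 s1 (\<phi>2 r2) (\<phi>1 r1))) ?T"
    if "0 < r2" "0 < r1" for r2 r1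
    unfolding wt_A_eq using that by (intro tens \<phi>2 \<phi>1)
  have A'_step: "continuous_map (ell (wt_A_dual s2 s1 (\<phi>2 r2) (\<phi>1 r1))) (ell (wt_A_dual s2 s1 r2 r1)) ?T"
    if r: "0 < r2" "0 < r1" for r2 r1
    unfolding wt_A_dual_eq[OF r] wt_A_dual_eq[OF \<phi>2(1)[OF r(1)] \<phi>1(1)[OF r(2)]]
    using r by (intro tens i2 i1)
  have A: "continuous_map (space_A s2 s1) (space_A s2 s1) ?T"
  proof (cases "mixed_zero s2 s1")
    case True
    let ?\<omega> = "\<lambda>(r2, r1). wt_A s2 s1 r2 r1 :: (nat ^ 'd2) \<times> (nat ^ 'd1) \<Rightarrow> ennreal"
    \<comment> \<open>The two factors vary in opposite directions with their parameters, so each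
      parameter is chosen separately.\<close>
    have dir: "\<exists>k\<in>{0<..} \<times> {0<..}. ?\<omega> k \<le> ?\<omega> i \<and> ?\<omega> k \<le> ?\<omega> j"
      if ij: "i \<in> {0<..} \<times> {0<..}" "j \<in> {0<..} \<times> {0<..}" for i j
    proof -
      have pos: "0 < fst i" "0 < fst j" "0 < snd i" "0 < snd j"
        using ij by (auto simp: mem_Times_iff)
      obtain k2 where "0 < k2" "wt k2 s2 \<le> (wt (fst i) s2 :: nat ^ 'd2 \<Rightarrow> ennreal)"
        "wt k2 s2 \<le> (wt (fst j) s2 :: nat ^ 'd2 \<Rightarrow> ennreal)"
        by (rule directed_familyE[OF directed_wt pos(1,2)])
      moreover obtain k1 where "0 < k1" "wt k1 s1 \<le> (wt (snd i) s1 :: nat ^ 'd1 \<Rightarrow> ennreal)"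
        "wt k1 s1 \<le> (wt (snd j) s1 :: nat ^ 'd1 \<Rightarrow> ennreal)"
        by (rule directed_familyE[OF directed_wt pos(3,4)])
      ultimately show ?thesis
        by (intro bexI[of _ "(k2, k1)"]) (auto simp: wt_A_eq case_prod_beta intro!: tens_wt_le)
    qed
    have eq: "(\<lambda>(r2, r1). ell (wt_A s2 s1 r2 r1)) = (\<lambda>i. ell ((\<lambda>(r2, r1). wt_A s2 s1 r2 r1) i))"
      by auto
    show ?thesis
      unfolding space_A_def if_P[OF True] eq
    proof (intro continuous_map_ind_ell T dir)
      fix i :: "real \<times> real" assume "i \<in> {0<..} \<times> {0<..}"
      then obtain r2 r1 where i: "i = (r2, r1)" "0 < r2" "0 < r1"
        by auto
      show "\<exists>j\<in>{0<..} \<times> {0<..}. continuous_map (ell (?\<omega> i)) (ell (?\<omega> j)) ?T"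
        using A_step[OF i(2,3)] i \<phi>2(1) \<phi>1(1) by (intro bexI[of _ "(\<phi>2 r2, \<phi>1 r1)"]) simp_all
    qed (auto simp: ex_in_conv[symmetric] intro: zero_less_one)
  next
    case False
    let ?\<omega> = "\<lambda>r. wt_A s2 s1 r r :: (nat ^ 'd2) \<times> (nat ^ 'd1) \<Rightarrow> ennreal"
    have "directed_family ?\<omega>"
    proof (cases "s2 = Num 0")
      case True
      then show ?thesis
        unfolding wt_A_eq using False
        by (intro directed_family_antimono tens_wt_le) (simp_all add: mixed_zero_def wt_zero_le del: wt.simps)
    next
      case s2: False
      then show ?thesis
        unfolding wt_A_eq using False
        by (intro directed_family_mono tens_wt_le) (simp_all add: mixed_zero_def wt_le del: wt.simps)
    qed
    then have dir: "\<exists>k\<in>{0<..}. ?\<omega> k \<le> ?\<omega> i \<and> ?\<omega> k \<le> ?\<omega> j"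
      if "i \<in> {0<..}" "j \<in> {0<..}" for i j
      using that unfolding directed_family_def by blast
    show ?thesis
      unfolding space_A_def if_not_P[OF False]
    proof (intro continuous_map_ind_ell T dir)
      fix r :: real assume "r \<in> {0<..}"
      then have r: "0 < r" by simp
      have "continuous_map (ell (wt_A s2 s1 r r)) (ell (wt_A s2 s1 (?\<phi> r) (?\<phi> r))) ?T"
        unfolding wt_A_eq
        using common[OF False r] \<phi>2(4)[OF r] \<phi>1(4)[OF r] by (intro tens) (blast intro: dominated_mono)+
      then show "\<exists>j\<in>{0<..}. continuous_map (ell (wt_A s2 s1 r r)) (ell (wt_A s2 s1 j j)) ?T"
        using r \<phi>2(1) \<phi>1(1) by (intro bexI[of _ "?\<phi> r"]) auto
    qed auto
  qed
  have A': "continuous_map (space_A_dual s2 s1) (space_A_dual s2 s1) ?T"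
  proof (cases "mixed_zero s2 s1")
    case True
    show ?thesis
      unfolding space_A_dual_def if_P[OF True]
    proof (rule continuous_map_proj_lim)
      fix j :: "real \<times> real" assume "j \<in> {0<..} \<times> {0<..}"
      then obtain r2 r1 where j: "j = (r2, r1)" "0 < r2" "0 < r1"
        by auto
      show "\<exists>i\<in>{0<..} \<times> {0<..}. continuous_map ((\<lambda>(r2, r1). ell (wt_A_dual s2 s1 r2 r1)) i)
          ((\<lambda>(r2, r1). ell (wt_A_dual s2 s1 r2 r1)) j) ?T"
        using A'_step[OF j(2,3)] j \<phi>2(1) \<phi>1(1) by (intro bexI[of _ "(\<phi>2 r2, \<phi>1 r1)"]) simp_all
    qed auto
  next
    case False
    show ?thesis
      unfolding space_A_dual_def if_not_P[OF False]
    proof (rule continuous_map_proj_lim)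
      fix r :: real assume "r \<in> {0<..}"
      then have r: "0 < r" by simp
      then have \<phi>: "0 < ?\<phi> r"
        using \<phi>2(1) \<phi>1(1) by simp
      have "continuous_map (ell (wt_A_dual s2 s1 (?\<phi> r) (?\<phi> r))) (ell (wt_A_dual s2 s1 r r)) ?T"
        unfolding wt_A_dual_eq[OF r r] wt_A_dual_eq[OF \<phi> \<phi>]
        using common[OF False r] i2[OF r] i1[OF r] by (intro tens) (blast intro: dominated_mono inv_wt_le)+
      then show "\<exists>i\<in>{0<..}. continuous_map (ell (wt_A_dual s2 s1 i i)) (ell (wt_A_dual s2 s1 r r)) ?T"
        using \<phi> by (intro bexI[of _ "?\<phi> r"]) auto
    qed auto
  qed
  have B_step: "continuous_map (ell (wt_B s2 s1 r2 (\<phi>1 r1))) (ell (wt_B s2 s1 (\<phi>2 r2) r1)) ?T"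
    if "0 < r2" "0 < r1" for r2 r1
    unfolding wt_B_eq using that by (intro tens \<phi>2 i1)
  have B'_step: "continuous_map (ell (wt_B_dual s2 s1 (\<phi>2 r2) r1)) (ell (wt_B_dual s2 s1 r2 (\<phi>1 r1))) ?T"
    if "0 < r2" "0 < r1" for r2 r1
    unfolding wt_B_dual_eq using that by (intro tens \<phi>1 i2)
  have "continuous_map (space_B s2 s1) (space_B s2 s1) ?T"
    unfolding space_B_def
    by (intro continuous_map_proj_ind[where \<omega> = "wt_B s2 s1" and \<phi> = \<phi>2 and \<psi> = \<phi>1]
        T \<phi>2(1) \<phi>1(1) B_step) (unfold wt_B_eq wt_B_dual_eq, intro directed_tens_left directed_wt)
  moreover have "continuous_map (space_B_dual s2 s1) (space_B_dual s2 s1) ?T"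
    unfolding space_B_dual_def
    by (intro continuous_map_proj_ind[where \<omega> = "\<lambda>q p. wt_B_dual s2 s1 p q" and \<phi> = \<phi>1 and \<psi> = \<phi>2]
        T \<phi>2(1) \<phi>1(1) B'_step) (unfold wt_B_eq wt_B_dual_eq, intro directed_tens_right directed_wt)
  moreover have "continuous_map (space_C s2 s1) (space_C s2 s1) ?T"
    unfolding space_C_def
    by (intro continuous_map_ind_proj[where \<omega> = "wt_B s2 s1" and \<phi> = \<phi>2 and \<psi> = \<phi>1]
        T \<phi>2(1) \<phi>1(1) B_step) (unfold wt_B_eq wt_B_dual_eq, intro directed_tens_left_uniform directed_wt)
  moreover have "continuous_map (space_C_dual s2 s1) (space_C_dual s2 s1) ?T"
    unfolding space_C_dual_def
    by (intro continuous_map_ind_proj[where \<omega> = "\<lambda>q p. wt_B_dual s2 s1 p q" and \<phi> = \<phi>1 and \<psi> = \<phi>2]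
        T \<phi>2(1) \<phi>1(1) B'_step) (unfold wt_B_eq wt_B_dual_eq, intro directed_tens_right_uniform directed_wt)
  ultimately show ?thesis
    using X A A' unfolding spaces_R_def by blast
qed

lemma continuous_map_zero_unless:
  assumes "lin_op T" "P \<Longrightarrow> continuous_map X X T"
  shows "continuous_map (zero_unless P X) (zero_unless P X) T"
  using assms by (auto simp: zero_unless_def lin_op_zero)

text \<open>The mirror image of the previous argument: inductive and projective parameters exchange
  places, so raising takes over the role of lowering. If an index is 0, only the zero space
  remains.\<close>

lemma continuous_map_spaces_B:
  fixes F2 :: "nat ^ 'd2::finite \<Rightarrow> (nat ^ 'd2) set" and F1 :: "nat ^ 'd1::finite \<Rightarrow> (nat ^ 'd1) set"
  assumes m2: "bounded_blocks F2 m2 h2" and m1: "bounded_blocks F1 m1 h1"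
    and d2: "\<And>r. 0 < r \<Longrightarrow> \<exists>r'. r \<le> r' \<and> dominated F2 h2 (wt r' s2) (wt r s2)"
    and d1: "\<And>r. 0 < r \<Longrightarrow> \<exists>r'. r \<le> r' \<and> dominated F1 h1 (wt r' s1) (wt r s1)"
    and X: "X \<in> spaces_B s2 s1"
  shows "continuous_map X X (mat_op (tens_blocks F2 F1) (tens_mat m2 m1))"
proof -
  let ?T = "mat_op (tens_blocks F2 F1) (tens_mat m2 m1)"
  obtain \<phi>2 where \<phi>2: "\<And>r. 0 < r \<Longrightarrow> r \<le> \<phi>2 r" "\<And>r. 0 < r \<Longrightarrow> dominated F2 h2 (wt (\<phi>2 r) s2) (wt r s2)"
    using d2 by metis
  obtain \<phi>1 where \<phi>1: "\<And>r. 0 < r \<Longrightarrow> r \<le> \<phi>1 r" "\<And>r. 0 < r \<Longrightarrow> dominated F1 h1 (wt (\<phi>1 r) s1) (wt r s1)"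
    using d1 by metis
  have pos: "0 < \<phi>2 r" "0 < \<phi>1 r" if "0 < r" for r
    using that \<phi>2(1)[of r] \<phi>1(1)[of r] by auto
  have i2: "dominated F2 h2 (inv_wt r s2) (inv_wt (\<phi>2 r) s2)" if "0 < r" for r
    using that pos by (intro dominated_inv_wt[OF m2] \<phi>2)
  have i1: "dominated F1 h1 (inv_wt r s1) (inv_wt (\<phi>1 r) s1)" if "0 < r" for r
    using that pos by (intro dominated_inv_wt[OF m1] \<phi>1)
  note tens = continuous_map_ell_tens[OF m2 m1]
  note T = lin_op_mat_op[of "tens_blocks F2 F1" "tens_mat m2 m1"]
  \<comment> \<open>Both indices are nonzero wherever this is used, so the weights increase in
    \<open>r\<close> and the maximum dominates both choices.\<close>
  let ?\<phi> = "\<lambda>r. max (\<phi>2 r) (\<phi>1 r)"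
  have common: "wt (\<phi>2 r) s2 \<le> wt (?\<phi> r) s2" "wt (\<phi>1 r) s1 \<le> wt (?\<phi> r) s1"
    if "both_nonzero s2 s1" "0 < r" for r
    using that pos[OF that(2)] by (simp_all add: both_nonzero_def wt_le)
  have A: "continuous_map (space_A0 s2 s1) (space_A0 s2 s1) ?T"
    unfolding space_A0_def
  proof (intro continuous_map_zero_unless T continuous_map_proj_lim)
    fix r :: real assume nz: "both_nonzero s2 s1" and "r \<in> {0<..}"
    then have r: "0 < r" by simp
    have "continuous_map (ell (wt_A s2 s1 (?\<phi> r) (?\<phi> r))) (ell (wt_A s2 s1 r r)) ?T"
      unfolding wt_A_eq
      using common[OF nz r] \<phi>2(2)[OF r] \<phi>1(2)[OF r] by (intro tens) (blast intro: dominated_mono)+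
    then show "\<exists>i\<in>{0<..}. continuous_map (ell (wt_A s2 s1 i i)) (ell (wt_A s2 s1 r r)) ?T"
      using pos[OF r] by (intro bexI[of _ "?\<phi> r"]) auto
  qed auto
  have A': "continuous_map (space_A0_dual s2 s1) (space_A0_dual s2 s1) ?T"
    unfolding space_A0_dual_def
  proof (intro continuous_map_zero_unless T)
    assume nz: "both_nonzero s2 s1"
    have dir: "\<exists>k\<in>{0<..}. wt_A_dual s2 s1 k k \<le> (wt_A_dual s2 s1 i i :: (nat ^ 'd2) \<times> (nat ^ 'd1) \<Rightarrow> ennreal) \<and> 
        wt_A_dual s2 s1 k k \<le> (wt_A_dual s2 s1 j j :: (nat ^ 'd2) \<times> (nat ^ 'd1) \<Rightarrow> ennreal)"
      if "i \<in> {0<..}" "j \<in> {0<..}" for i j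
      using that nz
      by (intro bexI[of _ "max i j"]) (auto simp: wt_A_dual_eq both_nonzero_def intro!: tens_wt_le inv_wt_le wt_le)
    show "continuous_map (ind_lim {0<..} (\<lambda>r. ell (wt_A_dual s2 s1 r r)))
        (ind_lim {0<..} (\<lambda>r. ell (wt_A_dual s2 s1 r r))) ?T"
    proof (intro continuous_map_ind_ell T dir)
      fix r :: real assume "r \<in> {0<..}"
      then have r: "0 < r" by simp
      then have \<phi>: "0 < ?\<phi> r"
        using pos[OF r] by simp
      have "continuous_map (ell (wt_A_dual s2 s1 r r)) (ell (wt_A_dual s2 s1 (?\<phi> r) (?\<phi> r))) ?T"
        unfolding wt_A_dual_eq[OF r r] wt_A_dual_eq[OF \<phi> \<phi>]
        using common[OF nz r] i2[OF r] i1[OF r] by (intro tens) (blast intro: dominated_mono inv_wt_le)+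
      then show "\<exists>j\<in>{0<..}. continuous_map (ell (wt_A_dual s2 s1 r r)) (ell (wt_A_dual s2 s1 j j)) ?T"
        using \<phi> by (intro bexI[of _ "?\<phi> r"]) auto
    qed auto
  qed
  have B_step: "continuous_map (ell (wt_B s2 s1 (\<phi>2 r2) r1)) (ell (wt_B s2 s1 r2 (\<phi>1 r1))) ?T"
    if "0 < r2" "0 < r1" for r2 r1
    unfolding wt_B_eq using that by (intro tens \<phi>2 i1)
  have B'_step: "continuous_map (ell (wt_B_dual s2 s1 r2 (\<phi>1 r1))) (ell (wt_B_dual s2 s1 (\<phi>2 r2) r1)) ?T"
    if "0 < r2" "0 < r1" for r2 r1
    unfolding wt_B_dual_eq using that by (intro tens \<phi>1 i2)
  have "continuous_map (space_B0 s2 s1) (space_B0 s2 s1) ?T"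
    unfolding space_B0_def
    by (intro continuous_map_zero_unless continuous_map_proj_ind[where \<omega> = "\<lambda>q p. wt_B s2 s1 p q" and \<phi> = \<phi>1 and \<psi> = \<phi>2]
        T pos  B_step) (unfold wt_B_eq wt_B_dual_eq, intro directed_tens_right directed_inv_wt)
  moreover have "continuous_map (space_B0_dual s2 s1) (space_B0_dual s2 s1) ?T"
    unfolding space_B0_dual_def
    by (intro continuous_map_zero_unless continuous_map_proj_ind[where \<omega> = "wt_B_dual s2 s1" and \<phi> = \<phi>2 and \<psi> = \<phi>1]
        T pos  B'_step) (unfold wt_B_eq wt_B_dual_eq, intro directed_tens_left directed_inv_wt)
  moreover have "continuous_map (space_C0 s2 s1) (space_C0 s2 s1) ?T"
    unfolding space_C0_def
    by (intro continuous_map_zero_unless continuous_map_ind_proj[where \<omega> = "\<lambda>q p. wt_B s2 s1 p q" and \<phi> = \<phi>1 and \<psi> = \<phi>2]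
        T pos  B_step) (unfold wt_B_eq wt_B_dual_eq, intro directed_tens_right_uniform directed_inv_wt)
  moreover have "continuous_map (space_C0_dual s2 s1) (space_C0_dual s2 s1) ?T"
    unfolding space_C0_dual_def
    by (intro continuous_map_zero_unless continuous_map_ind_proj[where \<omega> = "wt_B_dual s2 s1" and \<phi> = \<phi>2 and \<psi> = \<phi>1]
        T pos  B'_step) (unfold wt_B_eq wt_B_dual_eq, intro directed_tens_left_uniform directed_inv_wt)
  ultimately show ?thesis
    using X A A' unfolding spaces_B_def by blast
qed

section \<open>The matrix of a linear substitution\<close>

definition mi_power :: "nat ^ 'n::finite \<Rightarrow> complex ^ 'n \<Rightarrow> complex" where
  "mi_power \<alpha> z = (\<Prod>i\<in>UNIV. (z $ i) ^ (\<alpha> $ i))"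

lemma herm_eq: "herm \<alpha> z = mi_power \<alpha> z / complex_of_real (sqrt (mi_fact \<alpha>))"
  by (simp add: herm_def mi_power_def)

lemma mi_size_add: "mi_size (\<alpha> + \<beta>) = mi_size \<alpha> + mi_size \<beta>"
  by (simp add: mi_size_def sum.distrib)

lemma mi_size_axis [simp]: "mi_size (axis j k) = k"
  by (simp add: mi_size_def axis_def if_distrib cong: if_cong)

lemma mi_size_eq_0_iff [simp]: "mi_size \<alpha> = 0 \<longleftrightarrow> \<alpha> = 0"
  by (auto simp: mi_size_def vec_eq_iff)

lemma mi_power_add: "mi_power (\<alpha> + \<beta>) z = mi_power \<alpha> z * mi_power \<beta> z"
  by (simp add: mi_power_def power_add prod.distrib)

lemma mi_power_axis: "mi_power (axis j k) z = (z $ j) ^ k"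
proof -
  have "(z $ i) ^ (axis j k $ i) = (if i = j then (z $ j) ^ k else 1)" for i
    by (simp add: axis_def)
  then show ?thesis
    by (simp add: mi_power_def)
qed

lemma mi_power_0 [simp]: "mi_power 0 z = 1"
  by (simp add: mi_power_def)

lemma mi_power_one: "mi_power \<alpha> 1 = 1"
  by (simp add: mi_power_def)

lemma
  fixes n :: nat
  shows finite_mi_size: "finite {\<beta> :: nat ^ 'n::finite. mi_size \<beta> = n}"
    and card_mi_size_le: "card {\<beta> :: nat ^ 'n. mi_size \<beta> = n} \<le> (Suc n) ^ CARD('n)"
proof -
  let ?P = "PiE (UNIV :: 'n set) (\<lambda>_. {..n})"
  \<comment> \<open>The simplex of degree \<open>n\<close> lies in a cube with \<open>n + 1\<close>
    values per coordinate.\<close>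
  have sub: "{\<beta> :: nat ^ 'n. mi_size \<beta> = n} \<subseteq> (\<lambda>f. \<chi> i. f i) ` ?P"
  proof
    fix \<beta> :: "nat ^ 'n" assume "\<beta> \<in> {\<beta>. mi_size \<beta> = n}"
    then have "\<beta> $ i \<le> n" for i
      unfolding mi_size_def using member_le_sum[of i UNIV "\<lambda>i. \<beta> $ i"] by auto
    then show "\<beta> \<in> (\<lambda>f. \<chi> i. f i) ` ?P"
      by (intro image_eqI[of _ _ "\<lambda>i. \<beta> $ i"]) auto
  qed
  have fin: "finite ?P"
    by (intro finite_PiE) auto
  then show "finite {\<beta> :: nat ^ 'n. mi_size \<beta> = n}"
    using sub finite_surj by blast
  have "card {\<beta> :: nat ^ 'n. mi_size \<beta> = n} \<le> card ((\<lambda>f. \<chi> i. f i) ` ?P :: (nat ^ 'n) set)"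
    using sub fin by (intro card_mono) auto
  also have "\<dots> \<le> card ?P"
    by (intro card_image_le fin)
  also have "\<dots> = (Suc n) ^ CARD('n)"
    by (simp add: card_PiE)
  finally show "card {\<beta> :: nat ^ 'n. mi_size \<beta> = n} \<le> (Suc n) ^ CARD('n)" .
qed

lemma finite_mi_blocks: "finite (mi_blocks \<alpha>)"
  unfolding mi_blocks_def by (rule finite_mi_size)

text \<open>A homogeneous polynomial \<open>f\<close> of degree \<open>n\<close>, where
  \<open>g\<close> majorises the sum of the absolute values of its terms. Such majorants multiply
  along with the polynomials, and they control single coefficients as well as absolute
  convergence.\<close>

definition hom_poly :: "nat \<Rightarrow> (complex ^ 'n::finite \<Rightarrow> complex) \<Rightarrow> (complex ^ 'n \<Rightarrow> real) \<Rightarrow> bool" where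
  "hom_poly n f g \<longleftrightarrow> (\<exists>q. (\<forall>z. f z = (\<Sum>\<beta> | mi_size \<beta> = n. q \<beta> * mi_power \<beta> z)) \<and>
     (\<forall>z. (\<Sum>\<beta> | mi_size \<beta> = n. cmod (q \<beta>) * cmod (mi_power \<beta> z)) \<le> g z))"

lemma hom_poly_one: "hom_poly 0 (\<lambda>_. 1) (\<lambda>_. 1)"
  unfolding hom_poly_def by (intro exI[of _ "\<lambda>_. 1"]) simp

lemma hom_poly_zero: "hom_poly n (\<lambda>_. 0) (\<lambda>_. 0)"
  unfolding hom_poly_def by (intro exI[of _ "\<lambda>_. 0"]) simp

lemma hom_poly_add:
  assumes "hom_poly n f g" "hom_poly n f' g'"
  shows "hom_poly n (\<lambda>z. f z + f' z) (\<lambda>z. g z + g' z)"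
proof -
  obtain q where q: "\<And>z. f z = (\<Sum>\<beta> | mi_size \<beta> = n. q \<beta> * mi_power \<beta> z)"
    "\<And>z. (\<Sum>\<beta> | mi_size \<beta> = n. cmod (q \<beta>) * cmod (mi_power \<beta> z)) \<le> g z"
    using assms(1) unfolding hom_poly_def by blast
  obtain q' where q': "\<And>z. f' z = (\<Sum>\<beta> | mi_size \<beta> = n. q' \<beta> * mi_power \<beta> z)"
    "\<And>z. (\<Sum>\<beta> | mi_size \<beta> = n. cmod (q' \<beta>) * cmod (mi_power \<beta> z)) \<le> g' z"
    using assms(2) unfolding hom_poly_def by blast
  have "(\<Sum>\<beta> | mi_size \<beta> = n. cmod (q \<beta> + q' \<beta>) * cmod (mi_power \<beta> z)) \<le> g z + g' z" for z
  proof -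
    have "(\<Sum>\<beta> | mi_size \<beta> = n. cmod (q \<beta> + q' \<beta>) * cmod (mi_power \<beta> z))
        \<le> (\<Sum>\<beta> | mi_size \<beta> = n. cmod (q \<beta>) * cmod (mi_power \<beta> z) + cmod (q' \<beta>) * cmod (mi_power \<beta> z))"
      by (intro sum_mono) (simp add: distrib_right[symmetric] mult_right_mono norm_triangle_ineq)
    also have "\<dots> \<le> g z + g' z"
      by (simp add: sum.distrib add_mono q(2) q'(2))
    finally show ?thesis .
  qed
  then show ?thesis
    unfolding hom_poly_def using q(1) q'(1)
    by (intro exI[of _ "\<lambda>\<beta>. q \<beta> + q' \<beta>"]) (auto simp: sum.distrib distrib_right)
qed

lemma hom_poly_sum:
  assumes "finite S" "\<And>j. j \<in> S \<Longrightarrow> hom_poly n (f j) (g j)"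
  shows "hom_poly n (\<lambda>z. \<Sum>j\<in>S. f j z) (\<lambda>z. \<Sum>j\<in>S. g j z)"
  using assms by (induction S) (auto intro: hom_poly_zero hom_poly_add)

text \<open>Multiplication by a coordinate shifts all exponents by a unit vector; this is injective
  on monomials, so no terms merge and the majorant is just multiplied.\<close>

lemma hom_poly_mult_coord:
  fixes j :: "'n::finite"
  assumes "hom_poly n f g"
  shows "hom_poly (Suc n) (\<lambda>z. a * z $ j * f z) (\<lambda>z. cmod a * cmod (z $ j) * g z)"
proof -
  obtain q where q: "\<And>z. f z = (\<Sum>\<beta> | mi_size \<beta> = n. q \<beta> * mi_power \<beta> z)"
    "\<And>z. (\<Sum>\<beta> | mi_size \<beta> = n. cmod (q \<beta>) * cmod (mi_power \<beta> z)) \<le> g z"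
    using assms(1) unfolding hom_poly_def by blast
  let ?e = "axis j 1 :: nat ^ 'n"
  \<comment> \<open>Subtraction of natural numbers truncates, so exponents outside the range of the
    shift are sent to 0 explicitly.\<close>
  define q' where "q' \<beta> = (if \<beta> $ j = 0 then 0 else a * q (\<beta> - ?e))" for \<beta>
  have q'_add: "q' (\<beta> + ?e) = a * q \<beta>" for \<beta>
    by (simp add: q'_def axis_def)
  have shift: "(\<Sum>\<beta> | mi_size \<beta> = Suc n. G \<beta>) = (\<Sum>\<beta> | mi_size \<beta> = n. G (\<beta> + ?e))"
    if "\<And>\<beta>. \<beta> $ j = 0 \<Longrightarrow> G \<beta> = 0" for G :: "nat ^ 'n \<Rightarrow> 'b::comm_monoid_add"
  proof -
    have inv: "\<beta> - ?e + ?e = \<beta>" if "\<beta> $ j \<noteq> 0" for \<beta> :: "nat ^ 'n"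
      using that by (auto simp: vec_eq_iff axis_def)
    have "mi_size (\<beta> - ?e) = n" if "mi_size \<beta> = Suc n" "\<beta> $ j \<noteq> 0" for \<beta>
      using mi_size_add[of "\<beta> - ?e" ?e] that(1) unfolding inv[OF that(2)] by simp
    then have img: "{\<beta>. mi_size \<beta> = Suc n} - (\<lambda>\<beta>. \<beta> + ?e) ` {\<beta>. mi_size \<beta> = n} \<subseteq> {\<beta>. \<beta> $ j = 0}"
      using inv by (force simp: image_iff)
    have "(\<Sum>\<beta> | mi_size \<beta> = Suc n. G \<beta>) = (\<Sum>\<beta>\<in>(\<lambda>\<beta>. \<beta> + ?e) ` {\<beta>. mi_size \<beta> = n}. G \<beta>)"
      using img that by (intro sum.mono_neutral_right) (auto simp: finite_mi_size mi_size_add)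
    also have "\<dots> = (\<Sum>\<beta> | mi_size \<beta> = n. G (\<beta> + ?e))"
      by (subst sum.reindex) (auto simp: inj_on_def)
    finally show ?thesis .
  qed
  have "a * z $ j * f z = (\<Sum>\<beta> | mi_size \<beta> = Suc n. q' \<beta> * mi_power \<beta> z)" for z
    by (subst shift) (simp_all add: q'_def[of \<open>_ :: nat ^ 'n\<close>] q'_add q(1) sum_distrib_left mi_power_add mi_power_axis mult_ac)
  moreover have "(\<Sum>\<beta> | mi_size \<beta> = Suc n. cmod (q' \<beta>) * cmod (mi_power \<beta> z)) \<le> cmod a * cmod (z $ j) * g z" for z
  proof -
    have "(\<Sum>\<beta> | mi_size \<beta> = Suc n. cmod (q' \<beta>) * cmod (mi_power \<beta> z))
        = cmod a * cmod (z $ j) * (\<Sum>\<beta> | mi_size \<beta> = n. cmod (q \<beta>) * cmod (mi_power \<beta> z))"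
      by (subst shift) (simp_all add: q'_def[of \<open>_ :: nat ^ 'n\<close>] q'_add sum_distrib_left mi_power_add mi_power_axis norm_mult mult_ac)
    also have "\<dots> \<le> cmod a * cmod (z $ j) * g z"
      by (intro mult_left_mono q(2)) auto
    finally show ?thesis .
  qed
  ultimately show ?thesis
    unfolding hom_poly_def by blast
qed

lemma hom_poly_mult_linear:
  fixes b :: "'n::finite \<Rightarrow> complex"
  assumes "hom_poly n f g"
  shows "hom_poly (Suc n) (\<lambda>z. (\<Sum>j\<in>UNIV. b j * z $ j) * f z) (\<lambda>z. (\<Sum>j\<in>UNIV. cmod (b j) * cmod (z $ j)) * g z)"
  unfolding sum_distrib_right by (intro hom_poly_sum hom_poly_mult_coord assms) simp

lemma hom_poly_mult_linear_power:
  fixes b :: "'n::finite \<Rightarrow> complex"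
  assumes "hom_poly n f g"
  shows "hom_poly (k + n) (\<lambda>z. (\<Sum>j\<in>UNIV. b j * z $ j) ^ k * f z)
    (\<lambda>z. (\<Sum>j\<in>UNIV. cmod (b j) * cmod (z $ j)) ^ k * g z)"
proof (induction k)
  case (Suc k)
  from hom_poly_mult_linear[OF this, of b] show ?case
    by (simp add: mult.assoc)
qed (simp add: assms)

lemma hom_poly_prod_linear:
  fixes B :: "'i \<Rightarrow> 'n::finite \<Rightarrow> complex"
  assumes "finite S"
  shows "hom_poly (\<Sum>i\<in>S. a i) (\<lambda>z. \<Prod>i\<in>S. (\<Sum>j\<in>UNIV. B i j * z $ j) ^ a i)
    (\<lambda>z. \<Prod>i\<in>S. (\<Sum>j\<in>UNIV. cmod (B i j) * cmod (z $ j)) ^ a i)"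
  using assms
proof (induction S)
  case empty
  then show ?case by (simp add: hom_poly_one)
next
  case (insert i S)
  from hom_poly_mult_linear_power[OF insert.IH, of "a i" "B i"] show ?case
    using insert.hyps by simp
qed

text \<open>The second conjunct makes the double series absolutely convergent when the expansion of an
  entire kernel is rearranged.\<close>

definition represents :: "complex ^ 'n::finite ^ 'n \<Rightarrow> (nat ^ 'n \<Rightarrow> (nat ^ 'n) set) \<Rightarrow>
    (nat ^ 'n \<Rightarrow> nat ^ 'n \<Rightarrow> complex) \<Rightarrow> bool" where
  "represents B F m \<longleftrightarrow> (\<forall>\<alpha> z. herm \<alpha> (B *v z) = (\<Sum>\<beta>\<in>F \<alpha>. m \<alpha> \<beta> * herm \<beta> z)) \<and>
     (\<forall>z. \<exists>w. \<forall>\<alpha>. (\<Sum>\<beta>\<in>F \<alpha>. cmod (m \<alpha> \<beta> * herm \<beta> z)) \<le> cmod (herm \<alpha> w))"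

text \<open>Used with singleton blocks only, where just the diagonal entries are read.\<close>

definition id_mat :: "'a \<Rightarrow> 'a \<Rightarrow> complex" where
  "id_mat \<alpha> \<beta> = 1"

lemma represents_mat_1: "represents (mat 1) (\<lambda>\<alpha>. {\<alpha>}) id_mat"
  by (auto simp: represents_def id_mat_def)

lemma bounded_blocks_id: "bounded_blocks (\<lambda>\<alpha>. {\<alpha>}) id_mat (\<lambda>_. 1)"
  by (auto simp: bounded_blocks_def blocks_def id_mat_def)

lemma dominated_id: "dominated (\<lambda>\<alpha>. {\<alpha>}) (\<lambda>_. 1) \<omega> \<omega>"
  unfolding dominated_def by (intro exI[of _ 1]) simp

lemma blocks_mi_blocks: "blocks mi_blocks"
  unfolding blocks_def using finite_mi_blocks by (auto simp: mi_blocks_def)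

text \<open>Each coordinate of \<open>B *v z\<close> is a linear form, so a monomial in it is a
  product of linear forms, whose majorant is the same product formed with absolute values.\<close>

lemma ex_represents:
  fixes B :: "complex ^ 'n::finite ^ 'n"
  obtains m C where "1 \<le> C" "represents B mi_blocks m" "bounded_blocks mi_blocks m (\<lambda>\<alpha>. C ^ mi_size \<alpha>)"
proof -
  let ?D = "2 ^ CARD('n) :: real"
  define g where "g \<alpha> z = (\<Prod>i\<in>UNIV. (\<Sum>j\<in>UNIV. cmod (B $ i $ j) * cmod (z $ j)) ^ (\<alpha> $ i))"
    for \<alpha> :: "nat ^ 'n" and z :: "complex ^ 'n"
  have "hom_poly (mi_size \<alpha>) (\<lambda>z. mi_power \<alpha> (B *v z)) (g \<alpha>)" for \<alpha>
    unfolding mi_size_def g_def mi_power_def matrix_vector_mult_def vec_lambda_beta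
    by (intro hom_poly_prod_linear) simp
  then have "\<forall>\<alpha>. \<exists>q. (\<forall>z. mi_power \<alpha> (B *v z) = (\<Sum>\<beta> | mi_size \<beta> = mi_size \<alpha>. q \<beta> * mi_power \<beta> z)) \<and>
      (\<forall>z. (\<Sum>\<beta> | mi_size \<beta> = mi_size \<alpha>. cmod (q \<beta>) * cmod (mi_power \<beta> z)) \<le> g \<alpha> z)"
    unfolding hom_poly_def by blast
  from choice[OF this] obtain q
    where q: "\<And>\<alpha> z. mi_power \<alpha> (B *v z) = (\<Sum>\<beta> | mi_size \<beta> = mi_size \<alpha>. q \<alpha> \<beta> * mi_power \<beta> z)"
      "\<And>\<alpha> z. (\<Sum>\<beta> | mi_size \<beta> = mi_size \<alpha>. cmod (q \<alpha> \<beta>) * cmod (mi_power \<beta> z)) \<le> g \<alpha> z"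
    by blast
  \<comment> \<open>Passage from the monomials to the normalised basis \<open>herm\<close>.\<close>
  define m where "m \<alpha> \<beta> = q \<alpha> \<beta> * complex_of_real (sqrt (mi_fact \<beta>) / sqrt (mi_fact \<alpha>))" for \<alpha> \<beta>
  have herm: "m \<alpha> \<beta> * herm \<beta> z = q \<alpha> \<beta> * mi_power \<beta> z / complex_of_real (sqrt (mi_fact \<alpha>))" for \<alpha> \<beta> z
    using mi_fact_pos[of \<beta>] by (simp add: m_def herm_eq less_imp_neq[symmetric])
  have "represents B mi_blocks m"
    unfolding represents_def mi_blocks_def
  proof (intro conjI allI)
    show "herm \<alpha> (B *v z) = (\<Sum>\<beta>\<in>{\<beta>. mi_size \<beta> = mi_size \<alpha>}. m \<alpha> \<beta> * herm \<beta> z)" for \<alpha> z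
      unfolding herm by (simp add: herm_eq q(1) sum_divide_distrib)
    fix z :: "complex ^ 'n"
    \<comment> \<open>With this vector the majorant is exactly the modulus of the monomial at
      \<open>w\<close>, simultaneously for all \<open>\<alpha>\<close>.\<close>
    define w :: "complex ^ 'n" where "w = (\<chi> i. complex_of_real (\<Sum>j\<in>UNIV. cmod (B $ i $ j) * cmod (z $ j)))"
    have "cmod (w $ i) = (\<Sum>j\<in>UNIV. cmod (B $ i $ j) * cmod (z $ j))" for i
      unfolding w_def vec_lambda_beta norm_of_real by (intro abs_of_nonneg sum_nonneg) simp
    then have w: "cmod (mi_power \<alpha> w) = g \<alpha> z" for \<alpha>
      by (simp add: mi_power_def g_def prod_norm[symmetric] norm_power)
    have "(\<Sum>\<beta> | mi_size \<beta> = mi_size \<alpha>. cmod (m \<alpha> \<beta> * herm \<beta> z)) \<le> cmod (herm \<alpha> w)" for \<alpha>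
    proof -
      have "(\<Sum>\<beta> | mi_size \<beta> = mi_size \<alpha>. cmod (m \<alpha> \<beta> * herm \<beta> z))
          = (\<Sum>\<beta> | mi_size \<beta> = mi_size \<alpha>. cmod (q \<alpha> \<beta>) * cmod (mi_power \<beta> z)) / sqrt (mi_fact \<alpha>)"
        unfolding herm using mi_fact_pos[of \<alpha>] by (simp add: norm_divide norm_mult sum_divide_distrib less_imp_le)
      also have "\<dots> \<le> g \<alpha> z / sqrt (mi_fact \<alpha>)"
        by (intro divide_right_mono q(2)) (simp add: less_imp_le)
      also have "\<dots> = cmod (herm \<alpha> w)"
        using mi_fact_pos[of \<alpha>] by (simp add: herm_eq norm_divide w less_imp_le)
      finally show ?thesis .
    qed
    then show "\<exists>w. \<forall>\<alpha>. (\<Sum>\<beta> | mi_size \<beta> = mi_size \<alpha>. cmod (m \<alpha> \<beta> * herm \<beta> z)) \<le> cmod (herm \<alpha> w)"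
      by blast
  qed
  \<comment> \<open>A bound for all absolute row sums; the summand 1 ensures
    \<open>1 \<le> L\<close>.\<close>
  define L where "L = 1 + (\<Sum>i\<in>UNIV. \<Sum>j\<in>UNIV. cmod (B $ i $ j))"
  have L: "1 \<le> L" "(\<Sum>j\<in>UNIV. cmod (B $ i $ j)) \<le> L" for i
  proof -
    show "1 \<le> L" by (simp add: L_def sum_nonneg)
    have "(\<Sum>j\<in>UNIV. cmod (B $ i $ j)) \<le> (\<Sum>i\<in>UNIV. \<Sum>j\<in>UNIV. cmod (B $ i $ j))"
      by (intro member_le_sum[of i UNIV "\<lambda>i. \<Sum>j\<in>UNIV. cmod (B $ i $ j)"]) (auto simp: sum_nonneg)
    then show "(\<Sum>j\<in>UNIV. cmod (B $ i $ j)) \<le> L" by (simp add: L_def)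
  qed
  have q_le: "cmod (q \<alpha> \<beta>) \<le> L ^ mi_size \<alpha>" if "mi_size \<beta> = mi_size \<alpha>" for \<alpha> \<beta>
  proof -
    have "cmod (q \<alpha> \<beta>) \<le> (\<Sum>\<beta> | mi_size \<beta> = mi_size \<alpha>. cmod (q \<alpha> \<beta>))"
      using that by (intro member_le_sum[of \<beta> _ "\<lambda>\<beta>. cmod (q \<alpha> \<beta>)"]) (auto simp: finite_mi_size)
    \<comment> \<open>At the all-ones vector every monomial is 1, so the majorant bounds the sum of
      the absolute coefficients.\<close>
    also have "\<dots> \<le> g \<alpha> 1"
      using q(2)[of \<alpha> 1] by (simp add: mi_power_one)
    also have "\<dots> \<le> (\<Prod>i\<in>UNIV. L ^ (\<alpha> $ i))"
      unfolding g_def by (intro prod_mono conjI power_mono zero_le_power) (auto simp: L(2) sum_nonneg)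
    also have "\<dots> = L ^ mi_size \<alpha>"
      by (simp add: mi_size_def power_sum)
    finally show ?thesis .
  qed
  \<comment> \<open>\<open>L\<close> bounds the coefficients, one \<open>?D\<close> the ratio of the
    normalisations, the other \<open>?D\<close> the size of the block.\<close>
  let ?C = "L * ?D * ?D"
  have "bounded_blocks mi_blocks m (\<lambda>\<alpha>. ?C ^ mi_size \<alpha>)"
    unfolding bounded_blocks_def
  proof (intro conjI allI ballI blocks_mi_blocks)
    show "0 < ?C ^ mi_size \<alpha>" for \<alpha> :: "nat ^ 'n"
      using L(1) by simp
    fix \<alpha> \<beta> :: "nat ^ 'n" assume "\<beta> \<in> mi_blocks \<alpha>"
    then have eq: "mi_size \<beta> = mi_size \<alpha>"
      by (simp add: mi_blocks_def)
    then show "?C ^ mi_size \<beta> = ?C ^ mi_size \<alpha>"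
      by simp
    let ?n = "mi_size \<alpha>"
    have ratio: "sqrt (mi_fact \<alpha>) / sqrt (mi_fact \<beta>) \<le> ?D ^ ?n"
    proof -
      have "mi_fact \<alpha> / mi_fact \<beta> \<le> ?D ^ ?n"
        using mi_fact_le_mi_fact[OF eq] mi_fact_pos[of \<beta>] by (simp add: divide_le_eq)
      also have "\<dots> \<le> (?D ^ ?n)\<^sup>2"
        by (simp add: power2_eq_square)
      finally show ?thesis
        unfolding real_sqrt_divide[symmetric] by (intro real_le_lsqrt) auto
    qed
    have card: "real (card (mi_blocks \<alpha>)) \<le> ?D ^ ?n"
    proof -
      have "card (mi_blocks \<alpha>) \<le> (Suc ?n) ^ CARD('n)"
        unfolding mi_blocks_def by (rule card_mi_size_le)
      \<comment> \<open>\<open>Suc n \<le> 2 ^ n\<close> makes the polynomial block size geometric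
        in the degree.\<close>
      also have "\<dots> \<le> (2 ^ ?n) ^ CARD('n)"
        by (intro power_mono) (auto simp: Suc_le_eq)
      finally have "real (card (mi_blocks \<alpha>)) \<le> real ((2 ^ ?n) ^ CARD('n))"
        by (rule of_nat_mono)
      then show ?thesis
        by (simp add: power_mult[symmetric] mult.commute)
    qed
    have "cmod (m \<beta> \<alpha>) = cmod (q \<beta> \<alpha>) * (sqrt (mi_fact \<alpha>) / sqrt (mi_fact \<beta>))"
      by (simp add: m_def norm_mult norm_divide less_imp_le)
    also have "\<dots> \<le> L ^ ?n * ?D ^ ?n"
      using q_le[of \<alpha> \<beta>] eq L(1) ratio by (intro mult_mono) (auto simp: less_imp_le)
    finally have "cmod (m \<beta> \<alpha>) * card (mi_blocks \<alpha>) \<le> (L ^ ?n * ?D ^ ?n) * ?D ^ ?n"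
      using L(1) by (intro mult_mono card) auto
    then show "cmod (m \<beta> \<alpha>) * card (mi_blocks \<alpha>) \<le> ?C ^ ?n"
      by (simp add: power_mult_distrib)
  qed
  moreover have "1 \<le> ?C"
    using L(1) mult_mono[of 1 L 1 "?D * ?D"] mult_mono[of 1 ?D 1 ?D] by simp
  ultimately show ?thesis
    using that \<open>represents B mi_blocks m\<close> by blast
qed

section \<open>Substitution into the expansion of a kernel\<close>

lemma cnj_vec_cnj_vec [simp]: "cnj_vec (cnj_vec z) = z"
  by (simp add: cnj_vec_def vec_eq_iff)

text \<open>Expansions are in the conjugate of \<open>z1\<close>; on that variable the substitution
  \<open>B1\<close> acts through the conjugate matrix.\<close>

definition cnj_mat :: "complex ^ 'n ^ 'm \<Rightarrow> complex ^ 'n ^ 'm" where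
  "cnj_mat B = (\<chi> i j. cnj (B $ i $ j))"

lemma cnj_vec_mult: "cnj_vec (B *v z) = cnj_mat B *v cnj_vec z"
  by (simp add: cnj_vec_def cnj_mat_def matrix_vector_mult_def vec_eq_iff)

lemma cnj_mat_1 [simp]: "cnj_mat (mat 1) = mat 1"
  by (simp add: cnj_mat_def mat_def vec_eq_iff)

text \<open>Each basis function at the substituted point is expanded into its block, and the
  resulting double series is regrouped by the new index.\<close>

lemma expands_pullback:
  fixes B2 :: "complex ^ 'd2::finite ^ 'd2" and B1 :: "complex ^ 'd1::finite ^ 'd1"
  assumes F: "blocks F2" "blocks F1" and rep: "represents B2 F2 m2" "represents (cnj_mat B1) F1 m1"
    and c: "expands c K"
  shows "expands (mat_op (tens_blocks F2 F1) (tens_mat m2 m1) c) (pullback B2 B1 K)"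
  unfolding expands_def
proof (intro allI)
  fix z2 :: "complex ^ 'd2" and z1 :: "complex ^ 'd1"
  let ?F = "tens_blocks F2 F1" and ?m = "tens_mat m2 m1"
  define H where "H x2 x1 = (\<lambda>(\<alpha>2, \<alpha>1). herm \<alpha>2 x2 * herm \<alpha>1 x1)"
    for x2 :: "complex ^ 'd2" and x1 :: "complex ^ 'd1"
  have c': "((\<lambda>\<delta>. c \<delta> * H x2 x1 \<delta>) has_sum K (x2, cnj_vec x1)) UNIV" for x2 x1
    using c unfolding expands_def H_def by (force simp: case_prod_unfold mult.assoc dest: spec2[of _ x2 "cnj_vec x1"])
  let ?y = "cnj_vec z1"
  have F': "blocks ?F"
    by (rule blocks_tens[OF F])
  obtain w2 where w2: "\<And>\<alpha>. (\<Sum>\<beta>\<in>F2 \<alpha>. cmod (m2 \<alpha> \<beta> * herm \<beta> z2)) \<le> cmod (herm \<alpha> w2)"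
    using rep(1) unfolding represents_def by blast
  obtain w1 where w1: "\<And>\<alpha>. (\<Sum>\<beta>\<in>F1 \<alpha>. cmod (m1 \<alpha> \<beta> * herm \<beta> ?y)) \<le> cmod (herm \<alpha> w1)"
    using rep(2) unfolding represents_def by blast
  \<comment> \<open>Terms of the double series: \<open>\<delta>\<close> is the old index,
    \<open>\<gamma>\<close> the new one.\<close>
  define f where "f = (\<lambda>(\<delta>, \<gamma>). c \<delta> * (?m \<delta> \<gamma> * H z2 ?y \<gamma>))"
  have inner: "(\<Sum>\<gamma>\<in>?F \<delta>. f (\<delta>, \<gamma>)) = c \<delta> * H (B2 *v z2) (cnj_mat B1 *v ?y) \<delta>" for \<delta>
  proof -
    obtain a b where ab: "\<delta> = (a, b)" by (cases \<delta>)
    have "(\<Sum>\<gamma>\<in>?F \<delta>. ?m \<delta> \<gamma> * H z2 ?y \<gamma>)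
        = (\<Sum>\<alpha>\<in>F2 a. m2 a \<alpha> * herm \<alpha> z2) * (\<Sum>\<beta>\<in>F1 b. m1 b \<beta> * herm \<beta> ?y)"
      unfolding sum_product sum.cartesian_product ab tens_blocks_def
      by (auto simp: tens_mat_def H_def mult_ac intro!: sum.cong)
    also have "\<dots> = H (B2 *v z2) (cnj_mat B1 *v ?y) \<delta>"
      using rep unfolding represents_def by (simp add: H_def ab)
    finally show ?thesis
      by (simp add: f_def sum_distrib_left[symmetric])
  qed
  have inner_abs: "(\<Sum>\<gamma>\<in>?F \<delta>. norm (f (\<delta>, \<gamma>))) \<le> norm (c \<delta> * H w2 w1 \<delta>)" for \<delta>
  proof -
    obtain a b where ab: "\<delta> = (a, b)" by (cases \<delta>)
    have "(\<Sum>\<gamma>\<in>?F \<delta>. cmod (?m \<delta> \<gamma> * H z2 ?y \<gamma>))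
        = (\<Sum>\<alpha>\<in>F2 a. cmod (m2 a \<alpha> * herm \<alpha> z2)) * (\<Sum>\<beta>\<in>F1 b. cmod (m1 b \<beta> * herm \<beta> ?y))"
      unfolding sum_product sum.cartesian_product ab tens_blocks_def
      by (auto simp: tens_mat_def H_def norm_mult mult_ac intro!: sum.cong)
    also have "\<dots> \<le> cmod (herm a w2) * cmod (herm b w1)"
      by (intro mult_mono w2 w1) (auto intro: sum_nonneg)
    finally have "cmod (c \<delta>) * (\<Sum>\<gamma>\<in>?F \<delta>. cmod (?m \<delta> \<gamma> * H z2 ?y \<gamma>)) \<le> cmod (c \<delta>) * (cmod (herm a w2) * cmod (herm b w1))"
      by (intro mult_left_mono) auto
    then show ?thesis
      by (simp add: f_def H_def ab norm_mult sum_distrib_left)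
  qed
  have fin: "finite (?F \<delta>)" for \<delta>
    using F' unfolding blocks_def by blast
  have "(\<lambda>x. norm (f x)) summable_on Sigma UNIV ?F"
    unfolding Infinite_Sum.abs_summable_on_Sigma_iff
  proof (intro conjI ballI)
    show "(\<lambda>\<gamma>. norm (f (\<delta>, \<gamma>))) summable_on ?F \<delta>" for \<delta>
      using fin by simp
    \<comment> \<open>The given expansion converges at every point, in particular at the majorising
      one, and for complex numbers unconditional convergence is absolute.\<close>
    have "(\<lambda>\<delta>. c \<delta> * H w2 w1 \<delta>) summable_on UNIV"
      using c' has_sum_imp_summable by blast
    then have "(\<lambda>\<delta>. norm (c \<delta> * H w2 w1 \<delta>)) summable_on UNIV"
      by (simp add: summable_on_iff_abs_summable_on_complex)
    then show "(\<lambda>\<delta>. norm (infsum (\<lambda>\<gamma>. norm (f (\<delta>, \<gamma>))) (?F \<delta>))) summable_on UNIV"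
      using inner_abs fin by (rule_tac Infinite_Sum.abs_summable_on_comparison_test') (auto simp: sum_nonneg)
  qed
  then have summable: "f summable_on Sigma UNIV ?F"
    by (rule abs_summable_summable)
  have "(f has_sum K (B2 *v z2, cnj_vec (cnj_mat B1 *v ?y))) (Sigma UNIV ?F)"
    by (rule has_sum_SigmaI[OF _ c' summable]) (use inner fin in \<open>auto intro!: has_sum_finiteI\<close>)
  also have "(B2 *v z2, cnj_vec (cnj_mat B1 *v ?y)) = (B2 *v z2, B1 *v z1)"
    by (simp add: cnj_vec_mult[symmetric])
  \<comment> \<open>Block membership is symmetric, so swapping the pair maps the index set onto
    itself. Summing over \<open>\<delta>\<close> first then produces the new coefficients.\<close>
  finally have "((\<lambda>(\<gamma>, \<delta>). f (\<delta>, \<gamma>)) has_sum pullback B2 B1 K (z2, z1)) (Sigma UNIV ?F)"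
    unfolding pullback_def prod.case
    by (rule has_sum_reindex_bij_witness[of _ "\<lambda>(a, b). (b, a)" "\<lambda>(a, b). (b, a)", THEN iffD1, rotated -1])
      (use F' in \<open>auto simp: blocks_def\<close>)
  then have "((\<lambda>\<gamma>. mat_op ?F ?m c \<gamma> * H z2 ?y \<gamma>) has_sum pullback B2 B1 K (z2, z1)) UNIV"
  proof (rule has_sum_SigmaD)
    fix \<gamma>
    show "((\<lambda>\<delta>. (\<lambda>(\<gamma>, \<delta>). f (\<delta>, \<gamma>)) (\<gamma>, \<delta>)) has_sum mat_op ?F ?m c \<gamma> * H z2 ?y \<gamma>) (?F \<gamma>)"
      by (intro has_sum_finiteI) (simp_all add: fin f_def mat_op_def sum_distrib_right mult.assoc)
  qed
  then show "((\<lambda>(\<alpha>2, \<alpha>1). mat_op ?F ?m c (\<alpha>2, \<alpha>1) * herm \<alpha>2 z2 * herm \<alpha>1 (cnj_vec z1)) has_sum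
      pullback B2 B1 K (z2, z1)) UNIV"
    by (simp add: H_def case_prod_unfold mult.assoc)
qed

section \<open>Power series of entire functions\<close>

definition upd :: "complex ^ 'n \<Rightarrow> 'n \<Rightarrow> complex \<Rightarrow> complex ^ 'n" where
  "upd x i w = (\<chi> j. if j = i then w else x $ j)"

lemma upd_nth [simp]: "upd x i w $ j = (if j = i then w else x $ j)"
  by (simp add: upd_def)

lemma upd_upd_same [simp]: "upd (upd x i v) i w = upd x i w"
  by (simp add: vec_eq_iff)

lemma upd_triv [simp]: "upd x i (x $ i) = x"
  by (simp add: vec_eq_iff)

lemma upd_commute: "i \<noteq> j \<Longrightarrow> upd (upd x i v) j w = upd (upd x j w) i v"
  by (simp add: vec_eq_iff)

lemma norm_axis_complex: "norm (axis i (a :: complex)) = cmod a"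
proof -
  have "(\<Sum>j\<in>UNIV. (cmod (if j = i then a else 0))\<^sup>2) = (\<Sum>j\<in>UNIV. if j = i then (cmod a)\<^sup>2 else 0)"
    by (intro sum.cong) auto
  then show ?thesis
    by (simp add: norm_vec_def L2_set_def axis_def)
qed

lemma norm_upd_le: "norm (upd x i w) \<le> norm x + cmod (w - x $ i)"
proof -
  have "upd x i w = x + axis i (w - x $ i)"
    by (simp add: vec_eq_iff axis_def)
  then show ?thesis
    using norm_triangle_ineq[of x "axis i (w - x $ i)"] by (simp add: norm_axis_complex)
qed

lemma continuous_on_upd [continuous_intros]:
  assumes "continuous_on S f" "continuous_on S g"
  shows "continuous_on S (\<lambda>x. upd (f x) i (g x))"
  unfolding upd_def
proof (rule continuous_on_vec_lambda)
  show "continuous_on S (\<lambda>x. if j = i then g x else f x $ j)" for j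
    using assms by (cases "j = i") (auto intro: continuous_on_component)
qed

text \<open>Joint continuity supplies bounds on compact sets, which make the one-variable Cauchy
  estimates uniform in the other variables. The class is preserved by partial derivatives and by
  Taylor coefficients in one variable.\<close>

definition sep_hol :: "(complex ^ 'n::finite \<Rightarrow> complex) \<Rightarrow> bool" where
  "sep_hol f \<longleftrightarrow> continuous_on UNIV f \<and> (\<forall>i x. (\<lambda>w. f (upd x i w)) holomorphic_on UNIV)"

definition part_deriv :: "'n \<Rightarrow> (complex ^ 'n::finite \<Rightarrow> complex) \<Rightarrow> complex ^ 'n \<Rightarrow> complex" where
  "part_deriv i f x = deriv (\<lambda>w. f (upd x i w)) (x $ i)"

text \<open>Replaces iterated derivatives along a line by functions on the whole space, so that they
  can be handled by induction on \<open>k\<close>.\<close>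

lemma funpow_part_deriv:
  "(deriv ^^ k) (\<lambda>w. f (upd x i w)) = (\<lambda>v. (part_deriv i ^^ k) f (upd x i v))"
  by (induction k) (simp_all add: part_deriv_def)

lemma sep_hol_bounded:
  assumes "sep_hol f"
  obtains M where "0 \<le> M" "\<And>x. norm x \<le> R \<Longrightarrow> cmod (f x) \<le> M"
proof -
  have "compact (f ` cball 0 R)"
    using assms by (intro compact_continuous_image compact_cball) (auto simp: sep_hol_def intro: continuous_on_subset)
  then obtain M where "\<And>x. norm x \<le> R \<Longrightarrow> cmod (f x) \<le> M"
    by (force dest!: compact_imp_bounded simp: bounded_iff)
  then show ?thesis
    using that[of "max M 0"] by fastforce
qed

text \<open>Taylor's formula of first order. The bound depends on \<open>h\<close> only through
  \<open>M\<close>, hence is uniform over families of lines.\<close>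

lemma difference_quotient_estimate:
  assumes hol: "h holomorphic_on UNIV" and M: "\<And>w. cmod (w - a) \<le> 2 \<Longrightarrow> cmod (h w) \<le> M"
    and t: "t \<noteq> 0" "cmod t \<le> 1"
  shows "cmod ((h (a + t) - h a) / t - deriv h a) \<le> 2 * M * cmod t"
proof -
  have hol_deriv: "(deriv ^^ k) h holomorphic_on UNIV" for k
    by (rule holomorphic_higher_deriv[OF hol open_UNIV])
  have "cmod ((deriv ^^ 0) h (a + t) - (\<Sum>i\<le>1. (deriv ^^ i) h a * ((a + t) - a) ^ i / fact i))
      \<le> (2 * M) * cmod ((a + t) - a) ^ Suc 1 / fact 1"
  proof (rule complex_Taylor[of "cball a 1"])
    show "((deriv ^^ i) h has_field_derivative (deriv ^^ Suc i) h x) (at x within cball a 1)" for i x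
      using holomorphic_derivI[OF hol_deriv open_UNIV, of x i] by (simp add: has_field_derivative_at_within)
    show "cmod ((deriv ^^ Suc 1) h x) \<le> 2 * M" if "x \<in> cball a 1" for x
    proof -
      \<comment> \<open>The unit circle about a point of \<open>cball a 1\<close> stays within
        distance 2 of \<open>a\<close>, where \<open>M\<close> bounds \<open>h\<close>.\<close>
      have "cmod ((deriv ^^ 2) h x) \<le> fact 2 * M / 1 ^ 2"
      proof (rule Cauchy_inequality)
        show "h holomorphic_on ball x 1" "continuous_on (cball x 1) h"
          using hol by (auto intro: holomorphic_on_subset holomorphic_on_imp_continuous_on)
        show "cmod (h w) \<le> M" if "cmod (x - w) = 1" for w
        proof (rule M)
          have "cmod (w - a) \<le> cmod (w - x) + cmod (x - a)"
            using norm_triangle_ineq[of "w - x" "x - a"] by simp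
          then show "cmod (w - a) \<le> 2"
            using that \<open>x \<in> cball a 1\<close> by (simp add: dist_norm norm_minus_commute)
        qed
      qed simp
      then show ?thesis
        by (simp add: numeral_2_eq_2)
    qed
  qed (use t in \<open>auto simp: dist_norm\<close>)
  then have "cmod (h (a + t) - h a - deriv h a * t) \<le> 2 * M * (cmod t)\<^sup>2"
    by (simp add: power2_eq_square diff_diff_eq)
  then have "cmod (h (a + t) - h a - deriv h a * t) / cmod t \<le> 2 * M * (cmod t)\<^sup>2 / cmod t"
    by (intro divide_right_mono) auto
  also have "cmod (h (a + t) - h a - deriv h a * t) / cmod t = cmod ((h (a + t) - h a) / t - deriv h a)"
    using t(1) by (simp add: norm_divide[symmetric] diff_divide_distrib)
  finally show ?thesis
    using t(1) by (simp add: power2_eq_square)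
qed

definition diff_quot :: "'n \<Rightarrow> (complex ^ 'n::finite \<Rightarrow> complex) \<Rightarrow> nat \<Rightarrow> complex ^ 'n \<Rightarrow> complex" where
  "diff_quot i f n x = (f (upd x i (x $ i + 1 / of_nat (Suc n))) - f x) / (1 / of_nat (Suc n))"

lemma uniform_limit_diff_quot:
  assumes f: "sep_hol f" and S: "bounded S"
  shows "uniform_limit S (diff_quot i f) (part_deriv i f) sequentially"
proof -
  obtain R where R: "\<And>x. x \<in> S \<Longrightarrow> norm x \<le> R"
    using S by (auto simp: bounded_iff)
  \<comment> \<open>The margin 2 is the distance at which the estimate of difference quotients
    evaluates the function.\<close>
  obtain M where M: "0 \<le> M" "\<And>x. norm x \<le> R + 2 \<Longrightarrow> cmod (f x) \<le> M"
    using sep_hol_bounded[OF f] by blast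
  have est: "dist (diff_quot i f n x) (part_deriv i f x) \<le> 2 * M * inverse (real (Suc n))" if "x \<in> S" for n x
  proof -
    let ?t = "1 / of_nat (Suc n) :: complex"
    have nt: "cmod ?t = inverse (real (Suc n))"
      by (simp add: norm_divide inverse_eq_divide del: of_nat_Suc)
    have "cmod ((f (upd x i (x $ i + ?t)) - f (upd x i (x $ i))) / ?t - deriv (\<lambda>w. f (upd x i w)) (x $ i)) \<le> 2 * M * cmod ?t"
    proof (rule difference_quotient_estimate)
      show "(\<lambda>w. f (upd x i w)) holomorphic_on UNIV"
        using f by (simp add: sep_hol_def)
      show "cmod (f (upd x i w)) \<le> M" if "cmod (w - x $ i) \<le> 2" for w
        using norm_upd_le[of x i w] R[OF \<open>x \<in> S\<close>] that by (intro M(2)) linarith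
      show "cmod ?t \<le> 1"
        unfolding nt by (simp add: field_simps)
    qed (simp del: of_nat_Suc)
    then show ?thesis
      unfolding nt by (simp add: diff_quot_def part_deriv_def dist_norm del: of_nat_Suc)
  qed
  show ?thesis
  proof (rule uniform_limitI)
    fix e :: real assume "0 < e"
    have "(\<lambda>n. 2 * M * inverse (real (Suc n))) \<longlonglongrightarrow> 2 * M * 0"
      by (intro tendsto_mult tendsto_const LIMSEQ_inverse_real_of_nat)
    then have "\<forall>\<^sub>F n in sequentially. 2 * M * inverse (real (Suc n)) < e"
      using \<open>0 < e\<close> by (intro order_tendstoD(2)) auto
    then show "\<forall>\<^sub>F n in sequentially. \<forall>x\<in>S. dist (diff_quot i f n x) (part_deriv i f x) < e"
      by eventually_elim (use est le_less_trans in blast)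
  qed
qed

text \<open>Difference quotients inherit continuity and holomorphy in each variable from
  \<open>f\<close>, and they converge uniformly on bounded sets.\<close>

lemma sep_hol_part_deriv:
  assumes f: "sep_hol f"
  shows "sep_hol (part_deriv i f)"
  unfolding sep_hol_def
proof (intro conjI allI)
  have cont: "continuous_on S f" for S
    using f continuous_on_subset unfolding sep_hol_def by blast
  have hol: "(\<lambda>w. f (upd x j w)) holomorphic_on S" for x j S
    using f holomorphic_on_subset unfolding sep_hol_def by blast
  show "continuous_on UNIV (part_deriv i f)"
  proof -
    have "continuous_on (ball 0 R) (part_deriv i f)" for R
    proof (rule uniform_limit_theorem)
      show "uniform_limit (ball 0 R) (diff_quot i f) (part_deriv i f) sequentially"
        by (rule uniform_limit_diff_quot[OF f bounded_ball])
      have "continuous_on (ball 0 R) (diff_quot i f n)" for n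
        unfolding diff_quot_def
        by (intro continuous_intros continuous_on_compose2[OF cont[of UNIV]]) (auto simp del: of_nat_Suc)
      then show "\<forall>\<^sub>F n in sequentially. continuous_on (ball 0 R) (diff_quot i f n)"
        by simp
    qed simp
    then have "isCont (part_deriv i f) x" for x
      by (rule continuous_on_interior[of "ball 0 (norm x + 1)"]) (simp add: interior_open)
    then show ?thesis
      by (simp add: continuous_at_imp_continuous_on)
  qed
  fix j x
  show "(\<lambda>w. part_deriv i f (upd x j w)) holomorphic_on UNIV"
  proof (rule holomorphic_uniform_sequence[OF open_UNIV])
    show "(\<lambda>w. diff_quot i f n (upd x j w)) holomorphic_on UNIV" for n
    proof (cases "j = i")
      case True
      have "(\<lambda>w. f (upd x i (w + 1 / of_nat (Suc n)))) holomorphic_on UNIV"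
        by (rule holomorphic_on_compose_gen[OF _ hol[of x i UNIV], unfolded o_def])
          (auto intro!: holomorphic_intros)
      then show ?thesis
        unfolding diff_quot_def True by (intro holomorphic_intros) (auto simp: hol simp del: of_nat_Suc)
    next
      case False
      then show ?thesis
        unfolding diff_quot_def by (intro holomorphic_intros) (auto simp: hol upd_commute[of j i] simp del: of_nat_Suc)
    qed
    fix v
    have "bounded (upd x j ` cball v 1)"
      unfolding bounded_iff
    proof (intro exI ballI)
      fix y assume "y \<in> upd x j ` cball v 1"
      then obtain w where w: "y = upd x j w" "cmod (v - w) \<le> 1"
        by (auto simp: dist_norm)
      have "cmod (w - x $ j) \<le> cmod (w - v) + cmod (v - x $ j)"
        using norm_triangle_ineq[of "w - v" "v - x $ j"] by simp
      then show "norm y \<le> norm x + (1 + cmod (v - x $ j))"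
        using norm_upd_le[of x j w] w by (simp add: norm_minus_commute)
    qed
    from uniform_limit_diff_quot[OF f this, of i]
    have "uniform_limit (cball v 1) (\<lambda>n w. diff_quot i f n (upd x j w)) (\<lambda>w. part_deriv i f (upd x j w)) sequentially"
      unfolding uniform_limit_iff by simp
    then show "\<exists>d. 0 < d \<and> cball v d \<subseteq> UNIV \<and>
        uniform_limit (cball v d) (\<lambda>n w. diff_quot i f n (upd x j w)) (\<lambda>w. part_deriv i f (upd x j w)) sequentially"
      by (intro exI[of _ 1]) auto
  qed
qed

section \<open>Taylor expansion in several variables, one variable at a time\<close>

definition taylor_coeff :: "'n \<Rightarrow> nat \<Rightarrow> (complex ^ 'n::finite \<Rightarrow> complex) \<Rightarrow> complex ^ 'n \<Rightarrow> complex" where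
  "taylor_coeff i k f x = (deriv ^^ k) (\<lambda>w. f (upd x i w)) 0 / fact k"

text \<open>Up to the factorial, the coefficient is an iterated partial derivative restricted to the
  hyperplane where coordinate \<open>i\<close> is 0.\<close>

lemma sep_hol_taylor_coeff:
  assumes f: "sep_hol f"
  shows "sep_hol (taylor_coeff i k f)"
proof -
  have g: "sep_hol ((part_deriv i ^^ k) f)"
    using f by (induction k) (auto intro: sep_hol_part_deriv)
  define g where "g = (part_deriv i ^^ k) f"
  have eq: "taylor_coeff i k f = (\<lambda>x. g (upd x i 0) / fact k)"
    by (simp add: taylor_coeff_def funpow_part_deriv g_def fun_eq_iff)
  have cont: "continuous_on UNIV g" and hol: "(\<lambda>w. g (upd x j w)) holomorphic_on UNIV" for x j
    using g by (auto simp: g_def sep_hol_def)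
  show ?thesis
    unfolding sep_hol_def eq
  proof (intro conjI allI)
    show "continuous_on UNIV (\<lambda>x. g (upd x i 0) / fact k)"
      by (intro continuous_intros continuous_on_compose2[OF cont]) auto
    show "(\<lambda>w. g (upd (upd x j w) i 0) / fact k) holomorphic_on UNIV" for j x
      by (cases "j = i") (auto simp: upd_commute[of j i] hol intro!: holomorphic_intros)
  qed
qed

lemma taylor_coeff_bound:
  assumes f: "sep_hol f" and R: "0 < R" and M: "\<And>w. cmod w = R \<Longrightarrow> cmod (f (upd x i w)) \<le> M"
  shows "cmod (taylor_coeff i k f x) \<le> M / R ^ k"
proof -
  have hol: "(\<lambda>w. f (upd x i w)) holomorphic_on S" for S
    using f holomorphic_on_subset unfolding sep_hol_def by blast
  have "cmod ((deriv ^^ k) (\<lambda>w. f (upd x i w)) 0) \<le> fact k * M / R ^ k"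
    using R M by (intro Cauchy_inequality hol holomorphic_on_imp_continuous_on) auto
  then show ?thesis
    by (simp add: taylor_coeff_def norm_divide divide_le_eq mult.commute)
qed

lemma taylor_sums:
  assumes f: "sep_hol f"
  shows "(\<lambda>k. taylor_coeff i k f x * (x $ i) ^ k) sums f x"
proof -
  have "(\<lambda>w. f (upd x i w)) holomorphic_on ball 0 (cmod (x $ i) + 1)"
    using f holomorphic_on_subset unfolding sep_hol_def by blast
  from holomorphic_power_series[OF this, of "x $ i"] show ?thesis
    by (simp add: taylor_coeff_def)
qed

text \<open>Over a cube of exponents the sum factors into geometric sums, each at most 2.\<close>

lemma summable_half_mi_size: "(\<lambda>\<alpha> :: nat ^ 'n::finite. (1/2 :: real) ^ mi_size \<alpha>) summable_on UNIV"
proof (rule nonneg_bdd_above_summable_on)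
  show "bdd_above (sum (\<lambda>\<alpha> :: nat ^ 'n. (1/2 :: real) ^ mi_size \<alpha>) ` {F. F \<subseteq> UNIV \<and> finite F})"
  proof (rule bdd_aboveI2)
    fix A :: "(nat ^ 'n) set" assume "A \<in> {F. F \<subseteq> UNIV \<and> finite F}"
    then have A: "finite A" by simp
    obtain N where N: "\<And>\<alpha>. \<alpha> \<in> A \<Longrightarrow> mi_size \<alpha> \<le> N"
      using finite_nat_set_iff_bounded_le[of "mi_size ` A"] A by auto
    let ?P = "PiE (UNIV :: 'n set) (\<lambda>_. {..N})"
    have "A \<subseteq> vec_lambda ` ?P"
    proof
      fix \<alpha> assume "\<alpha> \<in> A"
      have "\<alpha> $ i \<le> N" for i
        using N[OF \<open>\<alpha> \<in> A\<close>] member_le_sum[of i UNIV "\<lambda>i. \<alpha> $ i"] by (auto simp: mi_size_def)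
      then show "\<alpha> \<in> vec_lambda ` ?P"
        by (intro image_eqI[of _ _ "\<lambda>i. \<alpha> $ i"]) auto
    qed
    moreover have fin: "finite ?P"
      by (intro finite_PiE) auto
    ultimately have "(\<Sum>\<alpha>\<in>A. (1/2 :: real) ^ mi_size \<alpha>) \<le> (\<Sum>\<alpha>\<in>vec_lambda ` ?P. (1/2) ^ mi_size \<alpha>)"
      by (intro sum_mono2) auto
    also have "\<dots> = (\<Sum>g\<in>?P. \<Prod>i\<in>UNIV. (1/2 :: real) ^ g i)"
      by (subst sum.reindex) (auto simp: inj_on_def vec_lambda_inject mi_size_def power_sum)
    also have "\<dots> = (\<Prod>i\<in>(UNIV :: 'n set). \<Sum>k\<in>{..N}. (1/2 :: real) ^ k)"
      by (rule prod_sum_PiE[symmetric]) auto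
    also have "\<dots> \<le> (\<Prod>i\<in>(UNIV :: 'n set). 2)"
    proof (intro prod_mono conjI sum_nonneg)
      have "(\<Sum>k\<in>{..N}. (1/2 :: real) ^ k) \<le> (\<Sum>k. (1/2) ^ k)"
        by (intro sum_le_suminf summable_geometric) auto
      then show "(\<Sum>k\<in>{..N}. (1/2 :: real) ^ k) \<le> 2"
        by (simp add: suminf_geometric)
    qed auto
    finally show "(\<Sum>\<alpha>\<in>A. (1/2 :: real) ^ mi_size \<alpha>) \<le> 2 ^ CARD('n)"
      by simp
  qed
qed simp

lemma cmod_mi_power_le: "(\<And>j. cmod (x $ j) \<le> r) \<Longrightarrow> cmod (mi_power \<alpha> x) \<le> r ^ mi_size \<alpha>"
  by (auto simp: mi_power_def mi_size_def prod_norm[symmetric] norm_power power_sum intro!: prod_mono power_mono)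

text \<open>Induction on the set \<open>S\<close> of coordinates on which \<open>f\<close> depends:
  the Taylor coefficients in a further coordinate \<open>i\<close> depend on \<open>S\<close> only
  and are expanded by the induction hypothesis. The Cauchy estimate on polydiscs is part of the
  induction, for it gives the absolute convergence needed to join the two summations.\<close>

lemma sep_hol_expansion_aux:
  fixes S :: "'n::finite set"
  assumes "finite S" and "sep_hol f" and "\<And>x. f x = f (\<chi> j. if j \<in> S then x $ j else 0)"
  shows "\<exists>c. (\<forall>R M. 0 < R \<longrightarrow> (\<forall>x. (\<forall>j. cmod (x $ j) \<le> R) \<longrightarrow> cmod (f x) \<le> M) \<longrightarrow> (\<forall>\<alpha>. cmod (c \<alpha>) * R ^ mi_size \<alpha> \<le> M)) \<and>
    (\<forall>x. ((\<lambda>\<alpha>. c \<alpha> * mi_power \<alpha> x) has_sum f x) {\<alpha>. \<forall>j. j \<notin> S \<longrightarrow> \<alpha> $ j = 0})"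
  using assms
proof (induction S arbitrary: f)
  case empty
  have "{\<alpha> :: nat ^ 'n. \<forall>j. j \<notin> {} \<longrightarrow> \<alpha> $ j = 0} = {0}"
    by (auto simp: vec_eq_iff)
  moreover have "f x = f 0" for x
    using empty.prems(2)[of x] by (simp add: zero_vec_def)
  moreover have "cmod (if \<alpha> = 0 then f 0 else 0) * R ^ mi_size \<alpha> \<le> M"
    if "0 < R" "\<And>x. (\<forall>j. cmod (x $ j) \<le> R) \<Longrightarrow> cmod (f x) \<le> M" for \<alpha> :: "nat ^ 'n" and R M
  proof -
    have "cmod (f 0) \<le> M"
      using that(2)[of 0] that(1) by simp
    then show ?thesis
      using norm_ge_zero[of "f 0"] by (cases "\<alpha> = 0") (auto simp: mi_size_def simp del: norm_ge_zero)
  qed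
  ultimately show ?case
    by (intro exI[of _ "\<lambda>\<alpha>. if \<alpha> = 0 then f 0 else 0"]) (auto intro!: has_sum_finiteI)
next
  case (insert i S)
  let ?A = "{\<alpha> :: nat ^ 'n. \<forall>j. j \<notin> S \<longrightarrow> \<alpha> $ j = 0}"
  let ?A' = "{\<alpha> :: nat ^ 'n. \<forall>j. j \<notin> insert i S \<longrightarrow> \<alpha> $ j = 0}"
  let ?D = "\<lambda>k. taylor_coeff i k f"
  have dep: "?D k x = ?D k (\<chi> j. if j \<in> S then x $ j else 0)" for k x
  proof -
    let ?y = "\<chi> j. if j \<in> S then x $ j else 0"
    have "f (upd x i w) = f (upd ?y i w)" for w
    proof -
      have "f (upd x i w) = f (\<chi> j. if j \<in> insert i S then upd x i w $ j else 0)"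
        by (rule insert.prems(2))
      also have "\<dots> = f (\<chi> j. if j \<in> insert i S then upd ?y i w $ j else 0)"
        by (rule arg_cong[of _ _ f]) (auto simp: vec_eq_iff)
      also have "\<dots> = f (upd ?y i w)"
        by (rule insert.prems(2)[symmetric])
      finally show ?thesis .
    qed
    then have "(\<lambda>w. f (upd x i w)) = (\<lambda>w. f (upd ?y i w))"
      by (rule ext)
    then show ?thesis
      unfolding taylor_coeff_def by (rule arg_cong[of _ _ "\<lambda>h. (deriv ^^ k) h 0 / fact k"])
  qed
  have "\<forall>k. \<exists>c. (\<forall>R M. 0 < R \<longrightarrow> (\<forall>x. (\<forall>j. cmod (x $ j) \<le> R) \<longrightarrow> cmod (?D k x) \<le> M) \<longrightarrow> (\<forall>\<alpha>. cmod (c \<alpha>) * R ^ mi_size \<alpha> \<le> M)) \<and>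
      (\<forall>x. ((\<lambda>\<alpha>. c \<alpha> * mi_power \<alpha> x) has_sum ?D k x) ?A)"
    using insert.IH[OF sep_hol_taylor_coeff[OF insert.prems(1)] dep] by blast
  from choice[OF this] obtain c
    where c_bound: "\<And>k R M \<alpha>. 0 < R \<Longrightarrow> (\<And>x. (\<forall>j. cmod (x $ j) \<le> R) \<Longrightarrow> cmod (?D k x) \<le> M) \<Longrightarrow> cmod (c k \<alpha>) * R ^ mi_size \<alpha> \<le> M"
      and c_sum: "\<And>k x. ((\<lambda>\<alpha>. c k \<alpha> * mi_power \<alpha> x) has_sum ?D k x) ?A"
    by blast
  \<comment> \<open>A multi-index is split into its entry at \<open>i\<close>, the order of the
    Taylor coefficient, and the rest, an index for the induction hypothesis.\<close>
  define drop where "drop \<alpha> = (\<chi> j. if j = i then 0 else \<alpha> $ j)" for \<alpha> :: "nat ^ 'n"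
  define d where "d \<alpha> = c (\<alpha> $ i) (drop \<alpha>)" for \<alpha>
  have drop: "\<alpha> = drop \<alpha> + axis i (\<alpha> $ i)" for \<alpha>
    by (simp add: drop_def vec_eq_iff axis_def)
  have size: "mi_size \<alpha> = mi_size (drop \<alpha>) + \<alpha> $ i" for \<alpha>
    using mi_size_add[of "drop \<alpha>" "axis i (\<alpha> $ i)"] drop[of \<alpha>] by simp
  have power: "mi_power \<alpha> x = mi_power (drop \<alpha>) x * (x $ i) ^ (\<alpha> $ i)" for \<alpha> x
    using mi_power_add[of "drop \<alpha>" "axis i (\<alpha> $ i)" x] drop[of \<alpha>] by (simp add: mi_power_axis)
  have bound: "cmod (d \<alpha>) * R ^ mi_size \<alpha> \<le> M"
    if R: "0 < R" and M: "\<And>x. (\<forall>j. cmod (x $ j) \<le> R) \<Longrightarrow> cmod (f x) \<le> M" for R M \<alpha>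
  proof -
    have "cmod (?D (\<alpha> $ i) x) \<le> M / R ^ (\<alpha> $ i)" if "\<forall>j. cmod (x $ j) \<le> R" for x
      using that R by (intro taylor_coeff_bound insert.prems(1) M) auto
    then have "cmod (c (\<alpha> $ i) (drop \<alpha>)) * R ^ mi_size (drop \<alpha>) \<le> M / R ^ (\<alpha> $ i)"
      by (intro c_bound R)
    then show ?thesis
      using R by (simp add: d_def size[of \<alpha>] power_add field_simps)
  qed
  have "((\<lambda>\<alpha>. d \<alpha> * mi_power \<alpha> x) has_sum f x) ?A'" for x
  proof -
    \<comment> \<open>The point lies in the polydisc of radius \<open>r\<close>, while the Cauchy
      estimate is used at radius \<open>2 * r\<close>; the quotient gives the factor
      \<open>1/2\<close> per degree.\<close>
    define r where "r = norm x + 1"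
    have r: "0 < r" "cmod (x $ j) \<le> r" for j
      using Finite_Cartesian_Product.norm_nth_le[of x j] by (auto simp: r_def add_nonneg_pos)
    obtain M where M: "\<And>y. norm y \<le> real CARD('n) * (2 * r) \<Longrightarrow> cmod (f y) \<le> M"
      using sep_hol_bounded[OF insert.prems(1)] by blast
    have M': "cmod (f y) \<le> M" if "\<forall>j. cmod (y $ j) \<le> 2 * r" for y
    proof (rule M)
      have "norm y \<le> (\<Sum>j\<in>UNIV. cmod (y $ j))"
        unfolding norm_vec_def by (rule L2_set_le_sum) simp
      also have "\<dots> \<le> (\<Sum>j\<in>(UNIV :: 'n set). 2 * r)"
        using that by (intro sum_mono) auto
      finally show "norm y \<le> real CARD('n) * (2 * r)" by simp
    qed
    have term_le: "cmod (d \<alpha> * mi_power \<alpha> x) \<le> M * (1/2) ^ mi_size \<alpha>" for \<alpha>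
    proof -
      have "cmod (d \<alpha> * mi_power \<alpha> x) \<le> cmod (d \<alpha>) * r ^ mi_size \<alpha>"
        using r by (simp add: norm_mult mult_left_mono cmod_mi_power_le)
      also have "\<dots> = cmod (d \<alpha>) * (2 * r) ^ mi_size \<alpha> * (1/2) ^ mi_size \<alpha>"
        by (simp add: power_mult_distrib power_one_over)
      also have "\<dots> \<le> M * (1/2) ^ mi_size \<alpha>"
        using r by (intro mult_right_mono bound M') auto
      finally show ?thesis .
    qed
    have "(\<lambda>\<alpha>. cmod (d \<alpha> * mi_power \<alpha> x)) summable_on ?A'"
    proof (rule Infinite_Sum.abs_summable_on_comparison_test'[OF _ term_le])
      show "(\<lambda>\<alpha>. M * (1/2) ^ mi_size \<alpha>) summable_on ?A'"
        by (intro summable_on_cmult_right summable_on_subset_banach[OF summable_half_mi_size]) auto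
    qed
    then have summable: "(\<lambda>\<alpha>. d \<alpha> * mi_power \<alpha> x) summable_on ?A'"
      by (rule abs_summable_summable)
    let ?g = "\<lambda>(k, \<alpha>). c k \<alpha> * mi_power \<alpha> x * (x $ i) ^ k"
    \<comment> \<open>The sum \<open>s\<close> is left free: the equivalence transfers summability
      to the product index set and then the computed sum back.\<close>
    have reindex: "((\<lambda>\<alpha>. d \<alpha> * mi_power \<alpha> x) has_sum s) ?A' \<longleftrightarrow> (?g has_sum s) (UNIV \<times> ?A)" for s
    proof (rule has_sum_reindex_bij_witness[of _ "\<lambda>(k, \<alpha>). \<alpha> + axis i k" "\<lambda>\<alpha>. (\<alpha> $ i, drop \<alpha>)"])
      show "?g (\<alpha> $ i, drop \<alpha>) = d \<alpha> * mi_power \<alpha> x" for \<alpha>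
        by (simp add: d_def power[of \<alpha>])
    qed (use insert.hyps(2) in \<open>auto simp: drop_def vec_eq_iff axis_def\<close>)
    have outer: "((\<lambda>k. ?D k x * (x $ i) ^ k) has_sum f x) UNIV"
    proof (rule norm_summable_imp_has_sum[OF _ taylor_sums[OF insert.prems(1)]])
      show "summable (\<lambda>k. norm (?D k x * (x $ i) ^ k))"
      proof (rule summable_comparison_test')
        show "summable (\<lambda>k. M * (1/2) ^ k :: real)"
          by (intro summable_mult summable_geometric) auto
        fix k :: nat
        have "cmod (?D k x) \<le> M / (2 * r) ^ k"
          using r by (intro taylor_coeff_bound insert.prems(1) M') (auto intro: order_trans[OF r(2)])
        moreover from this have "0 \<le> M / (2 * r) ^ k"
          by (rule order_trans[OF norm_ge_zero])
        ultimately have "cmod (?D k x) * cmod (x $ i) ^ k \<le> M / (2 * r) ^ k * r ^ k"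
          using r by (intro mult_mono power_mono) auto
        also have "\<dots> = M * (1/2) ^ k"
          using r(1) by (simp add: power_mult_distrib power_one_over)
        finally show "norm (norm (?D k x * (x $ i) ^ k)) \<le> M * (1/2) ^ k"
          by (simp add: norm_mult norm_power)
      qed
    qed
    have "(?g has_sum f x) (Sigma UNIV (\<lambda>_. ?A))"
    proof (rule has_sum_SigmaI[OF _ outer])
      show "((\<lambda>\<alpha>. ?g (k, \<alpha>)) has_sum ?D k x * (x $ i) ^ k) ?A" for k
        using has_sum_cmult_left[OF c_sum[of k x], of "(x $ i) ^ k"] by simp
      show "?g summable_on Sigma UNIV (\<lambda>_. ?A)"
        using summable reindex unfolding summable_on_def by blast
    qed
    then show ?thesis
      by (rule reindex[THEN iffD2])
  qed
  then show ?case
    using bound by blast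
qed

lemma sep_hol_expansion:
  assumes "sep_hol f"
  obtains c where "\<And>x. ((\<lambda>\<alpha>. c \<alpha> * mi_power \<alpha> x) has_sum f x) UNIV"
  using sep_hol_expansion_aux[of UNIV f] assms by auto

section \<open>Uniqueness of the coefficients\<close>

lemma power_series_zero_imp_coeff_zero:
  fixes a :: "nat \<Rightarrow> complex"
  assumes "\<And>w. (\<lambda>k. a k * w ^ k) sums 0"
  shows "a k = 0"
proof (rule ccontr)
  assume k: "a k \<noteq> 0"
  have "a 0 = 0"
    using assms[of 0] unfolding powser_sums_zero_iff .
  with k have "0 < k"
    by (cases k) auto
  \<comment> \<open>A nonzero coefficient would keep the sum, here the zero function, away from 0 on
    a punctured disc.\<close>
  show False
  proof (rule powser_0_nonzero[of 1 0 a "\<lambda>_. 0" k])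
    fix s :: real assume s: "0 < s" and nz: "\<And>z. z \<in> cball (0::complex) s - {0} \<Longrightarrow> (0::complex) \<noteq> 0"
    show False
      using nz[of "of_real s"] s by simp
  qed (use assms k \<open>0 < k\<close> in auto)
qed

text \<open>Exponents are fixed one coordinate at a time: grouping the terms by the exponent of
  \<open>x $ i\<close> gives a one-variable power series that vanishes identically, so every group
  sums to 0. For \<open>S = UNIV\<close> a single coefficient is left.\<close>

lemma mi_expansion_unique_aux:
  fixes S :: "'n::finite set"
  assumes "finite S" and zero: "\<And>x. ((\<lambda>\<alpha>. e \<alpha> * mi_power \<alpha> x) has_sum 0) UNIV"
  shows "((\<lambda>\<alpha>. e \<alpha> * (\<Prod>j\<in>-S. (x $ j) ^ (\<alpha> $ j))) has_sum (0 :: complex)) {\<alpha>. \<forall>j\<in>S. \<alpha> $ j = \<beta> $ j}"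
  using assms(1)
proof (induction S arbitrary: x \<beta>)
  case empty
  then show ?case
    using zero[of x] by (simp add: mi_power_def)
next
  case (insert i S)
  let ?A = "{\<alpha> :: nat ^ 'n. \<forall>j\<in>S. \<alpha> $ j = \<beta> $ j}"
  let ?B = "\<lambda>k. {\<alpha> :: nat ^ 'n. (\<forall>j\<in>S. \<alpha> $ j = \<beta> $ j) \<and> \<alpha> $ i = k}"
  let ?t = "\<lambda>\<alpha>. e \<alpha> * (\<Prod>j\<in>-insert i S. (x $ j) ^ (\<alpha> $ j))"
  have split: "e \<alpha> * (\<Prod>j\<in>-S. (upd x i w $ j) ^ (\<alpha> $ j)) = ?t \<alpha> * w ^ (\<alpha> $ i)" for \<alpha> w
  proof -
    have "- S = insert i (- insert i S)"
      using insert.hyps(2) by auto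
    then have "(\<Prod>j\<in>-S. (upd x i w $ j) ^ (\<alpha> $ j)) = w ^ (\<alpha> $ i) * (\<Prod>j\<in>-insert i S. (upd x i w $ j) ^ (\<alpha> $ j))"
      by (simp add: prod.insert_remove)
    also have "(\<Prod>j\<in>-insert i S. (upd x i w $ j) ^ (\<alpha> $ j)) = (\<Prod>j\<in>-insert i S. (x $ j) ^ (\<alpha> $ j))"
      by (intro prod.cong) auto
    finally show ?thesis
      by (simp add: mult_ac)
  qed
  have sum0: "((\<lambda>\<alpha>. ?t \<alpha> * w ^ (\<alpha> $ i)) has_sum 0) ?A" for w
    using insert.IH[of "upd x i w" \<beta>] unfolding split .
  \<comment> \<open>At \<open>w = 1\<close> the factor belonging to coordinate \<open>i\<close>
    disappears.\<close>
  have "?t summable_on ?A"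
    using sum0[of 1] by (simp add: has_sum_imp_summable)
  then have "?t summable_on ?B k" for k
    by (rule summable_on_subset_banach) auto
  then have B: "(?t has_sum infsum ?t (?B k)) (?B k)" for k
    by (rule has_sum_infsum)
  have "(\<lambda>k. infsum ?t (?B k) * w ^ k) sums 0" for w
  proof -
    have "((\<lambda>(k, \<alpha>). ?t \<alpha> * w ^ k) has_sum 0) (Sigma UNIV ?B) \<longleftrightarrow> ((\<lambda>\<alpha>. ?t \<alpha> * w ^ (\<alpha> $ i)) has_sum 0) ?A"
      by (rule has_sum_reindex_bij_witness[of _ "\<lambda>\<alpha>. (\<alpha> $ i, \<alpha>)" snd]) auto
    with sum0[of w] have "((\<lambda>(k, \<alpha>). ?t \<alpha> * w ^ k) has_sum 0) (Sigma UNIV ?B)"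
      by simp
    then have "((\<lambda>k. infsum ?t (?B k) * w ^ k) has_sum 0) UNIV"
      by (rule has_sum_SigmaD) (use has_sum_cmult_left[OF B] in simp)
    then show ?thesis
      by (rule has_sum_imp_sums)
  qed
  then have "infsum ?t (?B (\<beta> $ i)) = 0"
    by (rule power_series_zero_imp_coeff_zero)
  with B[of "\<beta> $ i"] have "(?t has_sum 0) (?B (\<beta> $ i))"
    by simp
  also have "?B (\<beta> $ i) = {\<alpha>. \<forall>j\<in>insert i S. \<alpha> $ j = \<beta> $ j}"
    by auto
  finally show ?case .
qed

lemma mi_expansion_unique:
  fixes e :: "nat ^ 'n::finite \<Rightarrow> complex"
  assumes "\<And>x. ((\<lambda>\<alpha>. e \<alpha> * mi_power \<alpha> x) has_sum 0) UNIV"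
  shows "e \<beta> = 0"
proof -
  have "{\<alpha>. \<forall>j\<in>(UNIV :: 'n set). \<alpha> $ j = \<beta> $ j} = {\<beta>}"
    by (auto simp: vec_eq_iff)
  then have "(e has_sum 0) {\<beta>}"
    using mi_expansion_unique_aux[of UNIV e 0 \<beta>] assms by simp
  then show ?thesis
    by (simp add: has_sum_finite_iff)
qed

section \<open>Pairs of vectors as vectors indexed by a sum type\<close>

definition join :: "'a ^ 'd2 \<Rightarrow> 'a ^ 'd1 \<Rightarrow> 'a ^ ('d2::finite + 'd1::finite)" where
  "join a b = (\<chi> k. case k of Inl i \<Rightarrow> a $ i | Inr i \<Rightarrow> b $ i)"

definition left_part :: "'a ^ ('d2::finite + 'd1::finite) \<Rightarrow> 'a ^ 'd2" where
  "left_part x = (\<chi> i. x $ Inl i)"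

definition right_part :: "'a ^ ('d2::finite + 'd1::finite) \<Rightarrow> 'a ^ 'd1" where
  "right_part x = (\<chi> i. x $ Inr i)"

lemma join_parts [simp]:
  "left_part (join a b) = a" "right_part (join a b) = b" "join (left_part x) (right_part x) = x"
  by (auto simp: join_def left_part_def right_part_def vec_eq_iff split: sum.split)

lemma mi_power_join: "mi_power (join \<alpha>2 \<alpha>1) x = mi_power \<alpha>2 (left_part x) * mi_power \<alpha>1 (right_part x)"
  unfolding mi_power_def left_part_def right_part_def join_def
  by (subst UNIV_Plus_UNIV[symmetric], subst prod.Plus) (simp_all add: o_def)

lemma has_sum_join_iff:
  "((\<lambda>\<alpha>. c \<alpha> * mi_power \<alpha> x) has_sum s) UNIV \<longleftrightarrow>
   ((\<lambda>(\<alpha>2, \<alpha>1). c (join \<alpha>2 \<alpha>1) * mi_power \<alpha>2 (left_part x) * mi_power \<alpha>1 (right_part x)) has_sum s) UNIV"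
  by (rule has_sum_reindex_bij_witness[of _ "\<lambda>(\<alpha>2, \<alpha>1). join \<alpha>2 \<alpha>1" "\<lambda>\<alpha>. (left_part \<alpha>, right_part \<alpha>)"])
    (auto simp: mi_power_join[symmetric] mult.assoc)

abbreviation norm_const :: "nat ^ 'd2::finite \<Rightarrow> nat ^ 'd1::finite \<Rightarrow> complex" where
  "norm_const \<alpha>2 \<alpha>1 \<equiv> complex_of_real (sqrt (mi_fact \<alpha>2)) * complex_of_real (sqrt (mi_fact \<alpha>1))"

lemma mi_fact_nonzero [simp]: "mi_fact \<alpha> \<noteq> 0"
  using mi_fact_pos[of \<alpha>] by linarith

text \<open>Restricting to a line parallel to a coordinate axis turns the complex linear Frechet
  derivative into an ordinary complex derivative, so the kernel is separately holomorphic and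
  continuous.\<close>

lemma ex_expands:
  fixes K :: "(complex ^ 'd2::finite) \<times> (complex ^ 'd1::finite) \<Rightarrow> complex"
  assumes "K \<in> entire_kernels"
  shows "\<exists>c. expands c K"
proof -
  define f where "f = (\<lambda>(z2, z1). K (z2, cnj_vec z1))"
  have f: "\<And>z. \<exists>f'. (f has_derivative f') (at z) \<and> (\<forall>a v2 v1. f' (a *s v2, a *s v1) = a * f' (v2, v1))"
    using assms unfolding entire_kernels_def entire_def f_def mem_Collect_eq by blast
  define g where "g x = f (left_part x, right_part x)" for x
  have "sep_hol g"
    unfolding sep_hol_def
  proof (intro conjI allI)
    have "continuous_on UNIV f"
      using f has_derivative_continuous by (blast intro: continuous_at_imp_continuous_on)
    moreover have "continuous_on UNIV (\<lambda>x :: complex ^ ('d2 + 'd1). (left_part x, right_part x))"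
      unfolding left_part_def right_part_def by (intro continuous_intros)
    ultimately show "continuous_on UNIV g"
      unfolding g_def by (rule continuous_on_compose2) simp
    fix k :: "'d2 + 'd1" and x
    show "(\<lambda>w. g (upd x k w)) holomorphic_on UNIV"
      unfolding holomorphic_on_def
    proof
      fix w
      let ?a = "left_part (upd x k 0)" and ?b = "right_part (upd x k 0)"
      let ?u = "left_part (axis k 1) :: complex ^ 'd2" and ?v = "right_part (axis k 1) :: complex ^ 'd1"
      let ?l = "\<lambda>w. (?a + w *s ?u, ?b + w *s ?v)"
      have line: "(left_part (upd x k w), right_part (upd x k w)) = ?l w" for w
        by (auto simp: left_part_def right_part_def vec_eq_iff axis_def)
      obtain f' where f': "(f has_derivative f') (at (?l w))" "\<And>a v2 v1. f' (a *s v2, a *s v1) = a * f' (v2, v1)"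
        using f[of "?l w"] by blast
      let ?L = "\<lambda>h :: complex. (h *s ?u, h *s ?v)"
      have "linear ?L"
        by (rule linearI) (simp_all add: vec_eq_iff distrib_right)
      then have "(?L has_derivative ?L) (at w)"
        by (intro bounded_linear_imp_has_derivative) (simp add: linear_conv_bounded_linear)
      from has_derivative_add[OF has_derivative_const[of "(?a, ?b)"] this]
      have "(?l has_derivative ?L) (at w)"
        by simp
      then have "((\<lambda>w. f (?l w)) has_derivative (\<lambda>h. f' (h *s ?u, h *s ?v))) (at w)"
        using f'(1) by (rule has_derivative_compose)
      \<comment> \<open>This is where complex linearity enters: the derivative along the line
        becomes multiplication by one number.\<close>
      then have "((\<lambda>w. f (?l w)) has_derivative (\<lambda>h. f' (?u, ?v) * h)) (at w)"
        by (simp add: f'(2) mult.commute)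
      then have "((\<lambda>w. g (upd x k w)) has_field_derivative f' (?u, ?v)) (at w)"
        unfolding has_field_derivative_def g_def line .
      then show "(\<lambda>w. g (upd x k w)) field_differentiable at w within UNIV"
        unfolding field_differentiable_def by auto
    qed
  qed
  then obtain c where c: "\<And>x. ((\<lambda>\<alpha>. c \<alpha> * mi_power \<alpha> x) has_sum g x) UNIV"
    using sep_hol_expansion by blast
  have "expands (\<lambda>(\<alpha>2, \<alpha>1). c (join \<alpha>2 \<alpha>1) * norm_const \<alpha>2 \<alpha>1) K"
    unfolding expands_def
  proof (intro allI)
    fix z2 :: "complex ^ 'd2" and z1 :: "complex ^ 'd1"
    have eq: "(\<lambda>(\<alpha>2, \<alpha>1). (\<lambda>(\<alpha>2, \<alpha>1). c (join \<alpha>2 \<alpha>1) * norm_const \<alpha>2 \<alpha>1) (\<alpha>2, \<alpha>1) * herm \<alpha>2 z2 * herm \<alpha>1 (cnj_vec z1))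
        = (\<lambda>(\<alpha>2, \<alpha>1). c (join \<alpha>2 \<alpha>1) * mi_power \<alpha>2 z2 * mi_power \<alpha>1 (cnj_vec z1))"
      by (auto simp: fun_eq_iff herm_eq)
    show "((\<lambda>(\<alpha>2, \<alpha>1). (\<lambda>(\<alpha>2, \<alpha>1). c (join \<alpha>2 \<alpha>1) * norm_const \<alpha>2 \<alpha>1) (\<alpha>2, \<alpha>1) * herm \<alpha>2 z2 * herm \<alpha>1 (cnj_vec z1))
        has_sum K (z2, z1)) UNIV"
      using c[of "join z2 (cnj_vec z1)"] unfolding eq has_sum_join_iff
      by (simp add: g_def f_def)
  qed
  then show ?thesis
    by blast
qed

text \<open>The difference of the two series sums to 0 everywhere; dividing its coefficients by the
  normalisation gives an ordinary power series with vanishing sum.\<close>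

lemma expands_unique:
  assumes "expands c K" "expands d K"
  shows "c = d"
proof -
  define e where "e \<alpha> = (c (left_part \<alpha>, right_part \<alpha>) - d (left_part \<alpha>, right_part \<alpha>)) / norm_const (left_part \<alpha>) (right_part \<alpha>)" for \<alpha>
  have "((\<lambda>\<alpha>. e \<alpha> * mi_power \<alpha> x) has_sum 0) UNIV" for x
  proof -
    let ?t = "\<lambda>c (\<alpha>2, \<alpha>1). c (\<alpha>2, \<alpha>1) * herm \<alpha>2 (left_part x) * herm \<alpha>1 (right_part x)"
    have "(?t c has_sum K (left_part x, cnj_vec (right_part x))) UNIV" "(?t d has_sum K (left_part x, cnj_vec (right_part x))) UNIV"
      using assms[unfolded expands_def, THEN spec, THEN spec, of "left_part x" "cnj_vec (right_part x)"]
      by simp_all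
    then have "((\<lambda>\<alpha>. ?t c \<alpha> + - ?t d \<alpha>) has_sum K (left_part x, cnj_vec (right_part x)) + - K (left_part x, cnj_vec (right_part x))) UNIV"
      by (intro has_sum_add has_sum_uminusI)
    moreover have "(\<lambda>(\<alpha>2, \<alpha>1). e (join \<alpha>2 \<alpha>1) * mi_power \<alpha>2 (left_part x) * mi_power \<alpha>1 (right_part x)) = (\<lambda>\<alpha>. ?t c \<alpha> + - ?t d \<alpha>)"
      by (auto simp: fun_eq_iff e_def herm_eq left_diff_distrib diff_divide_distrib)
    ultimately show ?thesis
      unfolding has_sum_join_iff by simp
  qed
  then have "e \<alpha> = 0" for \<alpha>
    by (rule mi_expansion_unique)
  then have "e (join \<alpha>2 \<alpha>1) = 0" for \<alpha>2 \<alpha>1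
    by blast
  then show ?thesis
    by (auto simp: e_def fun_eq_iff)
qed

lemma series_of_eq: "expands c K \<Longrightarrow> series_of K = c"
  unfolding series_of_def using expands_unique by (intro the_equality)

text \<open>The two conjugations cancel, leaving a polynomial, and polynomials are built from
  constants and coordinates by sums and products. These kernels are the test elements for uniqueness
  of the extension.\<close>

lemma entire_kernels_finite_series:
  fixes c :: "('d2::finite, 'd1::finite) kernel_series"
  assumes "finite A"
  defines "K \<equiv> \<lambda>(z2, z1). \<Sum>(\<alpha>2, \<alpha>1)\<in>A. c (\<alpha>2, \<alpha>1) * herm \<alpha>2 z2 * herm \<alpha>1 (cnj_vec z1)"
  shows "K \<in> entire_kernels" and "expands (\<lambda>\<alpha>. if \<alpha> \<in> A then c \<alpha> else 0) K"
proof -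
  define E where "E f \<longleftrightarrow> (\<forall>z. \<exists>f'. (f has_derivative f') (at z) \<and>
     (\<forall>a v2 v1. f' (a *s v2, a *s v1) = a * f' (v2, v1)))" for f :: "(complex ^ 'd2) \<times> (complex ^ 'd1) \<Rightarrow> complex"
  have const: "E (\<lambda>_. a)" for a
    unfolding E_def by (intro allI exI[of _ "\<lambda>_. 0"]) simp
  have add: "E (\<lambda>z. f z + g z)" if fg: "E f" "E g" for f g
    unfolding E_def
  proof
    fix z
    obtain f' where "(f has_derivative f') (at z)" "\<And>a v2 v1. f' (a *s v2, a *s v1) = a * f' (v2, v1)"
      using fg(1)[unfolded E_def, THEN spec[of _ z]] by blast
    moreover obtain g' where "(g has_derivative g') (at z)" "\<And>a v2 v1. g' (a *s v2, a *s v1) = a * g' (v2, v1)"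
      using fg(2)[unfolded E_def, THEN spec[of _ z]] by blast
    ultimately show "\<exists>h'. ((\<lambda>z. f z + g z) has_derivative h') (at z) \<and> (\<forall>a v2 v1. h' (a *s v2, a *s v1) = a * h' (v2, v1))"
      by (intro exI[of _ "\<lambda>h. f' h + g' h"]) (auto intro: has_derivative_add simp: distrib_left)
  qed
  have mult: "E (\<lambda>z. f z * g z)" if fg: "E f" "E g" for f g
    unfolding E_def
  proof
    fix z
    obtain f' where "(f has_derivative f') (at z)" "\<And>a v2 v1. f' (a *s v2, a *s v1) = a * f' (v2, v1)"
      using fg(1)[unfolded E_def, THEN spec[of _ z]] by blast
    moreover obtain g' where "(g has_derivative g') (at z)" "\<And>a v2 v1. g' (a *s v2, a *s v1) = a * g' (v2, v1)"
      using fg(2)[unfolded E_def, THEN spec[of _ z]] by blast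
    ultimately show "\<exists>h'. ((\<lambda>z. f z * g z) has_derivative h') (at z) \<and> (\<forall>a v2 v1. h' (a *s v2, a *s v1) = a * h' (v2, v1))"
      by (intro exI[of _ "\<lambda>h. f z * g' h + f' h * g z"] conjI has_derivative_mult) (auto simp: algebra_simps)
  qed
  have coord: "E (\<lambda>z. fst z $ i)" "E (\<lambda>z. snd z $ j)" for i j
  proof -
    have "((\<lambda>z :: (complex ^ 'd2) \<times> (complex ^ 'd1). fst z $ i) has_derivative (\<lambda>h. fst h $ i)) (at z)"
      "((\<lambda>z :: (complex ^ 'd2) \<times> (complex ^ 'd1). snd z $ j) has_derivative (\<lambda>h. snd h $ j)) (at z)" for z
      by (auto intro!: bounded_linear.has_derivative[OF bounded_linear_vec_nth] derivative_eq_intros)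
    note deriv = this
    show "E (\<lambda>z. fst z $ i)"
      unfolding E_def by (intro allI exI conjI, rule deriv(1)) simp
    show "E (\<lambda>z. snd z $ j)"
      unfolding E_def by (intro allI exI conjI, rule deriv(2)) simp
  qed
  have power: "E (\<lambda>z. f z ^ n)" if "E f" for f n
    by (induction n) (auto intro: const mult that)
  have prod: "E (\<lambda>z. \<Prod>i\<in>I. f i z)" if "finite I" "\<And>i. E (f i)" for f and I :: "'i set"
    using that by (induction I) (auto intro: const mult)
  have sum: "E (\<lambda>z. \<Sum>i\<in>I. f i z)" if "finite I" "\<And>i. E (f i)" for f and I :: "'i set"
    using that by (induction I) (auto intro: const add)
  have "E (\<lambda>z. \<Sum>\<alpha>\<in>A. c \<alpha> * ((\<Prod>i\<in>UNIV. (fst z $ i) ^ (fst \<alpha> $ i)) * (1 / complex_of_real (sqrt (mi_fact (fst \<alpha>))))) *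
      ((\<Prod>i\<in>UNIV. (snd z $ i) ^ (snd \<alpha> $ i)) * (1 / complex_of_real (sqrt (mi_fact (snd \<alpha>))))))"
    by (intro sum assms const mult prod power coord) auto
  then show "K \<in> entire_kernels"
    by (simp add: entire_kernels_def entire_def E_def K_def herm_def case_prod_unfold)
  show "expands (\<lambda>\<alpha>. if \<alpha> \<in> A then c \<alpha> else 0) K"
    unfolding expands_def K_def using assms(1)
    by (auto intro!: has_sum_finite_neutralI[of A] sum.cong)
qed

section \<open>The pullback on formal series\<close>

text \<open>Every output coefficient is a finite combination of input coefficients.\<close>

lemma continuous_on_mat_op: "continuous_on UNIV (mat_op F m)"
  unfolding mat_op_def by (intro continuous_on_coordinatewise_then_product continuous_intros continuous_on_product_coordinates)

lemma continuous_extension_mat_op: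
  fixes B2 :: "complex ^ 'd2::finite ^ 'd2" and B1 :: "complex ^ 'd1::finite ^ 'd1"
  assumes "blocks F2" "blocks F1" "represents B2 F2 m2" "represents (cnj_mat B1) F1 m1"
  shows "continuous_extension B2 B1 (mat_op (tens_blocks F2 F1) (tens_mat m2 m1))"
  unfolding continuous_extension_def
proof (intro conjI ballI continuous_on_mat_op)
  fix K :: "(complex ^ 'd2) \<times> (complex ^ 'd1) \<Rightarrow> complex" assume "K \<in> entire_kernels"
  then obtain c where c: "expands c K"
    using ex_expands by blast
  show "mat_op (tens_blocks F2 F1) (tens_mat m2 m1) (series_of K) = series_of (pullback B2 B1 K)"
    using expands_pullback[OF assms c] c by (simp add: series_of_eq)
qed

lemma tendsto_fun_iff:
  fixes f :: "'c \<Rightarrow> 'a \<Rightarrow> 'b::topological_space"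
  shows "(f \<longlongrightarrow> l) F \<longleftrightarrow> (\<forall>x. ((\<lambda>c. f c x) \<longlongrightarrow> l x) F)"
  using limitin_componentwise[of "\<lambda>_. euclidean" UNIV f l F] by (simp add: euclidean_product_topology)

text \<open>Polynomial kernels have the finitely supported series, which are dense.\<close>

lemma continuous_extension_unique:
  fixes B2 :: "complex ^ 'd2::finite ^ 'd2" and B1 :: "complex ^ 'd1::finite ^ 'd1"
  assumes T: "continuous_extension B2 B1 T" and U: "continuous_extension B2 B1 U"
  shows "T = U"
proof
  fix c :: "('d2, 'd1) kernel_series"
  let ?c = "\<lambda>A \<alpha>. if \<alpha> \<in> A then c \<alpha> else 0"
  let ?F = "finite_subsets_at_top UNIV"
  have agree: "T (?c A) = U (?c A)" if "finite A" for A
    using T U entire_kernels_finite_series[OF that, of c] unfolding continuous_extension_def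
    by (metis (no_types, lifting) series_of_eq)
  have lim: "(?c \<longlongrightarrow> c) ?F"
    unfolding tendsto_fun_iff
  proof
    fix \<alpha>
    \<comment> \<open>The truncation agrees with \<open>c\<close> at \<open>\<alpha>\<close> as soon
      as \<open>A\<close> contains \<open>\<alpha>\<close>.\<close>
    have "eventually (\<lambda>A. ?c A \<alpha> = c \<alpha>) ?F"
      unfolding eventually_finite_subsets_at_top by (intro exI[of _ "{\<alpha>}"]) auto
    then show "((\<lambda>A. ?c A \<alpha>) \<longlongrightarrow> c \<alpha>) ?F"
      by (rule tendsto_eventually)
  qed
  have "((\<lambda>A. T (?c A)) \<longlongrightarrow> T c) ?F" "((\<lambda>A. U (?c A)) \<longlongrightarrow> U c) ?F"
    using T U unfolding continuous_extension_def
    by (auto intro!: continuous_on_tendsto_compose[OF _ lim, of UNIV])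
  moreover have "eventually (\<lambda>A. T (?c A) = U (?c A)) ?F"
    using agree unfolding eventually_finite_subsets_at_top by blast
  ultimately have "((\<lambda>A. U (?c A)) \<longlongrightarrow> T c) ?F" "((\<lambda>A. U (?c A)) \<longlongrightarrow> U c) ?F"
    by (auto dest: tendsto_cong)
  then have "((\<lambda>A. U (?c A) \<beta>) \<longlongrightarrow> T c \<beta>) ?F" "((\<lambda>A. U (?c A) \<beta>) \<longlongrightarrow> U c \<beta>) ?F" for \<beta>
    unfolding tendsto_fun_iff by blast+
  then show "T c = U c"
    using tendsto_unique[OF finite_subsets_at_top_neq_bot] by blast
qed

text \<open>By uniqueness any admissible choice of blocks describes the same map. This freedom
  allows singleton blocks in a variable that is not substituted.\<close>

lemma formal_pullback_eq:
  assumes "blocks F2" "blocks F1" "represents B2 F2 m2" "represents (cnj_mat B1) F1 m1"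
  shows "formal_pullback B2 B1 = mat_op (tens_blocks F2 F1) (tens_mat m2 m1)"
  unfolding formal_pullback_def
  by (intro the_equality continuous_extension_mat_op[OF assms] continuous_extension_unique[OF _ continuous_extension_mat_op[OF assms]])

theorem theorem6p1:
  fixes s1 s2 :: gs_index
    and B2 :: "complex ^ 'd2::finite ^ 'd2" and B1 :: "complex ^ 'd1::finite ^ 'd1"
  assumes "s1 \<in> flat_indices" and "s2 \<in> flat_indices"
  shows
    "(\<exists>!T. continuous_extension B2 B1 T) \<and>
     ((s1 < Num (1/2) \<longrightarrow>
         (\<forall>X\<in>spaces_R s2 s1. continuous_map X X (formal_pullback (mat 1 :: complex ^ 'd2 ^ 'd2) B1))) \<and>
      (Num 0 < s1 \<and> s1 \<le> Num (1/2) \<longrightarrow>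
         (\<forall>X\<in>spaces_B s2 s1. continuous_map X X (formal_pullback (mat 1 :: complex ^ 'd2 ^ 'd2) B1)))) \<and>
     ((s2 < Num (1/2) \<longrightarrow>
         (\<forall>X\<in>spaces_R s2 s1. continuous_map X X (formal_pullback B2 (mat 1 :: complex ^ 'd1 ^ 'd1)))) \<and>
      (Num 0 < s2 \<and> s2 \<le> Num (1/2) \<longrightarrow>
         (\<forall>X\<in>spaces_B s2 s1. continuous_map X X (formal_pullback B2 (mat 1 :: complex ^ 'd1 ^ 'd1))))) \<and>
     ((s1 < Num (1/2) \<and> s2 < Num (1/2) \<longrightarrow>
         (\<forall>X\<in>spaces_R s2 s1. continuous_map X X (formal_pullback B2 B1))) \<and>
      (Num 0 < s1 \<and> s1 \<le> Num (1/2) \<and> Num 0 < s2 \<and> s2 \<le> Num (1/2) \<longrightarrow>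
         (\<forall>X\<in>spaces_B s2 s1. continuous_map X X (formal_pullback B2 B1))))"
proof -
  obtain m2 C2 where m2: "1 \<le> C2" "represents B2 mi_blocks m2" "bounded_blocks mi_blocks m2 (\<lambda>\<alpha>. C2 ^ mi_size \<alpha>)"
    by (rule ex_represents)
  obtain m1 C1 where m1: "1 \<le> C1" "represents (cnj_mat B1) mi_blocks m1" "bounded_blocks mi_blocks m1 (\<lambda>\<alpha>. C1 ^ mi_size \<alpha>)"
    by (rule ex_represents)
  have id: "represents (cnj_mat (mat 1)) (\<lambda>\<alpha>. {\<alpha>}) id_mat"
    by (simp add: represents_mat_1)
  have bl: "blocks (\<lambda>\<alpha>. {\<alpha>})"
    by (simp add: blocks_def)
  note eqs = formal_pullback_eq[OF bl blocks_mi_blocks represents_mat_1 m1(2)]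
    formal_pullback_eq[OF blocks_mi_blocks bl m2(2) id]
    formal_pullback_eq[OF blocks_mi_blocks blocks_mi_blocks m2(2) m1(2)]
  \<comment> \<open>Singleton blocks cost no factor, so \<open>r' = r\<close> works for every index
    \<open>s\<close>.\<close>
  have idR: "\<exists>r'. 0 < r' \<and> r' \<le> r \<and> (s = Num 0 \<longrightarrow> r' = r) \<and> dominated (\<lambda>\<alpha> :: nat ^ 'n::finite. {\<alpha>}) (\<lambda>_. 1) (wt r s) (wt r' s)"
    if "0 < r" for r s
    using that by (intro exI[of _ r]) (auto simp: dominated_id simp del: wt.simps)
  have idB: "\<exists>r'. r \<le> r' \<and> dominated (\<lambda>\<alpha> :: nat ^ 'n::finite. {\<alpha>}) (\<lambda>_. 1) (wt r' s) (wt r s)" for r s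
    by (intro exI[of _ r]) (auto simp: dominated_id simp del: wt.simps)
  have matR: "\<exists>r'. 0 < r' \<and> r' \<le> r \<and> (s = Num 0 \<longrightarrow> r' = r) \<and>
      dominated mi_blocks (\<lambda>\<alpha> :: nat ^ 'n::finite. C ^ mi_size \<alpha>) (wt r s) (wt r' s)"
    if "1 \<le> C" "s \<in> flat_indices" "s < Num (1/2)" "0 < r" for C r s
    using dominated_dilate_down[OF that] by metis
  have matB: "\<exists>r'. r \<le> r' \<and> dominated mi_blocks (\<lambda>\<alpha> :: nat ^ 'n::finite. C ^ mi_size \<alpha>) (wt r' s) (wt r s)"
    if "1 \<le> C" "s \<in> flat_indices" "Num 0 < s" "s \<le> Num (1/2)" "0 < r" for C r s
    using dominated_dilate_up[OF that] by metis
  have ex1: "\<exists>!T. continuous_extension B2 B1 T"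
    using continuous_extension_mat_op[OF blocks_mi_blocks blocks_mi_blocks m2(2) m1(2)] continuous_extension_unique
    by blast
  show ?thesis
    unfolding eqs
  proof (intro conjI impI ballI ex1; (elim conjE)?)
    show "continuous_map X X (mat_op (tens_blocks (\<lambda>\<alpha>. {\<alpha>}) mi_blocks) (tens_mat id_mat m1))"
      if "s1 < Num (1/2)" "X \<in> spaces_R s2 s1" for X
      using that m1(1) assms by (intro continuous_map_spaces_R[OF bounded_blocks_id m1(3)] idR matR)
    show "continuous_map X X (mat_op (tens_blocks (\<lambda>\<alpha>. {\<alpha>}) mi_blocks) (tens_mat id_mat m1))"
      if "Num 0 < s1" "s1 \<le> Num (1/2)" "X \<in> spaces_B s2 s1" for X
      using that m1(1) assms by (intro continuous_map_spaces_B[OF bounded_blocks_id m1(3)] idB matB)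
    show "continuous_map X X (mat_op (tens_blocks mi_blocks (\<lambda>\<alpha>. {\<alpha>})) (tens_mat m2 id_mat))"
      if "s2 < Num (1/2)" "X \<in> spaces_R s2 s1" for X
      using that m2(1) assms by (intro continuous_map_spaces_R[OF m2(3) bounded_blocks_id] idR matR)
    show "continuous_map X X (mat_op (tens_blocks mi_blocks (\<lambda>\<alpha>. {\<alpha>})) (tens_mat m2 id_mat))"
      if "Num 0 < s2" "s2 \<le> Num (1/2)" "X \<in> spaces_B s2 s1" for X
      using that m2(1) assms by (intro continuous_map_spaces_B[OF m2(3) bounded_blocks_id] idB matB)
    show "continuous_map X X (mat_op (tens_blocks mi_blocks mi_blocks) (tens_mat m2 m1))"
      if "s1 < Num (1/2)" "s2 < Num (1/2)" "X \<in> spaces_R s2 s1" for X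
      using that m1(1) m2(1) assms by (intro continuous_map_spaces_R[OF m2(3) m1(3)] matR)
    show "continuous_map X X (mat_op (tens_blocks mi_blocks mi_blocks) (tens_mat m2 m1))"
      if "Num 0 < s1" "s1 \<le> Num (1/2)" "Num 0 < s2" "s2 \<le> Num (1/2)" "X \<in> spaces_B s2 s1" for X
      using that m1(1) m2(1) assms by (intro continuous_map_spaces_B[OF m2(3) m1(3)] matB)
  qed
qed

end
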